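(* For every integer $\ell\ge 1$, the permutation class $\operatorname{Av}(24153, 31524, \ell(\ell-1)\cdots 21)$ is well-quasi-ordered under the permutation containment order. Consequently, for every $\ell$, the class of (finite) permutation graphs that contain neither the path $P_5$ nor the clique $K_\ell$ as an induced subgraph is well-quasi-ordered under the induced subgraph order.
   Context: A permutation $\pi=\pi(1)\cdots\pi(n)$ contains $\sigma=\sigma(1)\cdots\sigma(k)$, written $\sigma\le\pi$, if there are indices $i_1<\cdots<i_k$ such that $\pi(i_1)\cdots\pi(i_k)$ is order isomorphic to $\sigma$. For a set $B$ of permutations, $\operatorname{Av}(B)$ is the set of all permutations containing no element of $B$; $\ell(\ell-1)\cdots 21$ denotes the decreasing permutation of length $\ell$. A set of permutations (or graphs) closed downward under the relevant order is well-quasi-ordered if it contains no infinite antichain (infinite set of pairwise incomparable elements). The permutation graph $G_\pi$ of a permutation $\pi$ of length $n$ has vertex set $\{1,\dots,n\}$, with $i<j$ adjacent if and only if $\pi(i)>\pi(j)$; a permutation graph is any graph isomorphic to some $G_\pi$. *)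

theory Defs
  imports "HOL-Combinatorics.Multiset_Permutations" "Graph_Theory.Graph_Theory"
begin

text \<open>A permutation of length $n$ is its one-line notation, a list of the numbers $1,\dots,n$.
  List positions start at $0$, so $\pi(i)$ is \<open>\<pi> ! (i - 1)\<close>.\<close>

definition is_perm :: "nat list \<Rightarrow> bool" where
  "is_perm \<pi> \<longleftrightarrow> \<pi> \<in> permutations_of_set {1..length \<pi>}"

definition order_isomorphic :: "nat list \<Rightarrow> nat list \<Rightarrow> bool" where
  "order_isomorphic xs ys \<longleftrightarrow> length xs = length ys \<and>
     (\<forall>i<length xs. \<forall>j<length xs. xs ! i < xs ! j \<longleftrightarrow> ys ! i < ys ! j)"

definition perm_le :: "nat list \<Rightarrow> nat list \<Rightarrow> bool" where
  "perm_le \<sigma> \<pi> \<longleftrightarrow> (\<exists>f. strict_mono_on {..<length \<sigma>} f \<and> f ` {..<length \<sigma>} \<subseteq> {..<length \<pi>} \<and>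
     order_isomorphic (map (\<lambda>k. \<pi> ! f k) [0..<length \<sigma>]) \<sigma>)"

definition Av :: "nat list set \<Rightarrow> nat list set" where
  "Av B = {\<pi>. is_perm \<pi> \<and> (\<forall>\<beta>\<in>B. \<not> perm_le \<beta> \<pi>)}"

definition decreasing_perm :: "nat \<Rightarrow> nat list" where
  "decreasing_perm l = rev [1..<Suc l]"

text \<open>Both orders considered are on finite objects and hence well-founded, so that
  well-quasi-order amounts to the absence of infinite antichains.  The relation \<open>le\<close> may be
  a mere quasi-order (induced subgraph containment of graphs is taken up to isomorphism);
  distinct equivalent elements are comparable and so never lie in a common antichain.\<close>

definition well_quasi_ordered :: "('a \<Rightarrow> 'a \<Rightarrow> bool) \<Rightarrow> 'a set \<Rightarrow> bool" where
  "well_quasi_ordered le A \<longleftrightarrow>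
     \<not> (\<exists>S\<subseteq>A. infinite S \<and> pairwise (\<lambda>x y. \<not> le x y \<and> \<not> le y x) S)"

text \<open>A finite simple graph is a finite, loop-free digraph with symmetric set of arcs
  (\<^locale>\<open>pair_graph\<close>): each edge $\{u,v\}$ is represented by the two arcs $(u,v)$ and $(v,u)$.\<close>

definition perm_graph :: "nat list \<Rightarrow> nat pair_pre_digraph" where
  "perm_graph \<pi> = \<lparr> pverts = {1..length \<pi>},
     parcs = {(i, j). i \<in> {1..length \<pi>} \<and> j \<in> {1..length \<pi>} \<and>
       (i < j \<and> \<pi> ! (i - 1) > \<pi> ! (j - 1) \<or> j < i \<and> \<pi> ! (j - 1) > \<pi> ! (i - 1))} \<rparr>"

definition permutation_graph :: "'a pair_pre_digraph \<Rightarrow> bool" where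
  "permutation_graph G \<longleftrightarrow> (\<exists>\<pi>. is_perm \<pi> \<and> digraph_iso (with_proj (perm_graph \<pi>)) (with_proj G))"

definition induced_subgraph_le :: "'a pair_pre_digraph \<Rightarrow> 'b pair_pre_digraph \<Rightarrow> bool" where
  "induced_subgraph_le G H \<longleftrightarrow>
     (\<exists>H'. induced_subgraph H' (with_proj H) \<and> digraph_iso (with_proj G) H')"

definition path_graph :: "nat \<Rightarrow> nat pair_pre_digraph" where
  "path_graph n = \<lparr> pverts = {1..n},
     parcs = {(i, j). i \<in> {1..n} \<and> j \<in> {1..n} \<and> (j = i + 1 \<or> i = j + 1)} \<rparr>"

end

theory Submission
  imports Defs "HOL-Library.Ramsey" "HOL-Library.Sublist" "HOL-Library.Disjoint_Sets"
begin

text \<open>A permutation is a finite set of points in the plane, and adjacency in its permutation graph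
  means that two points form an inversion.  The proof is by induction on the clique bound.

  A connected point set without induced \<open>P\<^sub>5\<close> is partitioned into as few proper connected intervals as
  possible; each interval has a smaller clique number, and the quotient \<open>H\<close> contains no proper
  connected interval.  In such an \<open>H\<close> the number of independent nontrivial connected sets is bounded:
  whatever splits a member of a maximal such family lies beyond a further member, and merging the two
  gives a large family whose members have a larger clique number.  Applied to pairs of colour classes
  this yields a grid of bounded size all of whose cells are increasing.

  Two cells in a common column are merged by the first coordinate and two cells in a common row by the
  second.  \<open>P\<^sub>5\<close>-freeness restricts how a cell can interact with both kinds of neighbours, so that
  propagating cuts through the cells moves monotonically along a diagonal and stops after boundedly
  many steps.  Afterwards all these linear orders are consistent, a common linear extension writes
  \<open>H\<close> as a word over a bounded alphabet, and Higman's lemma applies, with the intervals as labels.\<close>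

section \<open>Well-quasi-orders and Higman's lemma\<close>

text \<open>The obstacle is cyclic order information. A word fixes one linear order of the points,
  and decoding it requires that along both axes points sharing a strip appear in that order. In a
  grid whose cells interact around a cycle the row and column orders may contradict each other, so
  bounding the grid is not enough. What breaks the cycles is a local fact: a piece of a cell cannot
  be cut in position from a lower row and also in value from a column to its right, nor from above
  and from the left, since five of the points would induce P5. Leaving a piece along the other axis
  therefore keeps moving in one direction of the potential column minus row (\<open>diag\<close>).
  This potential takes at most \<open>2 * m + 1\<close> values, which stops the propagation of
  lines; its monotonicity also excludes closed walks. Only connected intervals are contracted. That
  keeps the induction among connected sets, and it suffices because the bound on independent
  families only needs outside points that split connected sets. Disconnected sets enter at the very
  end, as chains of components.\<close>

definition wqo_on :: "('a \<Rightarrow> 'a \<Rightarrow> bool) \<Rightarrow> 'a set \<Rightarrow> bool" where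
  "wqo_on P A \<longleftrightarrow> (\<forall>f::nat \<Rightarrow> 'a. (\<forall>i. f i \<in> A) \<longrightarrow> (\<exists>i j. i < j \<and> P (f i) (f j)))"

lemma wqo_onD:
  assumes "wqo_on P A" "\<And>i. f i \<in> A"
  obtains i j :: nat where "i < j" "P (f i) (f j)"
  using assms unfolding wqo_on_def by blast

lemma wqo_on_subset: "wqo_on P B \<Longrightarrow> A \<subseteq> B \<Longrightarrow> wqo_on P A"
  unfolding wqo_on_def by (meson subsetD)

text \<open>Ramsey's theorem for pairs: on an infinite homogeneous set the colour must be the good
  one, since otherwise the terms indexed by that set would contradict \<open>wqo_on\<close>.\<close>

lemma wqo_on_monotone_subseq:
  fixes f :: "nat \<Rightarrow> 'a"
  assumes "wqo_on P A" "\<And>i. f i \<in> A"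
  shows "\<exists>h::nat \<Rightarrow> nat. strict_mono h \<and> (\<forall>i j. i < j \<longrightarrow> P (f (h i)) (f (h j)))"
proof -
  \<comment> \<open>Colours are given to unordered pairs; \<open>Min\<close> and \<open>Max\<close>
    recover which index comes first.\<close>
  define col where "col X = (if P (f (Min X)) (f (Max X)) then 0 else 1::nat)" for X
  obtain Y t where Y: "infinite Y" "\<forall>x\<in>Y. \<forall>y\<in>Y. x \<noteq> y \<longrightarrow> col {x, y} = t"
    using Ramsey2[where Z = "UNIV :: nat set" and f = col and s = 2] by (force simp: col_def)
  have pair: "col {i, j} = (if P (f i) (f j) then 0 else 1)" if "i < j" for i j
    using that by (simp add: col_def)
  have colY: "(if P (f i) (f j) then 0 else 1) = t" if "i < j" "i \<in> Y" "j \<in> Y" for i j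
    using Y(2) pair[OF that(1)] that by auto
  let ?h = "enumerate Y"
  have h: "strict_mono ?h" "\<And>i. ?h i \<in> Y"
    using Y(1) by (auto simp: strict_mono_enumerate enumerate_in_set)
  have hh: "?h i < ?h j" if "i < j" for i j
    using h(1) that by (simp add: strict_mono_less)
  obtain i j where ij: "i < j" "P (f (?h i)) (f (?h j))"
    using wqo_onD[OF assms(1), of "\<lambda>i. f (?h i)"] assms(2) by blast
  then have "t = 0" using colY[OF hh[OF ij(1)]] h(2) by auto
  then have "P (f (?h i)) (f (?h j))" if "i < j" for i j
    using colY[OF hh[OF that]] h(2) by (metis zero_neq_one)
  then show ?thesis using h(1) by blast
qed

lemma finite_range_const_subseq:
  fixes g :: "nat \<Rightarrow> 'b"
  assumes "finite F" "\<And>i. g i \<in> F"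
  shows "\<exists>h::nat \<Rightarrow> nat. strict_mono h \<and> (\<forall>i j. g (h i) = g (h j))"
proof -
  have "finite (range g)" using assms by (meson finite_subset image_subsetI)
  then obtain a where "infinite {i. g i = g a}"
    using pigeonhole_infinite[of UNIV g] by auto
  then have "strict_mono (enumerate {i. g i = g a})" "\<And>i. enumerate {i. g i = g a} i \<in> {i. g i = g a}"
    using strict_mono_enumerate enumerate_in_set by blast+
  then show ?thesis by auto
qed

lemma wqo_on_Times:
  fixes F :: "'b set" and A :: "'a set"
  assumes "finite F" "wqo_on P A"
  shows "wqo_on (\<lambda>x y. fst x = fst y \<and> P (snd x) (snd y)) (F \<times> A)"
  unfolding wqo_on_def
proof (intro allI impI)
  fix f :: "nat \<Rightarrow> 'b \<times> 'a" assume f: "\<forall>i. f i \<in> F \<times> A"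
  then obtain h :: "nat \<Rightarrow> nat" where h: "strict_mono h" "\<And>i j. fst (f (h i)) = fst (f (h j))"
    using finite_range_const_subseq[OF assms(1), of "\<lambda>i. fst (f i)"] by (auto simp: mem_Times_iff)
  obtain i j where "i < j" "P (snd (f (h i))) (snd (f (h j)))"
    using wqo_onD[OF assms(2), of "\<lambda>i. snd (f (h i))"] f by (auto simp: mem_Times_iff)
  then show "\<exists>i j. i < j \<and> fst (f i) = fst (f j) \<and> P (snd (f i)) (snd (f j))"
    using h by (metis strict_mono_less)
qed

text \<open>Nash-Williams' minimal bad sequence, with \<open>closed\<close> expressing that badness
  is detected on finite prefixes. Stage \<open>n\<close> minimises term \<open>n\<close> among the
  bad sequences that keep the first \<open>n\<close> terms; the diagonal of the stages is
  \<open>m\<close>.\<close>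

lemma minimal_sequence:
  fixes bad :: "(nat \<Rightarrow> 'a) \<Rightarrow> bool" and size :: "'a \<Rightarrow> nat"
  assumes "bad f0"
    and closed: "\<And>m. (\<And>n. \<exists>f. bad f \<and> (\<forall>i\<le>n. f i = m i)) \<Longrightarrow> bad m"
  shows "\<exists>m. bad m \<and> (\<forall>n f. bad f \<and> (\<forall>i<n. f i = m i) \<longrightarrow> size (m n) \<le> size (f n))"
proof -
  define step where "step n f g \<longleftrightarrow> bad g \<and> (\<forall>i<n. g i = f i) \<and>
    (\<forall>h. bad h \<and> (\<forall>i<n. h i = f i) \<longrightarrow> size (g n) \<le> size (h n))" for n f g
  have ex: "\<exists>g. step n f g" if "bad f" for n f
    using ex_has_least_nat[of "\<lambda>g. bad g \<and> (\<forall>i<n. g i = f i)" f "\<lambda>g. size (g n)"] that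
    unfolding step_def by auto
  have "\<exists>F. \<forall>n. bad (F n) \<and> step n (F n) (F (Suc n))"
  proof (rule dependent_nat_choice)
    show "\<exists>f. bad f" using assms(1) by blast
    show "\<exists>g. bad g \<and> step n f g" if "bad f" for f n
      using ex[OF that, of n] unfolding step_def by blast
  qed
  then obtain F where F: "\<And>n. bad (F n)" "\<And>n. step n (F n) (F (Suc n))" by blast
  define m where "m n = F (Suc n) n" for n
  have agree: "F k i = m i" if "i < k" for i k
    using that
  proof (induction k)
    case (Suc k)
    show ?case
    proof (cases "i = k")
      case False
      then have "i < k" using Suc.prems by simp
      then show ?thesis using Suc.IH F(2)[of k] by (simp add: step_def)
    qed (simp add: m_def)
  qed simp
  have "bad m"
  proof (rule closed)
    fix n show "\<exists>f. bad f \<and> (\<forall>i\<le>n. f i = m i)"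
      using F(1) agree by (intro exI[of _ "F (Suc n)"]) auto
  qed
  moreover have "size (m n) \<le> size (f n)" if f: "bad f" "\<forall>i<n. f i = m i" for n f
  proof -
    have "\<forall>i<n. f i = F n i" using f(2) agree by simp
    then show ?thesis using F(2)[of n] f(1) unfolding step_def m_def by blast
  qed
  ultimately show ?thesis by blast
qed

text \<open>The heads of a minimal bad sequence have an increasing subsequence. Replacing all terms
  from its first index on by the tails along it keeps the sequence bad but shortens a term.\<close>

lemma higman:
  assumes "wqo_on P A"
  shows "wqo_on (list_emb P) (lists A)"
proof (rule ccontr)
  define bad where "bad f \<longleftrightarrow> (\<forall>i::nat. f i \<in> lists A) \<and> (\<forall>i j. i < j \<longrightarrow> \<not> list_emb P (f i) (f j))" for f
  assume "\<not> ?thesis"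
  then obtain f0 where "bad f0" unfolding bad_def wqo_on_def by auto
  have closed: "bad m" if ex: "\<And>n. \<exists>f. bad f \<and> (\<forall>i\<le>n. f i = m i)" for m
    unfolding bad_def
  proof (intro conjI allI impI)
    fix i show "m i \<in> lists A" using ex[of i] unfolding bad_def by (metis order_refl)
  next
    fix i j :: nat assume "i < j"
    then show "\<not> list_emb P (m i) (m j)"
      using ex[of j] unfolding bad_def by (metis order_refl less_imp_le)
  qed
  obtain m where m: "bad m"
    and min: "\<And>n f. bad f \<Longrightarrow> \<forall>i<n. f i = m i \<Longrightarrow> length (m n) \<le> length (f n)"
    using minimal_sequence[of bad f0 length, OF \<open>bad f0\<close> closed] by blast
  have ne: "m n \<noteq> []" for n
    using m unfolding bad_def by (metis lessI list_emb_Nil)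
  have "m n \<in> lists A" for n using m unfolding bad_def by blast
  then have mA: "hd (m n) \<in> A" "tl (m n) \<in> lists A" for n
    using ne[of n] by (cases "m n"; fastforce)+
  obtain h :: "nat \<Rightarrow> nat" where h: "strict_mono h" "\<And>i j. i < j \<Longrightarrow> P (hd (m (h i))) (hd (m (h j)))"
    using wqo_on_monotone_subseq[OF assms, of "\<lambda>n. hd (m n)"] mA by blast
  define f where "f i = (if i < h 0 then m i else tl (m (h (i - h 0))))" for i
  have "bad f"
    unfolding bad_def
  proof (intro conjI allI impI)
    fix i show "f i \<in> lists A" using m mA by (simp add: f_def bad_def)
  next
    fix i j :: nat assume ij: "i < j"
    consider "j < h 0" | "i < h 0" "h 0 \<le> j" | "h 0 \<le> i" by linarith
    then show "\<not> list_emb P (f i) (f j)"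
    proof cases
      case 1
      then show ?thesis using m ij by (simp add: f_def bad_def)
    next
      case 2
      have "list_emb P (m i) (tl (m (h (j - h 0)))) \<Longrightarrow> list_emb P (m i) (m (h (j - h 0)))"
        using ne by (metis list.collapse list_emb_Cons)
      moreover have "i < h (j - h 0)"
        using 2 h(1) by (meson le0 less_le_trans strict_mono_less_eq)
      ultimately show ?thesis using 2 m by (auto simp: f_def bad_def)
    next
      case 3
      then have l: "i - h 0 < j - h 0" using ij by simp
      then have "h (i - h 0) < h (j - h 0)" using h(1) by (simp add: strict_mono_less)
      moreover have "list_emb P (tl (m (h (i - h 0)))) (tl (m (h (j - h 0)))) \<Longrightarrow>
          list_emb P (m (h (i - h 0))) (m (h (j - h 0)))"
        using ne h(2)[OF l] by (metis list.collapse list_emb_Cons2)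
      ultimately show ?thesis using 3 ij m by (auto simp: f_def bad_def)
    qed
  qed
  then have "length (m (h 0)) \<le> length (f (h 0))" by (rule min) (simp add: f_def)
  then show False using ne[of "h 0"] by (cases "m (h 0)") (simp_all add: f_def)
qed

lemma list_emb_index_map:
  assumes "list_emb P xs ys"
  shows "\<exists>h. (\<forall>i j. i < j \<and> j < length xs \<longrightarrow> h i < h j) \<and>
    (\<forall>i<length xs. h i < length ys \<and> P (xs ! i) (ys ! h i))"
  using assms
proof (induction rule: list_emb.induct)
  case (list_emb_Nil ys)
  show ?case by simp
next
  case (list_emb_Cons xs ys y)
  then obtain h where h: "\<And>i j. i < j \<Longrightarrow> j < length xs \<Longrightarrow> h i < h j"
    "\<And>i. i < length xs \<Longrightarrow> h i < length ys \<and> P (xs ! i) (ys ! h i)" by blast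
  show ?case
    by (rule exI[of _ "\<lambda>i. Suc (h i)"]) (simp add: h)
next
  case (list_emb_Cons2 x y xs ys)
  then obtain h where h: "\<And>i j. i < j \<Longrightarrow> j < length xs \<Longrightarrow> h i < h j"
    "\<And>i. i < length xs \<Longrightarrow> h i < length ys \<and> P (xs ! i) (ys ! h i)" by blast
  let ?h = "case_nat 0 (\<lambda>i. Suc (h i))"
  have "?h i < ?h j" if "i < j" "j < length (x # xs)" for i j
    using that h(1) by (cases i; cases j) simp_all
  moreover have "?h i < length (y # ys) \<and> P ((x # xs) ! i) ((y # ys) ! ?h i)" if "i < length (x # xs)" for i
    using that h(2) list_emb_Cons2.hyps(1) by (cases i) simp_all
  ultimately show ?case by (intro exI[of _ ?h]) blast
qed

section \<open>Point sets and their encoding by words\<close>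

text \<open>Throughout, a boolean selects an axis: \<open>True\<close> the position and \<open>False\<close> the value, so that
  negation swaps the axes and most arguments are carried out once for both.\<close>

definition coord :: "bool \<Rightarrow> int \<times> int \<Rightarrow> int" where
  "coord d p = (if d then fst p else snd p)"

definition emb :: "(int \<times> int) set \<Rightarrow> (int \<times> int) set \<Rightarrow> bool" where
  "emb S T \<longleftrightarrow> (\<exists>f. f ` S \<subseteq> T \<and>
     (\<forall>p\<in>S. \<forall>q\<in>S. \<forall>d. coord d p < coord d q \<longleftrightarrow> coord d (f p) < coord d (f q)))"

text \<open>A letter is a number with a point set attached. The finite table settles all comparisons
  between different places of the word; comparisons inside one place are left to the attached
  set.\<close>

definition codes :: "(nat \<times> nat \<times> bool) set \<Rightarrow> (nat \<times> (int \<times> int) set) list \<Rightarrow> (int \<times> int) set \<Rightarrow> bool" where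
  "codes tab w S \<longleftrightarrow> S = \<Union> (snd ` set w) \<and>
     (\<forall>i j. i < j \<and> j < length w \<longrightarrow> (\<forall>p\<in>snd (w ! i). \<forall>q\<in>snd (w ! j). \<forall>d.
        coord d p \<noteq> coord d q \<and>
        (coord d p < coord d q \<longleftrightarrow> (fst (w ! i), fst (w ! j), d) \<in> tab)))"

lemma codesI:
  assumes "\<Union> (snd ` set w) = S"
    and "\<And>i j p q d. i < j \<Longrightarrow> j < length w \<Longrightarrow> p \<in> snd (w ! i) \<Longrightarrow> q \<in> snd (w ! j) \<Longrightarrow>
      coord d p \<noteq> coord d q \<and> (coord d p < coord d q \<longleftrightarrow> (fst (w ! i), fst (w ! j), d) \<in> tab)"
  shows "codes tab w S"
  unfolding codes_def by (intro conjI allI impI ballI) (use assms in blast)+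

text \<open>With a common table, a subword embedding already preserves comparisons across letters,
  so the embeddings of the attached sets can be glued.\<close>

lemma codes_emb:
  assumes w: "codes tab w S" and w': "codes tab w' S'"
    and le: "list_emb (\<lambda>x y. fst x = fst y \<and> emb (snd x) (snd y)) w w'"
  shows "emb S S'"
proof -
  obtain h where h: "\<And>i j. i < j \<Longrightarrow> j < length w \<Longrightarrow> h i < h j"
    "\<And>i. i < length w \<Longrightarrow> h i < length w' \<and> fst (w ! i) = fst (w' ! h i) \<and> emb (snd (w ! i)) (snd (w' ! h i))"
    using list_emb_index_map[OF le] by blast
  have "\<exists>e. e ` snd (w ! i) \<subseteq> snd (w' ! h i) \<and>
     (\<forall>p\<in>snd (w ! i). \<forall>q\<in>snd (w ! i). \<forall>d. coord d p < coord d q \<longleftrightarrow> coord d (e p) < coord d (e q))"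
    if "i < length w" for i
    using h(2)[OF that] unfolding emb_def by blast
  then obtain e where "\<forall>i<length w. e i ` snd (w ! i) \<subseteq> snd (w' ! h i) \<and>
     (\<forall>p\<in>snd (w ! i). \<forall>q\<in>snd (w ! i). \<forall>d. coord d p < coord d q \<longleftrightarrow> coord d (e i p) < coord d (e i q))"
    by metis
  then have e: "\<And>i p. i < length w \<Longrightarrow> p \<in> snd (w ! i) \<Longrightarrow> e i p \<in> snd (w' ! h i)"
    "\<And>i p q d. i < length w \<Longrightarrow> p \<in> snd (w ! i) \<Longrightarrow> q \<in> snd (w ! i) \<Longrightarrow>
       coord d p < coord d q \<longleftrightarrow> coord d (e i p) < coord d (e i q)"
    by blast+
  have "\<exists>i<length w. p \<in> snd (w ! i)" if "p \<in> S" for p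
    using that w unfolding codes_def by (force simp: in_set_conv_nth)
  then obtain ix where ix: "\<And>p. p \<in> S \<Longrightarrow> ix p < length w \<and> p \<in> snd (w ! ix p)" by metis
  have wD: "coord d p \<noteq> coord d q \<and> (coord d p < coord d q \<longleftrightarrow> (fst (w ! i), fst (w ! j), d) \<in> tab)"
    if "i < j" "j < length w" "p \<in> snd (w ! i)" "q \<in> snd (w ! j)" for i j p q d
    using w that unfolding codes_def by blast
  have w'D: "coord d p \<noteq> coord d q \<and> (coord d p < coord d q \<longleftrightarrow> (fst (w' ! i), fst (w' ! j), d) \<in> tab)"
    if "i < j" "j < length w'" "p \<in> snd (w' ! i)" "q \<in> snd (w' ! j)" for i j p q d
    using w' that unfolding codes_def by blast
  have cross: "coord d p \<noteq> coord d q \<and> coord d (e (ix p) p) \<noteq> coord d (e (ix q) q) \<and>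
      (coord d p < coord d q \<longleftrightarrow> coord d (e (ix p) p) < coord d (e (ix q) q))"
    if "p \<in> S" "q \<in> S" "ix p < ix q" for p q d
  proof -
    have i: "ix p < length w" "ix q < length w" "p \<in> snd (w ! ix p)" "q \<in> snd (w ! ix q)"
      using ix that by auto
    have "e (ix p) p \<in> snd (w' ! h (ix p))" "e (ix q) q \<in> snd (w' ! h (ix q))"
      using e(1) i by auto
    then show ?thesis
      using wD[OF that(3) i(2-4), of d] w'D[OF h(1)[OF that(3) i(2)], of "e (ix p) p" "e (ix q) q" d]
        h(2)[OF i(1)] h(2)[OF i(2)] by simp
  qed
  show ?thesis
    unfolding emb_def
  proof (intro exI[of _ "\<lambda>p. e (ix p) p"] conjI ballI allI)
    show "(\<lambda>p. e (ix p) p) ` S \<subseteq> S'"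
    proof
      fix y assume "y \<in> (\<lambda>p. e (ix p) p) ` S"
      then obtain p where "p \<in> S" "y = e (ix p) p" by blast
      then have "y \<in> snd (w' ! h (ix p))" "h (ix p) < length w'" using e(1) ix h(2) by auto
      then show "y \<in> S'" using w' unfolding codes_def by (metis UN_I nth_mem)
    qed
  next
    fix p q d assume pq: "p \<in> S" "q \<in> S"
    consider "ix p < ix q" | "ix p = ix q" | "ix q < ix p" by linarith
    then show "coord d p < coord d q \<longleftrightarrow> coord d (e (ix p) p) < coord d (e (ix q) q)"
    proof cases
      case 1
      then show ?thesis using cross pq by blast
    next
      case 2
      then show ?thesis using e(2)[of "ix p" p q d] ix[OF pq(1)] ix[OF pq(2)] by simp
    next
      case 3
      then show ?thesis using cross[of q p d] pq by linarith
    qed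
  qed
qed

text \<open>There are finitely many tables, so some subsequence shares one, and Higman's lemma
  applies to its words.\<close>

lemma wqo_on_coded:
  assumes "wqo_on emb Q"
  shows "wqo_on emb {S. \<exists>tab w. tab \<subseteq> {..<N::nat} \<times> {..<N} \<times> UNIV \<and> set w \<subseteq> {..<N} \<times> Q \<and> codes tab w S}"
  unfolding wqo_on_def
proof (intro allI impI)
  fix f :: "nat \<Rightarrow> (int \<times> int) set"
  assume f: "\<forall>i. f i \<in> {S. \<exists>tab w. tab \<subseteq> {..<N::nat} \<times> {..<N} \<times> UNIV \<and> set w \<subseteq> {..<N} \<times> Q \<and> codes tab w S}"
  then obtain tab w where c: "\<And>i. tab i \<subseteq> {..<N::nat} \<times> {..<N} \<times> UNIV" "\<And>i. set (w i) \<subseteq> {..<N} \<times> Q"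
    "\<And>i. codes (tab i) (w i) (f i)" unfolding mem_Collect_eq by metis
  have "finite (Pow ({..<N::nat} \<times> {..<N} \<times> (UNIV :: bool set)))" by simp
  then obtain h :: "nat \<Rightarrow> nat" where h: "strict_mono h" "\<And>i j. tab (h i) = tab (h j)"
    using finite_range_const_subseq[of "Pow ({..<N::nat} \<times> {..<N} \<times> (UNIV :: bool set))" tab] c(1)
    by blast
  have "wqo_on (list_emb (\<lambda>x y. fst x = fst y \<and> emb (snd x) (snd y))) (lists ({..<N} \<times> Q))"
    by (intro higman wqo_on_Times assms) simp
  then obtain i j where ij: "i < j"
    "list_emb (\<lambda>x y. fst x = fst y \<and> emb (snd x) (snd y)) (w (h i)) (w (h j))"
    using wqo_onD[of _ _ "\<lambda>i. w (h i)"] c(2) by (metis (no_types, lifting) in_lists_conv_set subsetD)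
  then have "emb (f (h i)) (f (h j))"
    using codes_emb[OF c(3) _ ij(2), of "f (h j)"] c(3)[of "h j"] h(2)[of i j] by simp
  then show "\<exists>i j. i < j \<and> emb (f i) (f j)"
    using h(1) ij(1) by (meson strict_mono_less)
qed

section \<open>Inversions and connected point sets\<close>

text \<open>The coordinates \<open>c\<close> are a parameter, not fixed to \<open>coord\<close>, so
  that results also apply to the rotated coordinates \<open>rot c\<close>.\<close>

definition lt :: "(bool \<Rightarrow> 'p \<Rightarrow> int) \<Rightarrow> 'p \<Rightarrow> 'p \<Rightarrow> bool" where
  "lt c p q \<longleftrightarrow> (\<forall>d. c d p < c d q)"

definition adj :: "(bool \<Rightarrow> 'p \<Rightarrow> int) \<Rightarrow> 'p \<Rightarrow> 'p \<Rightarrow> bool" where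
  "adj c p q \<longleftrightarrow> (\<exists>d. c d p < c d q \<and> c (\<not> d) q < c (\<not> d) p)"

definition generic :: "(bool \<Rightarrow> 'p \<Rightarrow> int) \<Rightarrow> 'p set \<Rightarrow> bool" where
  "generic c S \<longleftrightarrow> finite S \<and> (\<forall>d. inj_on (c d) S)"

definition decreasing :: "(bool \<Rightarrow> 'p \<Rightarrow> int) \<Rightarrow> 'p set \<Rightarrow> bool" where
  "decreasing c K \<longleftrightarrow> (\<forall>p\<in>K. \<forall>q\<in>K. p \<noteq> q \<longrightarrow> adj c p q)"

definition ind_path :: "(bool \<Rightarrow> 'p \<Rightarrow> int) \<Rightarrow> 'p \<Rightarrow> 'p \<Rightarrow> 'p \<Rightarrow> 'p \<Rightarrow> 'p \<Rightarrow> bool" where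
  "ind_path c p q r s t \<longleftrightarrow> adj c p q \<and> adj c q r \<and> adj c r s \<and> adj c s t \<and>
     \<not> adj c p r \<and> \<not> adj c p s \<and> \<not> adj c p t \<and> \<not> adj c q s \<and> \<not> adj c q t \<and> \<not> adj c r t"

definition path_free :: "(bool \<Rightarrow> 'p \<Rightarrow> int) \<Rightarrow> 'p set \<Rightarrow> bool" where
  "path_free c S \<longleftrightarrow> (\<forall>p\<in>S. \<forall>q\<in>S. \<forall>r\<in>S. \<forall>s\<in>S. \<forall>t\<in>S. \<not> ind_path c p q r s t)"

definition bounded_class :: "nat \<Rightarrow> (bool \<Rightarrow> 'p \<Rightarrow> int) \<Rightarrow> 'p set \<Rightarrow> bool" where
  "bounded_class l c S \<longleftrightarrow> generic c S \<and> path_free c S \<and> \<not> (\<exists>K\<subseteq>S. card K = l \<and> decreasing c K)"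

text \<open>Connectedness of the inversion graph, phrased by cuts because the typical use extracts
  an edge leaving a chosen subset.\<close>

definition conn :: "(bool \<Rightarrow> 'p \<Rightarrow> int) \<Rightarrow> 'p set \<Rightarrow> bool" where
  "conn c A \<longleftrightarrow> A \<noteq> {} \<and> (\<forall>X\<subseteq>A. X \<noteq> {} \<and> X \<noteq> A \<longrightarrow> (\<exists>p\<in>X. \<exists>q\<in>A - X. adj c p q))"

text \<open>The point \<open>v\<close> splits \<open>A\<close> along axis \<open>d\<close>. An
  interval in the sense of permutations is a set split by no outside point along either
  axis.\<close>

definition between :: "(bool \<Rightarrow> 'p \<Rightarrow> int) \<Rightarrow> bool \<Rightarrow> 'p \<Rightarrow> 'p set \<Rightarrow> bool" where
  "between c d v A \<longleftrightarrow> (\<exists>a\<in>A. \<exists>b\<in>A. c d a < c d v \<and> c d v < c d b)"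

lemma all_bool: "(\<forall>d. P d) \<longleftrightarrow> P d0 \<and> P (\<not> d0)" for d0 :: bool
  by (cases d0) (auto simp: all_bool_eq)

lemma adj_sym: "adj c p q \<longleftrightarrow> adj c q p"
  unfolding adj_def by (auto simp: ex_bool_eq)

lemma adj_iff: "adj c p q \<longleftrightarrow>
   c d p < c d q \<and> c (\<not> d) q < c (\<not> d) p \<or> c d q < c d p \<and> c (\<not> d) p < c (\<not> d) q"
  unfolding adj_def by (cases d) (auto simp: ex_bool_eq)

lemma lt_iff: "lt c p q \<longleftrightarrow> c d p < c d q \<and> c (\<not> d) p < c (\<not> d) q"
  unfolding lt_def using all_bool[of "\<lambda>d. c d p < c d q" d] by simp

lemma adj_irrefl [simp]: "\<not> adj c p p" by (simp add: adj_def)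

lemma lt_trans: "lt c p q \<Longrightarrow> lt c q r \<Longrightarrow> lt c p r"
  unfolding lt_def by (meson less_trans)

lemma lt_not_adj: "lt c p q \<Longrightarrow> \<not> adj c p q" "lt c p q \<Longrightarrow> \<not> adj c q p"
  unfolding lt_def adj_def by (meson less_asym)+

lemma lt_asym: "lt c p q \<Longrightarrow> \<not> lt c q p" 
  unfolding lt_def by (meson less_asym)

lemma generic_subset: "generic c S \<Longrightarrow> T \<subseteq> S \<Longrightarrow> generic c T"
  unfolding generic_def by (meson finite_subset inj_on_subset)

lemma path_free_subset: "path_free c S \<Longrightarrow> T \<subseteq> S \<Longrightarrow> path_free c T"
  unfolding path_free_def by blast

lemma bounded_class_subset: "bounded_class l c S \<Longrightarrow> T \<subseteq> S \<Longrightarrow> bounded_class l c T"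
  unfolding bounded_class_def using generic_subset[of c S T] path_free_subset[of c S T] subset_trans[of _ T S]
  by blast

lemma genericD: "generic c S \<Longrightarrow> p \<in> S \<Longrightarrow> q \<in> S \<Longrightarrow> c d p = c d q \<Longrightarrow> p = q"
  unfolding generic_def inj_on_def by blast

lemma trichotomy:
  assumes "generic c S" "p \<in> S" "q \<in> S" "p \<noteq> q"
  shows "lt c p q \<or> lt c q p \<or> adj c p q"
proof -
  have "c True p \<noteq> c True q" "c False p \<noteq> c False q"
    using genericD[OF assms(1-3)] assms(4) by blast+
  then show ?thesis by (simp add: lt_iff[of _ _ _ True] adj_iff[of _ _ _ True]) linarith
qed

lemma nonadj_lt:
  assumes "generic c S" "p \<in> S" "q \<in> S" "\<not> adj c p q" "c d p < c d q"
  shows "lt c p q"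
  using trichotomy[OF assms(1-3)] assms(4,5) unfolding lt_def by (metis less_asym)

lemma path_freeD: "path_free c S \<Longrightarrow> p \<in> S \<Longrightarrow> q \<in> S \<Longrightarrow> r \<in> S \<Longrightarrow> s \<in> S \<Longrightarrow> t \<in> S \<Longrightarrow> \<not> ind_path c p q r s t"
  unfolding path_free_def by blast

lemma connD:
  assumes "conn c A" "X \<subseteq> A" "X \<noteq> {}" "X \<noteq> A"
  obtains p q where "p \<in> X" "q \<in> A" "q \<notin> X" "adj c p q"
  using assms unfolding conn_def by blast

lemma conn_singleton: "conn c {p}"
  unfolding conn_def by blast

lemma conn_Union:
  assumes "\<And>A. A \<in> F \<Longrightarrow> conn c A" "\<And>A. A \<in> F \<Longrightarrow> p \<in> A" "F \<noteq> {}"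
  shows "conn c (\<Union>F)"
  unfolding conn_def
proof (intro conjI allI impI)
  obtain B where "B \<in> F" using assms(3) by blast
  then show "\<Union>F \<noteq> {}" using assms(2)[of B] by blast
  fix X assume X: "X \<subseteq> \<Union>F" "X \<noteq> {} \<and> X \<noteq> \<Union>F"
  have "\<exists>A\<in>F. \<exists>a\<in>A. \<exists>b\<in>A. a \<in> X \<and> b \<notin> X"
  proof (cases "p \<in> X")
    case True
    obtain b A where "b \<notin> X" "A \<in> F" "b \<in> A" using X by blast
    then show ?thesis using True assms(2)[of A] by blast
  next
    case False
    obtain a A where "a \<in> X" "A \<in> F" "a \<in> A" using X by blast
    then show ?thesis using False assms(2)[of A] by blast
  qed
  then obtain A where A: "A \<in> F" "X \<inter> A \<noteq> {}" "X \<inter> A \<noteq> A" by blast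
  obtain a b where "a \<in> X \<inter> A" "b \<in> A" "b \<notin> X \<inter> A" "adj c a b"
    using connD[OF assms(1)[OF A(1)], of "X \<inter> A"] A(2,3) by blast
  then show "\<exists>p\<in>X. \<exists>q\<in>\<Union> F - X. adj c p q" using A(1) by blast
qed

lemma conn_Un_meet: "conn c A \<Longrightarrow> conn c B \<Longrightarrow> p \<in> A \<Longrightarrow> p \<in> B \<Longrightarrow> conn c (A \<union> B)"
  using conn_Union[of "{A, B}" c p] by auto

lemma conn_insert:
  assumes "conn c A" "a \<in> A" "adj c v a"
  shows "conn c (insert v A)"
proof -
  have "conn c {v, a}"
    unfolding conn_def
  proof (intro conjI allI impI)
    fix X assume "X \<subseteq> {v, a}" "X \<noteq> {} \<and> X \<noteq> {v, a}"
    then have "X = {v} \<or> X = {a}" by blast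
    then show "\<exists>p\<in>X. \<exists>q\<in>{v, a} - X. adj c p q"
    proof
      assume "X = {a}"
      moreover have "v \<noteq> a" using assms(3) by auto
      ultimately show ?thesis using assms(3) adj_sym[of c v a] by auto
    next
      assume "X = {v}"
      moreover have "v \<noteq> a" using assms(3) by auto
      ultimately show ?thesis using assms(3) by auto
    qed
  qed simp
  then show ?thesis
    using conn_Un_meet[OF _ assms(1), of "{v, a}" a] assms(2) by (simp add: insert_absorb)
qed

text \<open>If \<open>B\<close> had points on both sides of \<open>a\<close>, connectedness would
  give an edge between the sides, but such points are comparable through \<open>a\<close>.\<close>

lemma conn_lt:
  assumes "conn c B" "\<And>b. b \<in> B \<Longrightarrow> lt c a b \<or> lt c b a"
  shows "(\<forall>b\<in>B. lt c a b) \<or> (\<forall>b\<in>B. lt c b a)"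
proof (rule ccontr)
  assume neg: "\<not> ?thesis"
  let ?X = "{b \<in> B. lt c a b}"
  obtain p q where "p \<in> ?X" "q \<in> B" "q \<notin> ?X" "adj c p q"
    using connD[OF assms(1), of ?X] neg assms(2) by blast
  then show False
    using assms(2)[of q] lt_trans lt_not_adj by fastforce
qed

text \<open>The device for extending induced paths: a vertex adjacent to part of a connected set
  sees exactly one end of some edge in it.\<close>

lemma conn_mixed_edge:
  assumes "conn c A" "a \<in> A" "adj c v a" "b \<in> A" "\<not> adj c v b"
  obtains x y where "x \<in> A" "y \<in> A" "adj c v x" "\<not> adj c v y" "adj c x y"
proof -
  obtain p q where "p \<in> {z \<in> A. adj c v z}" "q \<in> A" "q \<notin> {z \<in> A. adj c v z}" "adj c p q"
    using connD[OF assms(1), of "{z \<in> A. adj c v z}"] assms by blast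
  then show thesis using that by blast
qed

lemma conn_edge:
  assumes "conn c A" "2 \<le> card A" "a \<in> A"
  obtains b where "b \<in> A" "adj c a b"
proof -
  have "A \<noteq> {a}" using assms(2) by auto
  then obtain p q where "p \<in> {a}" "q \<in> A" "q \<notin> {a}" "adj c p q"
    using connD[OF assms(1), of "{a}"] assms(3) by blast
  then show thesis using that by blast
qed

lemma conn_decreasing_pair:
  assumes "conn c A" "2 \<le> card A"
  shows "\<exists>Q\<subseteq>A. card Q = 2 \<and> decreasing c Q"
proof -
  obtain a where "a \<in> A" using assms unfolding conn_def by blast
  then obtain b where b: "b \<in> A" "adj c a b" using conn_edge assms by metis
  then have "a \<noteq> b" by auto
  then have "card {a, b} = 2" by simp
  moreover have "decreasing c {a, b}" using b adj_sym[of c a b] unfolding decreasing_def by auto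
  ultimately show ?thesis using \<open>a \<in> A\<close> b(1) by (intro exI[of _ "{a, b}"]) simp
qed

section \<open>Connected components of the inversion graph\<close>

definition component :: "(bool \<Rightarrow> 'p \<Rightarrow> int) \<Rightarrow> 'p set \<Rightarrow> 'p \<Rightarrow> 'p set" where
  "component c U p = \<Union>{A. A \<subseteq> U \<and> conn c A \<and> p \<in> A}"

lemma component_subset: "component c U p \<subseteq> U"
  unfolding component_def by blast

lemma component_self: "p \<in> U \<Longrightarrow> p \<in> component c U p"
  unfolding component_def using conn_singleton[of c p] by (intro UnionI[of "{p}"]) auto

lemma component_conn: "p \<in> U \<Longrightarrow> conn c (component c U p)"
  unfolding component_def using conn_singleton[of c p]
  by (intro conn_Union[where p = p]) auto

lemma component_maximal: "A \<subseteq> U \<Longrightarrow> conn c A \<Longrightarrow> p \<in> A \<Longrightarrow> A \<subseteq> component c U p"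
  unfolding component_def by blast

lemma component_eq:
  assumes "p \<in> U" "z \<in> component c U p"
  shows "component c U z = component c U p"
proof -
  have zU: "z \<in> U" using assms(2) component_subset[of c U p] by blast
  have 1: "component c U p \<subseteq> component c U z"
    using component_maximal[OF component_subset component_conn[OF assms(1)] assms(2)] .
  then have "p \<in> component c U z" using component_self[OF assms(1), of c] by blast
  then have "component c U z \<subseteq> component c U p"
    using component_maximal[OF component_subset component_conn[OF zU]] by blast
  then show ?thesis using 1 by blast
qed

lemma component_adj:
  assumes "p \<in> U" "q \<in> U" "adj c p q"
  shows "component c U p = component c U q"
proof -
  have "conn c {p, q}" using conn_insert[OF conn_singleton[of c q], of q p] assms(3) by simp
  then have "q \<in> component c U p" using component_maximal[of "{p, q}" U c p] assms by simp
  then show ?thesis using component_eq[OF assms(1), of q c] by simp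
qed

text \<open>Different components have no edge between them, so by \<open>conn_lt\<close> each point
  of one lies on a single side of the other; comparison with the fixed point \<open>q\<close> makes
  that side uniform.\<close>

lemma component_separated:
  assumes "generic c U" "p \<in> U" "q \<in> U" "component c U p \<noteq> component c U q"
  shows "(\<forall>a\<in>component c U p. \<forall>b\<in>component c U q. lt c a b) \<or> (\<forall>a\<in>component c U p. \<forall>b\<in>component c U q. lt c b a)"
proof -
  let ?A = "component c U p" and ?B = "component c U q"
  have ab: "lt c a b \<or> lt c b a" if "a \<in> ?A" "b \<in> ?B" for a b
  proof -
    have U: "a \<in> U" "b \<in> U" using that component_subset[of c U] by blast+
    have e: "component c U a = ?A" "component c U b = ?B"
      using component_eq[OF assms(2) that(1)] component_eq[OF assms(3) that(2)] by auto
    then have "a \<noteq> b" "\<not> adj c a b" using assms(4) component_adj[OF U] by auto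
    then show ?thesis using trichotomy[OF assms(1) U] by blast
  qed
  have side: "(\<forall>b\<in>?B. lt c a b) \<or> (\<forall>b\<in>?B. lt c b a)" if "a \<in> ?A" for a
    using conn_lt[OF component_conn[OF assms(3)], where a = a] ab[OF that] by blast
  have q: "q \<in> ?B" using component_self[OF assms(3)] .
  have "(\<forall>a\<in>?A. lt c q a) \<or> (\<forall>a\<in>?A. lt c a q)"
    using conn_lt[OF component_conn[OF assms(2)], where a = q] ab q by blast
  then show ?thesis
  proof
    assume h: "\<forall>a\<in>?A. lt c q a"
    have "\<forall>b\<in>?B. lt c b a" if "a \<in> ?A" for a
      using side[OF that] h that q lt_asym[of c q a] by blast
    then show ?thesis by blast
  next
    assume h: "\<forall>a\<in>?A. lt c a q"
    have "\<forall>b\<in>?B. lt c a b" if "a \<in> ?A" for a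
      using side[OF that] h that q lt_asym[of c a q] by blast
    then show ?thesis by blast
  qed
qed

section \<open>Bounding independent families of connected sets\<close>

definition before :: "(bool \<Rightarrow> 'p \<Rightarrow> int) \<Rightarrow> 'p set \<Rightarrow> 'p set \<Rightarrow> bool" where
  "before c A B \<longleftrightarrow> (\<forall>a\<in>A. \<forall>b\<in>B. lt c a b)"

text \<open>The number \<open>r\<close> drives the induction: merging members raises it, while the
  clique bound caps it.\<close>

definition block_family :: "(bool \<Rightarrow> 'p \<Rightarrow> int) \<Rightarrow> 'p set \<Rightarrow> nat \<Rightarrow> 'p set set \<Rightarrow> bool" where
  "block_family c H r F \<longleftrightarrow>
     (\<forall>A\<in>F. A \<subseteq> H \<and> conn c A \<and> (\<exists>Q\<subseteq>A. card Q = r \<and> decreasing c Q)) \<and>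
     (\<forall>A\<in>F. \<forall>B\<in>F. A \<noteq> B \<longrightarrow> before c A B \<or> before c B A)"

text \<open>No proper connected subset with at least two points is an interval. This is weaker than
  simplicity of a permutation, since disconnected intervals are allowed.\<close>

definition tight :: "(bool \<Rightarrow> 'p \<Rightarrow> int) \<Rightarrow> 'p set \<Rightarrow> bool" where
  "tight c H \<longleftrightarrow> (\<forall>A\<subseteq>H. conn c A \<and> 2 \<le> card A \<and> A \<noteq> H \<longrightarrow> (\<exists>v\<in>H - A. \<exists>d. between c d v A))"

text \<open>Half turn of the plane: it preserves adjacency and reverses \<open>lt\<close>, so
  arguments about sets lying above transfer to sets lying below.\<close>

abbreviation rot :: "(bool \<Rightarrow> 'p \<Rightarrow> int) \<Rightarrow> bool \<Rightarrow> 'p \<Rightarrow> int" where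
  "rot c \<equiv> (\<lambda>d p. - c d p)"

lemma before_less: "before c A B \<Longrightarrow> a \<in> A \<Longrightarrow> b \<in> B \<Longrightarrow> c d a < c d b"
  unfolding before_def lt_def by blast

lemma before_lt: "before c A B \<Longrightarrow> a \<in> A \<Longrightarrow> b \<in> B \<Longrightarrow> lt c a b"
  unfolding before_def by blast

lemma adj_rot: "adj (rot c) = adj c"
  by (intro ext) (auto simp: adj_iff[of _ _ _ True])

lemma lt_rot: "lt (rot c) p q \<longleftrightarrow> lt c q p"
  by (simp add: lt_def)

lemma conn_rot: "conn (rot c) = conn c"
  by (intro ext) (simp add: conn_def adj_rot)

lemma before_rot: "before (rot c) A B \<longleftrightarrow> before c B A"
  by (auto simp: before_def lt_rot)

lemma between_rot: "between (rot c) d v A \<longleftrightarrow> between c d v A"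
  by (auto simp: between_def)

lemma generic_rot: "generic (rot c) H \<longleftrightarrow> generic c H"
  by (simp add: generic_def inj_on_def)

lemma path_free_rot: "path_free (rot c) H \<longleftrightarrow> path_free c H"
  by (simp add: path_free_def ind_path_def adj_rot)

lemma decreasing_rot: "decreasing (rot c) = decreasing c"
  by (intro ext) (simp add: decreasing_def adj_rot)

lemma block_family_rot: "block_family (rot c) H r F \<longleftrightarrow> block_family c H r F"
  by (simp add: block_family_def conn_rot before_rot decreasing_rot disj_commute)

lemma decreasing_insert:
  assumes "decreasing c Q" "\<And>z. z \<in> Q \<Longrightarrow> adj c v z"
  shows "decreasing c (insert v Q)"
  using assms adj_sym[of c v] unfolding decreasing_def by auto

lemma decreasing_card_less:
  assumes "bounded_class l c H" "K \<subseteq> H" "decreasing c K"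
  shows "card K < l"
proof (rule ccontr)
  assume "\<not> ?thesis"
  then obtain K' where "K' \<subseteq> K" "card K' = l"
    using obtain_subset_with_card_n[of l K] by (metis not_less)
  then show False using assms unfolding bounded_class_def decreasing_def by blast
qed

text \<open>The colour of a point is the size of a largest decreasing set ending there in position.
  An inversion extends such a set, so its ends get different colours, and every such size is below
  \<open>l\<close>.\<close>

lemma coloring:
  assumes "bounded_class l c H"
  obtains col :: "'p \<Rightarrow> nat" where "\<And>p. p \<in> H \<Longrightarrow> col p < l"
    "\<And>p q. p \<in> H \<Longrightarrow> q \<in> H \<Longrightarrow> adj c p q \<Longrightarrow> col p \<noteq> col q"
proof -
  have fin: "finite H" using assms by (simp add: bounded_class_def generic_def)
  define P where "P p = {K. K \<subseteq> H \<and> p \<in> K \<and> decreasing c K \<and> (\<forall>q\<in>K. c True q \<le> c True p)}" for p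
  define col where "col p = Max (card ` P p)" for p
  have finP: "finite (card ` P p)" for p
    using fin unfolding P_def by (intro finite_imageI) (metis (no_types, lifting) finite_Collect_subsets finite_subset mem_Collect_eq subsetI)
  have neP: "card ` P p \<noteq> {}" if "p \<in> H" for p
  proof -
    have "{p} \<in> P p" using that by (simp add: P_def decreasing_def)
    then show ?thesis by blast
  qed
  have step: "col p < col q" if pq: "p \<in> H" "q \<in> H" "adj c p q" "c True p < c True q" for p q
  proof -
    obtain K where K: "K \<in> P p" "card K = col p"
      using Max_in[OF finP neP[OF pq(1)]] unfolding col_def by (metis imageE)
    have f: "c False q < c False p" using pq(3,4) adj_iff[of c p q True] by simp
    have "q \<notin> K" using K(1) pq(4) unfolding P_def by force
    have "adj c k q" if "k \<in> K" for k
    proof (cases "k = p")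
      case False
      then have "adj c k p" "c True k \<le> c True p" using K(1) that by (auto simp: P_def decreasing_def)
      then have "c True k < c True p \<and> c False p < c False k" using adj_iff[of c k p True] by simp
      then show ?thesis using f pq(4) adj_iff[of c k q True] by simp
    qed (use pq in simp)
    then have "insert q K \<in> P q"
      using K(1) pq adj_sym[of c q] unfolding P_def decreasing_def by force
    then have "card (insert q K) \<le> col q"
      unfolding col_def by (intro Max_ge finP imageI)
    moreover have "finite K" using K(1) fin finite_subset unfolding P_def by blast
    ultimately show ?thesis using K(2) \<open>q \<notin> K\<close> by simp
  qed
  show thesis
  proof (rule that[of col])
    fix p assume p: "p \<in> H"
    obtain K where K: "K \<in> P p" "card K = col p"
      using Max_in[OF finP neP[OF p]] unfolding col_def by (metis imageE)
    then show "col p < l" using decreasing_card_less[OF assms, of K] by (simp add: P_def)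
  next
    fix p q assume pq: "p \<in> H" "q \<in> H" "adj c p q"
    then have "c True p < c True q \<or> c True q < c True p" by (auto simp: adj_iff[of c p q True])
    then show "col p \<noteq> col q" using step[of p q] step[of q p] pq adj_sym[of c p q] by auto
  qed
qed

text \<open>All of \<open>A\<close> is below \<open>v\<close> on axis \<open>\<not> d\<close>, so
  splitting \<open>A\<close> along \<open>d\<close> yields an edge \<open>x y\<close> of
  \<open>A\<close> with only \<open>x\<close> adjacent to \<open>v\<close>. If \<open>v\<close> saw
  only part of \<open>C\<close>, an edge \<open>s t\<close> of \<open>C\<close> with only
  \<open>s\<close> adjacent to \<open>v\<close> would complete the induced path
  \<open>y x v s t\<close>.\<close>

lemma up_complete:
  assumes "generic c H" "path_free c H" "A \<subseteq> H" "C \<subseteq> H" "v \<in> H" "conn c A" "conn c C" "before c A C"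
    and bet: "between c d v A" and b: "b \<in> C" "c (\<not> d) b < c (\<not> d) v"
  shows "\<forall>z\<in>C. c (\<not> d) z < c (\<not> d) v"
    and "\<exists>x\<in>A. \<exists>y\<in>A. adj c v x \<and> lt c y v \<and> adj c x y"
proof -
  obtain a1 a2 where a: "a1 \<in> A" "a2 \<in> A" "c d a1 < c d v" "c d v < c d a2"
    using bet unfolding between_def by blast
  have dC: "c d v < c d z" if "z \<in> C" for z
    using a(4) before_less[OF assms(8) a(2) that, of d] by linarith
  have eA: "c (\<not> d) z < c (\<not> d) v" if "z \<in> A" for z
    using b(2) before_less[OF assms(8) that b(1), of "\<not> d"] by linarith
  have "lt c a1 v" "adj c v a2"
    using a eA[of a1] eA[of a2] lt_iff[of c a1 v d] adj_iff[of c v a2 d] by auto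
  then obtain x y where xy: "x \<in> A" "y \<in> A" "adj c v x" "\<not> adj c v y" "adj c x y"
    using conn_mixed_edge[OF assms(6) a(2) _ a(1)] lt_not_adj by metis
  then have "c d y \<le> c d v" using eA[of y] adj_iff[of c v y d] by linarith
  moreover have "c d y \<noteq> c d v" using genericD[OF assms(1), of y v d] assms(3,5) xy eA[of y] by auto
  ultimately have "lt c y v" using eA[of y] xy lt_iff[of c y v d] by simp
  then show "\<exists>x\<in>A. \<exists>y\<in>A. adj c v x \<and> lt c y v \<and> adj c x y" using xy by blast
  show "\<forall>z\<in>C. c (\<not> d) z < c (\<not> d) v"
  proof (rule ccontr)
    assume "\<not> ?thesis"
    then obtain z where z: "z \<in> C" "\<not> c (\<not> d) z < c (\<not> d) v" by blast
    have "\<not> adj c v z" using z dC[OF z(1)] adj_iff[of c v z d] by auto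
    moreover have "adj c v b" using b dC adj_iff[of c v b d] by auto
    ultimately obtain s t where st: "s \<in> C" "t \<in> C" "adj c v s" "\<not> adj c v t" "adj c s t"
      using conn_mixed_edge[OF assms(7) b(1) _ z(1)] by metis
    have n: "\<not> adj c p q" if "p \<in> A" "q \<in> C" for p q
      by (rule lt_not_adj(1)[OF before_lt[OF assms(8) that]])
    have "ind_path c y x v s t"
      unfolding ind_path_def using xy st n adj_sym[of c] by blast
    then show False using path_freeD[OF assms(2)] xy st assms(3-5) by blast
  qed
qed

text \<open>The splitter \<open>v A\<close> is adjacent to all of \<open>C A\<close>, so it joins
  \<open>C A\<close> to \<open>A\<close> and enlarges a clique by one. Merged sets stay ordered: if
  \<open>v A\<close> reached beyond a point of a later \<open>B\<close> in \<open>G\<close>, then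
  \<open>y x (v A) b2 (v B)\<close> would be an induced path, because the splitters are pairwise
  nonadjacent.\<close>

lemma merge_up:
  assumes gen: "generic c H" and pf: "path_free c H" and F: "block_family c H r F" and G: "G \<subseteq> F"
    and v: "\<And>A. A \<in> G \<Longrightarrow> v A \<in> H \<and> between c d (v A) A"
    and C: "\<And>A. A \<in> G \<Longrightarrow> C A \<in> F \<and> before c A (C A) \<and> (\<forall>b\<in>C A. c (\<not> d) b < c (\<not> d) (v A))"
    and nadj: "\<And>A B. A \<in> G \<Longrightarrow> B \<in> G \<Longrightarrow> \<not> adj c (v A) (v B)"
  shows "block_family c H (Suc r) ((\<lambda>A. insert (v A) (A \<union> C A)) ` G)"
    and "inj_on (\<lambda>A. insert (v A) (A \<union> C A)) G"
proof -
  define M where "M A = insert (v A) (A \<union> C A)" for A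
  have FH: "A \<subseteq> H" "conn c A" if "A \<in> F" for A using F that unfolding block_family_def by blast+
  have Fcmp: "before c A B \<or> before c B A" if "A \<in> F" "B \<in> F" "A \<noteq> B" for A B
    using F that unfolding block_family_def by simp
  have ne: "A \<noteq> {}" if "A \<in> F" for A using FH[OF that] unfolding conn_def by blast
  have bet: "\<exists>a\<in>A. \<exists>b\<in>A. c d a < c d (v A) \<and> c d (v A) < c d b" if "A \<in> G" for A
    using v[OF that] unfolding between_def by blast
  have adjC: "adj c (v A) z" if A: "A \<in> G" "z \<in> C A" for A z
  proof -
    obtain a where a: "a \<in> A" "c d (v A) < c d a" using bet[OF A(1)] by blast
    have "c d a < c d z" using before_less C[OF A(1)] A(2) a(1) by metis
    then show ?thesis using C[OF A(1)] A(2) a(2) adj_iff[of c "v A" z d] by auto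
  qed
  have dlt: "c (\<not> d) a < c (\<not> d) (v A)" if A: "A \<in> G" "a \<in> A" for A a
  proof -
    obtain z where z: "z \<in> C A" using ne C[OF A(1)] by blast
    have "c (\<not> d) a < c (\<not> d) z" using before_less C[OF A(1)] A(2) z by metis
    then show ?thesis using C[OF A(1)] z by force
  qed
  have sep: "before c (M A) (M B)" if AB: "A \<in> G" "B \<in> G" "before c A B" for A B
  proof -
    have AF: "A \<in> F" "B \<in> F" using AB G by blast+
    obtain a where a: "a \<in> A" "c d (v A) < c d a" using bet[OF AB(1)] by blast
    obtain b1 b2 where b: "b1 \<in> B" "b2 \<in> B" "c d b1 < c d (v B)" "c d (v B) < c d b2"
      using bet[OF AB(2)] by blast
    have vd: "c d (v A) < c d b" if "b \<in> B" for b
      using a(2) before_less[OF AB(3) a(1) that, of d] by linarith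
    have w: "adj c (v B) b2" using b dlt[OF AB(2) b(2)] adj_iff[of c "v B" b2 d] by auto
    have main: "c (\<not> d) (v A) < c (\<not> d) b" if "b \<in> B" for b
    proof (rule ccontr)
      assume "\<not> ?thesis"
      moreover have "c (\<not> d) (v A) \<noteq> c (\<not> d) b"
        using genericD[OF gen, of "v A" b "\<not> d"] v[OF AB(1)] FH(1)[OF AF(2)] that vd[OF that] by auto
      ultimately have b': "c (\<not> d) b < c (\<not> d) (v A)" by simp
      note uc = up_complete[OF gen pf FH(1)[OF AF(1)] FH(1)[OF AF(2)] _ FH(2)[OF AF(1)] FH(2)[OF AF(2)] AB(3) _ that b']
      have "c (\<not> d) b2 < c (\<not> d) (v A)" using uc(1) v[OF AB(1)] b(2) by blast
      then have vb: "adj c (v A) b2" using vd[OF b(2)] adj_iff[of c "v A" b2 d] by auto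
      obtain x y where xy: "x \<in> A" "y \<in> A" "adj c (v A) x" "lt c y (v A)" "adj c x y"
        using uc(2) v[OF AB(1)] by blast
      have "lt c z (v B)" if "z \<in> A" for z
      proof -
        have "lt c z b1" using before_lt[OF AB(3) that b(1)] .
        then show ?thesis
          using b(3) dlt[OF AB(2) b(1)] lt_iff[of c z b1 d] lt_iff[of c z "v B" d] by auto
      qed
      then have n: "\<not> adj c z (v B)" "\<not> adj c z b2" if "z \<in> A" for z
        using lt_not_adj(1) before_lt[OF AB(3) that b(2)] that by metis+
      have "ind_path c y x (v A) b2 (v B)"
        unfolding ind_path_def
        using xy n vb w lt_not_adj(1)[OF xy(4)] nadj[OF AB(1,2)] adj_sym[of c] by blast
      then show False
        using path_freeD[OF pf, of y x "v A" b2 "v B"] xy b(2) v AB FH(1)[OF AF(1)] FH(1)[OF AF(2)] by blast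
    qed
    \<comment> \<open>On axis \<open>\<not> d\<close> the set \<open>C A\<close> lies below
      \<open>v A\<close>, which lies below \<open>B\<close>; so \<open>C A\<close> can neither be
      \<open>B\<close> nor come after it.\<close>
    have "before c (C A) B"
    proof (rule ccontr)
      assume neg: "\<not> ?thesis"
      obtain z where z: "z \<in> C A" using ne C[OF AB(1)] by blast
      have zb: "c (\<not> d) z < c (\<not> d) b1" using main[OF b(1)] C[OF AB(1)] z by force
      have "C A \<noteq> B" using zb main C[OF AB(1)] b(1) by force
      then have "before c B (C A)" using Fcmp[of "C A" B] C[OF AB(1)] AF neg by simp
      then show False using zb before_less[OF _ b(1) z, of c "\<not> d"] by linarith
    qed
    then have xB: "lt c x b" if "x \<in> M A" "b \<in> B" for x b
      using that AB(3) main vd lt_iff[of c "v A" b d] unfolding M_def before_def by auto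
    show ?thesis
      unfolding before_def
    proof (intro ballI)
      fix x y assume x: "x \<in> M A" and "y \<in> M B"
      then consider "y \<in> B" | "y = v B" | "y \<in> C B" unfolding M_def by blast
      then show "lt c x y"
      proof cases
        case 2
        then show ?thesis using xB[OF x b(1)] b(3) dlt[OF AB(2) b(1)]
            lt_iff[of c x b1 d] lt_iff[of c x "v B" d] by auto
      next
        case 3
        then have "lt c b1 y" using C[OF AB(2)] b(1) before_lt by metis
        then show ?thesis using xB[OF x b(1)] lt_trans by metis
      qed (use xB x in blast)
    qed
  qed
  have cmp: "before c (M A) (M B) \<or> before c (M B) (M A)" if "A \<in> G" "B \<in> G" "A \<noteq> B" for A B
    using Fcmp[of A B] that G sep[of A B] sep[of B A] by blast
  have Mne: "\<not> before c (M A) (M A)" for A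
    using before_less[of c "M A" "M A" "v A" "v A"] unfolding M_def by auto
  show "inj_on (\<lambda>A. insert (v A) (A \<union> C A)) G"
    using cmp Mne unfolding inj_on_def M_def[symmetric] by metis
  have "M A \<subseteq> H \<and> conn c (M A) \<and> (\<exists>Q\<subseteq>M A. card Q = Suc r \<and> decreasing c Q)" if A: "A \<in> G" for A
  proof (intro conjI)
    have AF: "A \<in> F" "C A \<in> F" using A G C[OF A] by auto
    show "M A \<subseteq> H" using FH(1)[OF AF(1)] FH(1)[OF AF(2)] v[OF A] unfolding M_def by blast
    obtain a where a: "a \<in> A" "c d (v A) < c d a" using bet[OF A] by blast
    have "adj c (v A) a" using a dlt[OF A a(1)] adj_iff[of c "v A" a d] by auto
    then have 1: "conn c (insert (v A) A)" using conn_insert FH(2)[OF AF(1)] a(1) by metis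
    obtain z where z: "z \<in> C A" using ne AF by blast
    then have 2: "conn c (insert (v A) (C A))" using conn_insert[OF FH(2)[OF AF(2)] z] adjC[OF A] by metis
    have "M A = insert (v A) A \<union> insert (v A) (C A)" unfolding M_def by blast
    then show "conn c (M A)" using conn_Un_meet[OF 1 2, of "v A"] by simp
    obtain Q where Q: "Q \<subseteq> C A" "card Q = r" "decreasing c Q"
      using F AF unfolding block_family_def by blast
    have "finite Q" using Q(1) FH(1)[OF AF(2)] gen unfolding generic_def by (meson finite_subset)
    moreover have "v A \<notin> Q" using adjC[OF A, of "v A"] Q(1) by auto
    ultimately have "card (insert (v A) Q) = Suc r" using Q(2) by simp
    moreover have "decreasing c (insert (v A) Q)"
      using decreasing_insert[OF Q(3), of "v A"] adjC[OF A] Q(1) by blast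
    moreover have "insert (v A) Q \<subseteq> M A" using Q(1) unfolding M_def by blast
    ultimately show "\<exists>Q\<subseteq>M A. card Q = Suc r \<and> decreasing c Q" by blast
  qed
  then show "block_family c H (Suc r) ((\<lambda>A. insert (v A) (A \<union> C A)) ` G)"
    unfolding block_family_def M_def[symmetric]
  proof (intro conjI[OF ballI] ballI impI)
    fix B assume "B \<in> M ` G"
    then obtain A where "A \<in> G" "B = M A" by blast
    then show "B \<subseteq> H \<and> conn c B \<and> (\<exists>Q\<subseteq>B. card Q = Suc r \<and> decreasing c Q)"
      using \<open>\<And>A. A \<in> G \<Longrightarrow> M A \<subseteq> H \<and> conn c (M A) \<and> (\<exists>Q\<subseteq>M A. card Q = Suc r \<and> decreasing c Q)\<close>
      by simp
  next
    fix X Y assume XY: "X \<in> M ` G" "Y \<in> M ` G" "X \<noteq> Y"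
    then obtain A B where "A \<in> G" "B \<in> G" "X = M A" "Y = M B" "A \<noteq> B" by blast
    then show "before c X Y \<or> before c Y X" using cmp by simp
  qed
qed

lemma pigeonhole_fibre:
  assumes "finite T" "t ` F \<subseteq> T" "card T * n < card F"
  shows "\<exists>x\<in>T. n < card {A \<in> F. t A = x}"
proof (rule ccontr)
  assume neg: "\<not> ?thesis"
  have "F = (\<Union>x\<in>T. {A \<in> F. t A = x})" using assms(2) by auto
  then have "card F \<le> (\<Sum>x\<in>T. card {A \<in> F. t A = x})"
    using card_UN_le[OF assms(1), of "\<lambda>x. {A \<in> F. t A = x}"] by simp
  also have "\<dots> \<le> (\<Sum>x\<in>T. n)" using neg by (intro sum_mono) (simp add: not_less)
  finally show False using assms(3) by simp
qed

text \<open>If a family covers as many points as possible for its size, then a point splitting a member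
  cannot be absorbed into that member, so it lies beyond a whole further member.\<close>

lemma maximal_family_split:
  assumes bc: "generic c H" "path_free c H" and tight: "tight c H" and r: "2 \<le> r"
    and F: "block_family c H r F" "2 \<le> card F"
    and max: "\<And>F'. block_family c H r F' \<Longrightarrow> card F' = card F \<Longrightarrow> card (\<Union>F') \<le> card (\<Union>F)"
    and A: "A \<in> F"
  shows "\<exists>v\<in>H. \<exists>d. between c d v A \<and> (\<exists>C\<in>F.
    before c A C \<and> (\<forall>b\<in>C. c (\<not> d) b < c (\<not> d) v) \<or>
    before c C A \<and> (\<forall>b\<in>C. c (\<not> d) v < c (\<not> d) b))"
proof -
  have finH: "finite H" using bc(1) by (simp add: generic_def)
  have FH: "B \<subseteq> H" "conn c B" if "B \<in> F" for B using F that unfolding block_family_def by blast+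
  have Fcmp: "before c B C \<or> before c C B" if "B \<in> F" "C \<in> F" "B \<noteq> C" for B C
    using F that unfolding block_family_def by simp
  have finA: "finite B" if "B \<in> F" for B using FH(1)[OF that] finH finite_subset by blast
  have ne: "B \<noteq> {}" if "B \<in> F" for B using FH(2)[OF that] unfolding conn_def by blast
  have disj: "x \<notin> C" if "B \<in> F" "C \<in> F" "B \<noteq> C" "x \<in> B" for B C x
    using Fcmp[OF that(1-3)] that(4) before_less[of c B C x x True] before_less[of c C B x x True] by auto
  obtain Q where Q: "Q \<subseteq> A" "card Q = r" "decreasing c Q" using F(1) A unfolding block_family_def by blast
  have "2 \<le> card A" using Q(1,2) r card_mono[OF finA[OF A] Q(1)] by simp
  moreover have "A \<noteq> H"
  proof
    assume "A = H"
    have "F \<noteq> {A}" using F(2) by auto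
    then obtain B where "B \<in> F" "B \<noteq> A" using A by blast
    then show False using disj[of B A] ne FH(1) \<open>A = H\<close> A by blast
  qed
  ultimately obtain v d where v: "v \<in> H" "v \<notin> A" "between c d v A"
    using tight FH[OF A] unfolding tight_def by blast
  obtain a1 a2 where a: "a1 \<in> A" "a2 \<in> A" "c d a1 < c d v" "c d v < c d a2"
    using v(3) unfolding between_def by blast
  \<comment> \<open>Another member lies entirely on one side of \<open>A\<close>, so none of its
    points can split \<open>A\<close>.\<close>
  have notin: "v \<notin> C" if "C \<in> F" for C
  proof
    assume "v \<in> C"
    then have "C \<noteq> A" using v(2) by blast
    then show False
      using Fcmp[OF that A] \<open>v \<in> C\<close> before_less[of c C A v a1 d] before_less[of c A C a2 v d] a by auto
  qed
  have "\<exists>a\<in>A. adj c v a"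
  proof (rule ccontr)
    assume "\<not> ?thesis"
    then have "lt c v b \<or> lt c b v" if "b \<in> A" for b
      using trichotomy[OF bc(1) v(1), of b] FH(1)[OF A] that v(2) by blast
    then have "(\<forall>b\<in>A. lt c v b) \<or> (\<forall>b\<in>A. lt c b v)" using conn_lt[OF FH(2)[OF A], where a = v] by blast
    then show False using a unfolding lt_def by (meson less_asym)
  qed
  then have conn': "conn c (insert v A)" using conn_insert FH(2)[OF A] by metis
  have dC: "c d v < c d b" if "C \<in> F" "before c A C" "b \<in> C" for C b
    using a(4) before_less[OF that(2) a(2) that(3), of d] by linarith
  have dC': "c d b < c d v" if "C \<in> F" "before c C A" "b \<in> C" for C b
    using a(3) before_less[OF that(2) that(3) a(1), of d] by linarith
  have "\<exists>C\<in>F. \<exists>b\<in>C. C \<noteq> A \<and> (before c A C \<and> \<not> lt c v b \<or> before c C A \<and> \<not> lt c b v)"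
  proof (rule ccontr)
    assume neg: "\<not> ?thesis"
    define F' where "F' = insert (insert v A) (F - {A})"
    have new: "before c (insert v A) C \<or> before c C (insert v A)" if "C \<in> F - {A}" for C
    proof -
      have C: "C \<in> F" "C \<noteq> A" using that by auto
      have "before c A C \<or> before c C A" using Fcmp A C by blast
      then show ?thesis
      proof
        assume b: "before c A C"
        then have "\<forall>z\<in>C. lt c v z" using neg C by blast
        then show ?thesis using b unfolding before_def by simp
      next
        assume b: "before c C A"
        then have "\<forall>z\<in>C. lt c z v" using neg C by blast
        then show ?thesis using b unfolding before_def by simp
      qed
    qed
    have "block_family c H r F'"
      unfolding block_family_def
    proof (intro conjI[OF ballI] ballI impI)
      fix B assume "B \<in> F'"
      then consider "B = insert v A" | "B \<in> F" unfolding F'_def by blast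
      then show "B \<subseteq> H \<and> conn c B \<and> (\<exists>Q\<subseteq>B. card Q = r \<and> decreasing c Q)"
      proof cases
        case 1
        then show ?thesis using FH(1)[OF A] v(1) conn' Q by auto
      next
        case 2
        then show ?thesis using F(1) unfolding block_family_def by simp
      qed
    next
      fix B C assume "B \<in> F'" "C \<in> F'" "B \<noteq> C"
      then consider "B \<in> F" "C \<in> F" | "B = insert v A" "C \<in> F - {A}" | "C = insert v A" "B \<in> F - {A}"
        unfolding F'_def by blast
      then show "before c B C \<or> before c C B"
        using new[of B] new[of C] Fcmp[of B C] \<open>B \<noteq> C\<close> by cases metis+
    qed
    note fam = this
    have finF: "finite F" using F(2) card.infinite by force
    have "insert v A \<notin> F - {A}" using notin[of "insert v A"] by blast
    then have "card F' = card F"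
      using card.remove[OF finF A] card_insert_disjoint[of "F - {A}" "insert v A"] finF
      unfolding F'_def by simp
    then have "card (\<Union>F') \<le> card (\<Union>F)" by (rule max[OF fam])
    moreover have "\<Union>F' = insert v (\<Union>F)" using A unfolding F'_def by blast
    moreover have "finite (\<Union>F)" "v \<notin> \<Union>F" using finF finA notin by auto
    ultimately show False by simp
  qed
  then obtain C b where C: "C \<in> F" "b \<in> C" "before c A C \<and> \<not> lt c v b \<or> before c C A \<and> \<not> lt c b v" by blast
  have bv: "c (\<not> d) b \<noteq> c (\<not> d) v" 
    using genericD[OF bc(1), of b v "\<not> d"] C(2) FH(1)[OF C(1)] v(1) notin[OF C(1)] by auto
  from C(3) have "before c A C \<and> (\<forall>b\<in>C. c (\<not> d) b < c (\<not> d) v) \<or>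
    before c C A \<and> (\<forall>b\<in>C. c (\<not> d) v < c (\<not> d) b)"
  proof
    assume h: "before c A C \<and> \<not> lt c v b"
    then have "c (\<not> d) b < c (\<not> d) v" using dC[OF C(1) _ C(2)] bv lt_iff[of c v b d] by auto
    then show ?thesis
      using up_complete(1)[OF bc FH(1)[OF A] FH(1)[OF C(1)] v(1) FH(2)[OF A] FH(2)[OF C(1)] _ v(3) C(2)] h by blast
  next
    assume h: "before c C A \<and> \<not> lt c b v"
    then have "c (\<not> d) v < c (\<not> d) b" using dC'[OF C(1) _ C(2)] bv lt_iff[of c b v d] by auto
    \<comment> \<open>A member below \<open>A\<close> is a member above \<open>A\<close> after a
      half turn.\<close>
    then have "\<forall>z\<in>C. rot c (\<not> d) z < rot c (\<not> d) v"
      using h bc FH(1)[OF A] FH(1)[OF C(1)] v(1) FH(2)[OF A] FH(2)[OF C(1)] v(3) C(2)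
      by (intro up_complete(1)[of "rot c" H A C v d b])
        (simp_all add: generic_rot path_free_rot conn_rot before_rot between_rot)
    then show ?thesis using h by simp
  qed
  then show ?thesis using v(1,3) C(1) by blast
qed

text \<open>The factor \<open>4 * l\<close> counts the types of a splitter: axis, direction and
  colour. Some type occurs more than \<open>n\<close> times, and its common colour makes the
  splitters nonadjacent, as merging requires.\<close>

lemma larger_blocks:
  assumes bc: "bounded_class l c H" and tight: "tight c H" and r: "2 \<le> r"
    and F: "block_family c H r F" "2 \<le> card F" "4 * l * n < card F"
  shows "\<exists>G. block_family c H (Suc r) G \<and> n < card G"
proof -
  have gp: "generic c H" "path_free c H" using bc unfolding bounded_class_def by blast+
  have finH: "finite H" using gp(1) by (simp add: generic_def)
  have "\<exists>F1. (block_family c H r F1 \<and> card F1 = card F) \<and>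
      (\<forall>F'. block_family c H r F' \<and> card F' = card F \<longrightarrow> card (\<Union>F') \<le> card (\<Union>F1))"
  proof (rule ex_has_greatest_nat[where b = "Suc (card H)"])
    show "block_family c H r F \<and> card F = card F" using F by simp
    show "\<forall>F'. block_family c H r F' \<and> card F' = card F \<longrightarrow> card (\<Union>F') < Suc (card H)"
    proof (intro allI impI)
      fix F' assume "block_family c H r F' \<and> card F' = card F"
      then have "\<Union>F' \<subseteq> H" unfolding block_family_def by blast
      then show "card (\<Union>F') < Suc (card H)" using card_mono[OF finH] by (simp add: less_Suc_eq_le)
    qed
  qed
  then obtain F1 where F1: "block_family c H r F1" "card F1 = card F"
    "\<And>F'. block_family c H r F' \<Longrightarrow> card F' = card F1 \<Longrightarrow> card (\<Union>F') \<le> card (\<Union>F1)" by metis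
  have "\<forall>A\<in>F1. \<exists>v d C. v \<in> H \<and> between c d v A \<and> C \<in> F1 \<and>
    (before c A C \<and> (\<forall>b\<in>C. c (\<not> d) b < c (\<not> d) v) \<or>
     before c C A \<and> (\<forall>b\<in>C. c (\<not> d) v < c (\<not> d) b))"
    using maximal_family_split[OF gp tight r F1(1) _ F1(3)] F(2) F1(2) by metis
  then obtain v d C where split: "\<And>A. A \<in> F1 \<Longrightarrow> v A \<in> H \<and> between c (d A) (v A) A \<and> C A \<in> F1 \<and>
    (before c A (C A) \<and> (\<forall>b\<in>C A. c (\<not> d A) b < c (\<not> d A) (v A)) \<or>
     before c (C A) A \<and> (\<forall>b\<in>C A. c (\<not> d A) (v A) < c (\<not> d A) b))"
    by metis
  obtain col where col: "\<And>p. p \<in> H \<Longrightarrow> col p < l" "\<And>p q. p \<in> H \<Longrightarrow> q \<in> H \<Longrightarrow> adj c p q \<Longrightarrow> col p \<noteq> col q"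
    using coloring[OF bc] by blast
  define t where "t A = (d A, before c A (C A) \<and> (\<forall>b\<in>C A. c (\<not> d A) b < c (\<not> d A) (v A)), col (v A))" for A
  have "t ` F1 \<subseteq> UNIV \<times> UNIV \<times> {..<l}" using split col(1) by (auto simp: t_def)
  moreover have "card ((UNIV :: bool set) \<times> (UNIV :: bool set) \<times> {..<l}) * n < card F1"
    using F(3) F1(2) by (simp add: card_cartesian_product)
  ultimately obtain x where x: "n < card {A \<in> F1. t A = x}"
    using pigeonhole_fibre[of "UNIV \<times> UNIV \<times> {..<l}" t F1 n] by auto
  obtain e u k where xe: "x = (e, u, k)" by (metis surj_pair)
  define G where "G = {A \<in> F1. t A = x}"
  have G: "G \<subseteq> F1" "\<And>A. A \<in> G \<Longrightarrow> d A = e \<and> col (v A) = k" unfolding G_def t_def xe by auto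
  have nadj: "\<not> adj c (v A) (v B)" if "A \<in> G" "B \<in> G" for A B
    using that G col(2)[of "v A" "v B"] split[of A] split[of B] by auto
  have vG: "v A \<in> H \<and> between c e (v A) A" if "A \<in> G" for A using split[of A] G that by auto
  show ?thesis
  proof (cases u)
    case True
    have CG: "C A \<in> F1 \<and> before c A (C A) \<and> (\<forall>b\<in>C A. c (\<not> e) b < c (\<not> e) (v A))" if "A \<in> G" for A
      using that split[of A] True unfolding G_def t_def xe by auto
    note m = merge_up[OF gp F1(1) G(1) vG CG nadj]
    then show ?thesis using x card_image[OF m(2)] unfolding G_def[symmetric] by auto
  next
    case False
    have CG: "C A \<in> F1 \<and> before (rot c) A (C A) \<and> (\<forall>b\<in>C A. rot c (\<not> e) b < rot c (\<not> e) (v A))" if "A \<in> G" for A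
      using that split[of A] False unfolding G_def t_def xe before_rot by auto
    note m = merge_up[of "rot c" H r F1 G v e C, unfolded generic_rot path_free_rot block_family_rot between_rot adj_rot,
        OF gp F1(1) G(1) vG CG nadj]
    then show ?thesis using x card_image[OF m(2)] unfolding G_def[symmetric] by auto
  qed
qed

text \<open>Induction on \<open>l - r\<close>: merging turns a large family for \<open>r\<close>
  into a large one for \<open>Suc r\<close>, and for \<open>r \<ge> l\<close> no member can contain
  the required decreasing set.\<close>

lemma block_bound:
  assumes "2 \<le> r"
  shows "\<exists>n. \<forall>(c :: bool \<Rightarrow> 'p \<Rightarrow> int) H F. bounded_class l c H \<and> tight c H \<and> block_family c H r F \<longrightarrow> card F \<le> n"
  using assms
proof (induction "l - r" arbitrary: r rule: less_induct)
  case less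
  show ?case
  proof (cases "r < l")
    case True
    then obtain n where n: "\<And>(c :: bool \<Rightarrow> 'p \<Rightarrow> int) H F.
      bounded_class l c H \<Longrightarrow> tight c H \<Longrightarrow> block_family c H (Suc r) F \<Longrightarrow> card F \<le> n"
      using less.hyps[of "Suc r"] less.prems by (auto simp: diff_less_mono2)
    \<comment> \<open>The \<open>2\<close> ensures a second member, so that no member is all of
      \<open>H\<close> and tightness applies to each.\<close>
    have "card F \<le> max 2 (4 * l * n)" if *: "bounded_class l c H" "tight c H" "block_family c H r F"
      for c :: "bool \<Rightarrow> 'p \<Rightarrow> int" and H F
    proof (rule ccontr)
      assume "\<not> ?thesis"
      then have "2 \<le> card F" "4 * l * n < card F" by auto
      then obtain G where "block_family c H (Suc r) G" "n < card G"
        using larger_blocks[OF *(1,2) less.prems *(3)] by blast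
      then show False using n[OF *(1,2)] by fastforce
    qed
    then show ?thesis by blast
  next
    case False
    have "card F \<le> 0" if *: "bounded_class l c H" "block_family c H r F"
      for c :: "bool \<Rightarrow> 'p \<Rightarrow> int" and H F
    proof -
      have "A \<notin> F" for A
      proof
        assume "A \<in> F"
        then obtain Q where "Q \<subseteq> H" "card Q = r" "decreasing c Q"
          using *(2) unfolding block_family_def by blast
        then show False using decreasing_card_less[OF *(1)] False by blast
      qed
      then have "F = {}" by blast
      then show ?thesis by simp
    qed
    then show ?thesis by blast
  qed
qed

section \<open>A bounded grid with increasing cells\<close>

text \<open>Take \<open>p\<close> with most neighbours among the vertices satisfying
  \<open>P\<close>. If it misses a vertex of the other side, some \<open>t\<close> has distance
  three from it, via \<open>y\<close> and \<open>s\<close>. Maximality gives a neighbour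
  \<open>x\<close> of \<open>p\<close> not adjacent to \<open>s\<close>, and
  \<open>x p y s t\<close> is induced.\<close>

lemma bipartite_center:
  assumes pf: "path_free c B" and fin: "finite B" and conn: "conn c B" "2 \<le> card B"
    and bip: "\<And>p q. p \<in> B \<Longrightarrow> q \<in> B \<Longrightarrow> adj c p q \<Longrightarrow> P p \<noteq> P q"
  shows "\<exists>p\<in>B. P p \<and> (\<forall>q\<in>B. \<not> P q \<longrightarrow> adj c p q)"
proof -
  define N where "N p = {z \<in> B. adj c p z}" for p
  have finN: "finite (N p)" for p using fin by (simp add: N_def)
  obtain a where a: "a \<in> B" using conn unfolding conn_def by blast
  then obtain b where b: "b \<in> B" "adj c a b" using conn_edge[OF conn] by metis
  then have "\<exists>p. p \<in> B \<and> P p" using bip[OF a b] a by blast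
  then obtain p0 where p0: "p0 \<in> B \<and> P p0" by blast
  have "\<exists>p. (p \<in> B \<and> P p) \<and> (\<forall>y. y \<in> B \<and> P y \<longrightarrow> card (N y) \<le> card (N p))"
  proof (rule ex_has_greatest_nat[where b = "Suc (card B)"])
    show "p0 \<in> B \<and> P p0" by (rule p0)
    show "\<forall>y. y \<in> B \<and> P y \<longrightarrow> card (N y) < Suc (card B)"
      using card_mono[OF fin] by (simp add: N_def less_Suc_eq_le)
  qed
  then obtain p where p: "p \<in> B" "P p" and max: "\<And>y. y \<in> B \<Longrightarrow> P y \<Longrightarrow> card (N y) \<le> card (N p)" by blast
  have "adj c p q" if q: "q \<in> B" "\<not> P q" for q
  proof (rule ccontr)
    assume npq: "\<not> adj c p q"
    \<comment> \<open>The ball of radius two around \<open>p\<close>. The graph is bipartite, so the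
      missed vertex \<open>q\<close> lies outside it.\<close>
    let ?X = "insert p (N p \<union> {z \<in> B. \<exists>y\<in>N p. adj c y z})"
    have "\<not> adj c y q" if "y \<in> N p" for y
      using that bip[of y q] bip[of p y] p q unfolding N_def by auto
    then have "q \<notin> ?X" using npq q p unfolding N_def by auto
    then obtain s t where st: "s \<in> ?X" "t \<in> B" "t \<notin> ?X" "adj c s t"
      using connD[OF conn(1), of ?X] p(1) q(1) unfolding N_def by blast
    have "s \<noteq> p" "s \<notin> N p" using st unfolding N_def by auto
    then obtain y where y: "y \<in> B" "adj c p y" "s \<in> B" "adj c y s" using st(1) unfolding N_def by blast
    have t: "\<not> adj c p t" using st unfolding N_def by auto
    have Py: "\<not> P y" "P s" "\<not> P t" using bip[of p y] bip[of y s] bip[of s t] y st p by auto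
    have "\<not> N p \<subseteq> N s"
    proof
      assume "N p \<subseteq> N s"
      then have "N p \<subset> N s" using st(2,4) t unfolding N_def by auto
      then have "card (N p) < card (N s)" using psubset_card_mono[OF finN] by blast
      then show False using max[OF y(3) Py(2)] by simp
    qed
    then obtain x where x: "x \<in> B" "adj c p x" "\<not> adj c s x" unfolding N_def by blast
    have Px: "\<not> P x" using bip[of p x] p x by auto
    have "\<not> adj c x y" "\<not> adj c x t" "\<not> adj c p s" "\<not> adj c y t"
      using bip[of x y] bip[of x t] bip[of p s] bip[of y t] x(1) y(1,3) st(2) p Py Px by auto
    then have "ind_path c x p y s t"
      unfolding ind_path_def using x y st(4) t adj_sym[of c] by blast
    then show False using path_freeD[OF pf] x(1) p(1) y(1,3) st(2) by blast
  qed
  then show ?thesis using p by blast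
qed

text \<open>This lets \<open>block_bound\<close> limit the number of nontrivial components spanned
  by two colour classes.\<close>

lemma component_family:
  assumes "generic c H" "U \<subseteq> H"
  shows "block_family c H 2 {B \<in> component c U ` U. 2 \<le> card B}"
  unfolding block_family_def
proof (intro conjI[OF ballI] ballI impI)
  fix B assume "B \<in> {B \<in> component c U ` U. 2 \<le> card B}"
  then obtain p where p: "p \<in> U" "B = component c U p" "2 \<le> card B" by blast
  then have "conn c B" using component_conn by metis
  then show "B \<subseteq> H \<and> conn c B \<and> (\<exists>Q\<subseteq>B. card Q = 2 \<and> decreasing c Q)"
    using conn_decreasing_pair[OF _ p(3)] component_subset[of c U p] p(2) assms(2) by blast
next
  fix A B assume AB: "A \<in> {B \<in> component c U ` U. 2 \<le> card B}" "B \<in> {B \<in> component c U ` U. 2 \<le> card B}" "A \<noteq> B"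
  then obtain p q where "p \<in> U" "A = component c U p" "q \<in> U" "B = component c U q" by blast
  then show "before c A B \<or> before c B A"
    using component_separated[OF generic_subset[OF assms], of p q] AB(3) unfolding before_def by blast
qed

definition separated :: "(bool \<Rightarrow> 'p \<Rightarrow> int) \<Rightarrow> 'p set \<Rightarrow> ('p \<Rightarrow> 'l) \<Rightarrow> bool \<Rightarrow> 'l \<Rightarrow> 'l \<Rightarrow> bool" where
  "separated c H lab d a b \<longleftrightarrow> (\<forall>p\<in>H. \<forall>q\<in>H. lab p = a \<longrightarrow> lab q = b \<longrightarrow> c d p < c d q)"

text \<open>Between two colour classes, each nontrivial component has a point \<open>z\<close> of the first class that is
  adjacent to its whole second class; splitting the first class at \<open>z\<close> separates the two sides.\<close>

lemma separating_labels:
  fixes l :: nat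
  shows "\<exists>N. \<forall>(c :: bool \<Rightarrow> 'p \<Rightarrow> int) H. bounded_class l c H \<and> tight c H \<longrightarrow>
    (\<exists>lab :: 'p \<Rightarrow> nat \<times> ('p set \<times> bool) list. card (lab ` H) \<le> N \<and>
      (\<forall>p\<in>H. \<forall>q\<in>H. adj c p q \<longrightarrow>
        (\<exists>d. separated c H lab d (lab p) (lab q) \<or> separated c H lab d (lab q) (lab p))))"
proof -
  obtain n where n: "\<And>(c :: bool \<Rightarrow> 'p \<Rightarrow> int) H F.
      bounded_class l c H \<Longrightarrow> tight c H \<Longrightarrow> block_family c H 2 F \<Longrightarrow> card F \<le> n"
    using block_bound[of 2 l] by auto
  \<comment> \<open>A label is a colour and, for each of \<open>l\<close> second colours, a
    nontrivial component (at most \<open>n\<close> for each of the \<open>l * l\<close> colour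
    pairs) or \<open>{}\<close>, with one bit for the side of its centre.\<close>
  define N where "N = l * (2 * Suc (l * l * n)) ^ l"
  have "\<exists>lab :: 'p \<Rightarrow> nat \<times> ('p set \<times> bool) list. card (lab ` H) \<le> N \<and>
      (\<forall>p\<in>H. \<forall>q\<in>H. adj c p q \<longrightarrow>
        (\<exists>d. separated c H lab d (lab p) (lab q) \<or> separated c H lab d (lab q) (lab p)))"
    if bc: "bounded_class l c H" and tight: "tight c H" for c :: "bool \<Rightarrow> 'p \<Rightarrow> int" and H
  proof -
    have gen: "generic c H" and pf: "path_free c H" using bc unfolding bounded_class_def by blast+
    have finH: "finite H" using gen by (simp add: generic_def)
    obtain col where col: "\<And>p. p \<in> H \<Longrightarrow> col p < l" "\<And>p q. p \<in> H \<Longrightarrow> q \<in> H \<Longrightarrow> adj c p q \<Longrightarrow> col p \<noteq> col q"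
      using coloring[OF bc] by blast
    define U where "U a b = {q \<in> H. col q = a \<or> col q = b}" for a b
    define K where "K p b = component c (U (col p) b) p" for p b
    \<comment> \<open>The number of singleton components is not bounded, so they share the value
      \<open>{}\<close>; an adjacent pair always lies in a nontrivial component of its two
      colours.\<close>
    define \<kappa> where "\<kappa> p b = (if 2 \<le> card (K p b) then K p b else {})" for p b
    define cz where "cz a B = (SOME z. z \<in> B \<and> col z = a \<and> (\<forall>q\<in>B. col q \<noteq> a \<longrightarrow> adj c z q))" for a B
    define flag where "flag p b \<longleftrightarrow> c True p \<le> c True (cz (col p) (K p b))" for p b
    define lab where "lab p = (col p, map (\<lambda>b. (\<kappa> p b, flag p b)) [0..<l])" for p
    define F where "F a b = {B \<in> component c (U a b) ` U a b. 2 \<le> card B}" for a b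
    have UH: "U a b \<subseteq> H" for a b unfolding U_def by blast
    have Fn: "card (F a b) \<le> n" for a b
      unfolding F_def by (rule n[OF bc tight component_family[OF gen UH]])
    have Ffin: "finite (F a b)" for a b using finH finite_subset[OF UH[of a b]] unfolding F_def by simp
    define T where "T = insert {} (\<Union>(a, b)\<in>{..<l} \<times> {..<l}. F a b) \<times> (UNIV :: bool set)"
    have finT: "finite T" using Ffin unfolding T_def by auto
    have "card (\<Union>(a, b)\<in>{..<l} \<times> {..<l}. F a b) \<le> (\<Sum>(a, b)\<in>{..<l} \<times> {..<l}. card (F a b))"
      using card_UN_le[of "{..<l} \<times> {..<l}" "\<lambda>(a, b). F a b"] by (simp add: case_prod_beta)
    also have "\<dots> \<le> (\<Sum>(a, b)\<in>{..<l} \<times> {..<l}. n)" by (intro sum_mono) (use Fn in auto)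
    finally have "card (\<Union>(a, b)\<in>{..<l} \<times> {..<l}. F a b) \<le> l * l * n" by (simp add: case_prod_beta)
    then have "card (insert {} (\<Union>(a, b)\<in>{..<l} \<times> {..<l}. F a b)) \<le> Suc (l * l * n)"
      using Ffin by (auto simp: card_insert_if)
    then have cardT: "card T \<le> 2 * Suc (l * l * n)"
      unfolding T_def by (simp add: card_cartesian_product)
    let ?Z = "{..<l} \<times> {xs. set xs \<subseteq> T \<and> length xs = l}"
    have "lab ` H \<subseteq> ?Z"
    proof
      fix x assume "x \<in> lab ` H"
      then obtain p where p: "p \<in> H" "x = lab p" by blast
      have "(\<kappa> p b, flag p b) \<in> T" if "b < l" for b
      proof -
        have "p \<in> U (col p) b" using p(1) unfolding U_def by simp
        then have "K p b \<in> F (col p) b" if "2 \<le> card (K p b)" using that unfolding F_def K_def by blast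
        then show ?thesis using col(1)[OF p(1)] \<open>b < l\<close> unfolding T_def \<kappa>_def by auto
      qed
      then show "x \<in> ?Z" using p col(1) unfolding lab_def by auto
    qed
    moreover have "finite ?Z" using finite_lists_length_eq[OF finT] by simp
    ultimately have "card (lab ` H) \<le> card ?Z" by (rule card_mono[rotated])
    also have "\<dots> = l * card T ^ l" using card_lists_length_eq[OF finT] by (simp add: card_cartesian_product)
    also have "\<dots> \<le> N" unfolding N_def using cardT by (intro mult_le_mono2 power_mono) auto
    finally have card: "card (lab ` H) \<le> N" .
    have "\<exists>d. separated c H lab d (lab p) (lab q) \<or> separated c H lab d (lab q) (lab p)"
      if pq: "p \<in> H" "q \<in> H" "adj c p q" for p q
    proof -
      define a b where "a = col p" and "b = col q"
      have ab: "a \<noteq> b" "a < l" "b < l" using col pq unfolding a_def b_def by auto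
      define B where "B = K p b"
      have pU: "p \<in> U a b" "q \<in> U a b" using pq unfolding U_def a_def b_def by auto
      have sym: "U a b = U b a" unfolding U_def by blast
      have Bq: "K q a = B"
        unfolding B_def K_def a_def[symmetric] b_def[symmetric] sym[symmetric]
        using component_adj[OF pU pq(3)] by simp
      have BU: "B \<subseteq> U a b" unfolding B_def K_def a_def[symmetric] by (rule component_subset)
      then have BH: "B \<subseteq> H" using UH[of a b] by blast
      then have finB: "finite B" using finH by (rule finite_subset)
      have "p \<in> B" "q \<in> B"
        using component_self[OF pU(1), of c] component_self[OF pU(2), of c] Bq
        unfolding B_def K_def a_def[symmetric] b_def[symmetric] sym[symmetric] by auto
      moreover have "p \<noteq> q" using pq(3) by auto
      ultimately have B2: "2 \<le> card B" using card_mono[OF finB, of "{p, q}"] by simp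
      have connB: "conn c B" unfolding B_def K_def a_def[symmetric] by (rule component_conn[OF pU(1)])
      have "\<exists>z\<in>B. col z = a \<and> (\<forall>y\<in>B. col y \<noteq> a \<longrightarrow> adj c z y)"
      proof (rule bipartite_center[OF path_free_subset[OF pf BH] finB connB B2])
        fix x y assume "x \<in> B" "y \<in> B" "adj c x y"
        then have "col x \<noteq> col y" "col x \<in> {a, b}" "col y \<in> {a, b}" using col(2)[of x y] BU BH unfolding U_def by auto
        then show "(col x = a) \<noteq> (col y = a)" by auto
      qed
      then have "\<exists>z. z \<in> B \<and> col z = a \<and> (\<forall>y\<in>B. col y \<noteq> a \<longrightarrow> adj c z y)" by blast
      then have "cz a B \<in> B \<and> col (cz a B) = a \<and> (\<forall>y\<in>B. col y \<noteq> a \<longrightarrow> adj c (cz a B) y)"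
        unfolding cz_def by (rule someI_ex)
      then obtain z where z: "z = cz a B" "z \<in> B" "col z = a" "\<And>y. y \<in> B \<Longrightarrow> col y \<noteq> a \<Longrightarrow> adj c z y" by blast
      have labD: "col x = col y \<and> \<kappa> x b' = \<kappa> y b' \<and> flag x b' = flag y b'" if "lab x = lab y" "b' < l" for x y b'
        using that unfolding lab_def by simp
      have KB: "K x b' = K y b'" if "lab x = lab y" "b' < l" "2 \<le> card (K y b')" for x y b'
      proof -
        have "\<kappa> x b' \<noteq> {}" using labD[OF that(1,2)] that(3) unfolding \<kappa>_def by auto
        then show ?thesis using labD[OF that(1,2)] that(3) unfolding \<kappa>_def by (auto split: if_splits)
      qed
      have pB: "x \<in> B \<and> col x = a \<and> (c True x \<le> c True z \<longleftrightarrow> flag p b)" if x: "x \<in> H" "lab x = lab p" for x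
      proof -
        have e: "K x b = B" "col x = a" "flag x b = flag p b"
          using KB[OF x(2) ab(3)] B2 labD[OF x(2) ab(3)] unfolding B_def a_def by auto
        have "x \<in> U (col x) b" using x(1) unfolding U_def by simp
        then have "x \<in> K x b" unfolding K_def by (rule component_self)
        then show ?thesis using e z(1) unfolding flag_def by simp
      qed
      have qB: "y \<in> B \<and> col y = b" if y: "y \<in> H" "lab y = lab q" for y
      proof -
        have e: "K y a = B" "col y = b"
          using KB[OF y(2) ab(2)] B2 Bq labD[OF y(2) ab(2)] unfolding b_def by auto
        have "y \<in> U (col y) a" using y(1) unfolding U_def by simp
        then have "y \<in> K y a" unfolding K_def by (rule component_self)
        then show ?thesis using e by simp
      qed
      \<comment> \<open>Points of one colour are increasing, so a side of \<open>z\<close> in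
        position is the same side in value.\<close>
      have zx: "c False x \<le> c False z" if "x \<in> H" "lab x = lab p" "c True x \<le> c True z" for x
      proof -
        have "\<not> adj c x z" using pB[OF that(1,2)] z(2,3) col(2)[of x z] BH by auto
        then show ?thesis using that genericD[OF gen, of x z True] z(2) BH
            adj_iff[of c x z True] by (cases "c True x = c True z") auto
      qed
      have xz: "c False z < c False x" if "x \<in> H" "lab x = lab p" "c True z < c True x" for x
      proof -
        have "\<not> adj c z x" using pB[OF that(1,2)] z(2,3) col(2)[of z x] BH by auto
        then show ?thesis using nonadj_lt[OF gen _ that(1) _ that(3)] z(2) BH unfolding lt_def by blast
      qed
      have zq: "adj c z q" using z(4) qB[of q] pq(2) ab(1) by auto
      \<comment> \<open>Points labelled like \<open>q\<close> are all adjacent to \<open>z\<close>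
        but not to each other, which puts them into a single quadrant at \<open>z\<close>.\<close>
      have side: "(c True y < c True z \<longleftrightarrow> c True q < c True z) \<and> adj c z y" if y: "y \<in> H" "lab y = lab q" for y
      proof -
        have "adj c z y" using z(4) qB[OF y] ab(1) by auto
        moreover have "\<not> adj c y q" using col(2)[of y q] qB[OF y] qB[of q] pq(2) BH by auto
        ultimately show ?thesis
          using zq adj_iff[of c z y True] adj_iff[of c z q True] adj_iff[of c y q True] by auto
      qed
      show ?thesis
      \<comment> \<open>If \<open>q\<close> is left of and above \<open>z\<close>, points labelled
        like \<open>p\<close> up to \<open>z\<close> are separated from it in value and those after
        \<open>z\<close> in position. In the opposite quadrant the axes exchange roles.\<close>
      proof (cases "c True q < c True z")
        case True
        then have y: "c True y < c True z \<and> c False z < c False y" if "y \<in> H" "lab y = lab q" for y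
          using side[OF that] adj_iff[of c z y True] by auto
        show ?thesis
        proof (cases "flag p b")
          case True
          then have "separated c H lab False (lab p) (lab q)"
            unfolding separated_def using pB zx y by (meson le_less_trans)
          then show ?thesis by blast
        next
          case False
          then have "separated c H lab True (lab q) (lab p)"
            unfolding separated_def using pB y by (meson less_trans not_le)
          then show ?thesis by blast
        qed
      next
        case False
        then have y: "c True z < c True y \<and> c False y < c False z" if "y \<in> H" "lab y = lab q" for y
          using side[OF that] adj_iff[of c z y True] by auto
        show ?thesis
        proof (cases "flag p b")
          case True
          then have "separated c H lab True (lab p) (lab q)"
            unfolding separated_def using pB y by (meson le_less_trans)
          then show ?thesis by blast
        next
          case False
          then have "separated c H lab False (lab q) (lab p)"
            unfolding separated_def using pB xz y by (meson less_trans not_le)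
          then show ?thesis by blast
        qed
      qed
    qed
    then show ?thesis using card by (intro exI[of _ lab]) blast
  qed
  then show ?thesis by blast
qed

text \<open>\<open>g d\<close> numbers columns or rows in order; the last condition makes every cell
  an increasing set.\<close>

definition gridding :: "(bool \<Rightarrow> 'p \<Rightarrow> int) \<Rightarrow> 'p set \<Rightarrow> nat \<Rightarrow> (bool \<Rightarrow> 'p \<Rightarrow> nat) \<Rightarrow> bool" where
  "gridding c H m g \<longleftrightarrow> (\<forall>d. \<forall>p\<in>H. g d p \<le> m \<and> (\<forall>q\<in>H. c d p \<le> c d q \<longrightarrow> g d p \<le> g d q)) \<and>
     (\<forall>p\<in>H. \<forall>q\<in>H. adj c p q \<longrightarrow> (\<exists>d. g d p \<noteq> g d q))"

text \<open>The grid coordinate of a point counts the labels met so far along the axis. If two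
  labels are separated along \<open>d\<close>, the later one is not yet counted at points of the
  earlier one.\<close>

lemma bounded_gridding:
  fixes l :: nat
  shows "\<exists>m. \<forall>(c :: bool \<Rightarrow> 'p \<Rightarrow> int) H. bounded_class l c H \<and> tight c H \<longrightarrow> (\<exists>g. gridding c H m g)"
proof -
  obtain N where N: "\<forall>(c :: bool \<Rightarrow> 'p \<Rightarrow> int) H. bounded_class l c H \<and> tight c H \<longrightarrow>
    (\<exists>lab :: 'p \<Rightarrow> nat \<times> ('p set \<times> bool) list. card (lab ` H) \<le> N \<and>
      (\<forall>p\<in>H. \<forall>q\<in>H. adj c p q \<longrightarrow>
        (\<exists>d. separated c H lab d (lab p) (lab q) \<or> separated c H lab d (lab q) (lab p))))"
    using separating_labels by blast
  have "\<exists>g. gridding c H N g" if bc: "bounded_class l c H" "tight c H" for c :: "bool \<Rightarrow> 'p \<Rightarrow> int" and H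
  proof -
    have finH: "finite H" using bc(1) by (simp add: bounded_class_def generic_def)
    obtain lab :: "'p \<Rightarrow> nat \<times> ('p set \<times> bool) list" where lab: "card (lab ` H) \<le> N"
      and sep: "\<And>p q. p \<in> H \<Longrightarrow> q \<in> H \<Longrightarrow> adj c p q \<Longrightarrow>
        \<exists>d. separated c H lab d (lab p) (lab q) \<or> separated c H lab d (lab q) (lab p)"
      using N bc by blast
    define S where "S d p = {a \<in> lab ` H. \<exists>q\<in>H. lab q = a \<and> c d q \<le> c d p}" for d p
    have fin: "finite (S d p)" for d p using finH unfolding S_def by simp
    have mono: "S d p \<subseteq> S d q" if "c d p \<le> c d q" for d p q
      using that unfolding S_def by (auto intro: order_trans)
    have strict: "card (S d p) < card (S d q)" if s: "separated c H lab d (lab p) (lab q)" "p \<in> H" "q \<in> H" for d p q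
    proof -
      have "c d p < c d q" using s unfolding separated_def by blast
      moreover have "lab q \<in> S d q" using s unfolding S_def by blast
      moreover have "lab q \<notin> S d p" using s unfolding S_def separated_def by (auto simp: not_le)
      ultimately have "S d p \<subset> S d q" using mono[of d p q] by auto
      then show ?thesis using psubset_card_mono[OF fin] by blast
    qed
    have "gridding c H N (\<lambda>d p. card (S d p))"
      unfolding gridding_def
    proof (intro conjI allI ballI impI)
      fix d p
      have "card (S d p) \<le> card (lab ` H)" using finH unfolding S_def by (intro card_mono) auto
      then show "card (S d p) \<le> N" using lab by simp
    next
      fix d p q assume "c d p \<le> c d q"
      then show "card (S d p) \<le> card (S d q)" using card_mono[OF fin mono] by blast
    next
      fix p q assume "p \<in> H" "q \<in> H" "adj c p q"
      then show "\<exists>d. card (S d p) \<noteq> card (S d q)" using sep[of p q] strict by (metis less_irrefl)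
    qed
    then show ?thesis by blast
  qed
  then show ?thesis by blast
qed

section \<open>Corners of the grid\<close>

lemma griddingD:
  assumes "gridding c H m g" "p \<in> H"
  shows "g d p \<le> m" "q \<in> H \<Longrightarrow> c d p \<le> c d q \<Longrightarrow> g d p \<le> g d q"
    "q \<in> H \<Longrightarrow> adj c p q \<Longrightarrow> \<exists>d. g d p \<noteq> g d q"
  using assms unfolding gridding_def by blast+

locale grid =
  fixes c :: "bool \<Rightarrow> 'p \<Rightarrow> int" and H :: "'p set" and m :: nat and g :: "bool \<Rightarrow> 'p \<Rightarrow> nat"
  assumes gen: "generic c H" and pf: "path_free c H" and grid: "gridding c H m g"
begin

definition cell :: "'p \<Rightarrow> nat \<times> nat" where
  "cell p = (g True p, g False p)"

text \<open>For cells \<open>a\<close> and \<open>b\<close>, the cell of \<open>p\<close> is divided after its longest initial segment that is not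
  cut both by \<open>a\<close> in position and by \<open>b\<close> in value.  If \<open>a\<close> and \<open>b\<close> form a forbidden corner with the cell,
  then the final segment is not cut by both either, by \<open>corner_path\<close>.\<close>

definition uncut :: "'p \<Rightarrow> ((nat \<times> nat) \<times> (nat \<times> nat)) set" where
  "uncut p = {(a, b). a \<in> cell ` H \<and> b \<in> cell ` H \<and>
     \<not> (\<exists>q\<in>H. \<exists>s\<in>H. \<exists>r\<in>H. cell q = cell p \<and> cell s = a \<and> cell r = b \<and>
         c True q < c True s \<and> c True s < c True p \<and> c False q < c False r \<and> c False r < c False p)}"

definition lab :: "'p \<Rightarrow> (nat \<times> nat) \<times> ((nat \<times> nat) \<times> (nat \<times> nat)) set" where
  "lab p = (cell p, uncut p)"

definition cut where
  "cut d a s \<longleftrightarrow> (\<exists>p\<in>H. \<exists>q\<in>H. lab p = a \<and> lab q = a \<and> c d p < c d s \<and> c d s < c d q)"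

text \<open>Column minus row: it grows to the right and downwards. This is the potential behind both
  the termination of the lines and the absence of cycles.\<close>

definition diag :: "'p \<Rightarrow> int" where
  "diag p = int (g True p) - int (g False p)"

lemma finH: "finite H"
  using gen by (simp add: generic_def)

lemma g_mono: "p \<in> H \<Longrightarrow> q \<in> H \<Longrightarrow> c d p \<le> c d q \<Longrightarrow> g d p \<le> g d q"
  using griddingD(2)[OF grid] by blast

lemma g_less: "p \<in> H \<Longrightarrow> q \<in> H \<Longrightarrow> g d p < g d q \<Longrightarrow> c d p < c d q"
  using g_mono[of q p d] by (meson not_le)

lemma cell_iff: "cell p = cell q \<longleftrightarrow> g d p = g d q \<and> g (\<not> d) p = g (\<not> d) q"
  unfolding cell_def by (cases d) auto

lemma cell_lt:
  assumes "p \<in> H" "q \<in> H" "cell p = cell q" "c d p < c d q"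
  shows "lt c p q"
proof -
  have "g e p = g e q" for e using assms(3) by (cases e) (auto simp: cell_def)
  then have "\<not> adj c p q" using griddingD(3)[OF grid assms(1,2)] by blast
  then show ?thesis using nonadj_lt[OF gen assms(1,2)] assms(4) by blast
qed

lemma cell_less:
  assumes "p \<in> H" "q \<in> H" "cell p = cell q" "c d p < c d q"
  shows "c e p < c e q"
  using cell_lt[OF assms] unfolding lt_def by blast

lemma cell_le:
  assumes "p \<in> H" "q \<in> H" "cell p = cell q" "c d p \<le> c d q"
  shows "c e p \<le> c e q"
  using cell_less[OF assms(1-3), of d e] assms(4) genericD[OF gen assms(1,2), of d] by force

lemma uncut_antimono:
  assumes "p \<in> H" "q \<in> H" "cell p = cell q" "c d p \<le> c d q"
  shows "uncut q \<subseteq> uncut p"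
  using cell_le[OF assms, of True] cell_le[OF assms, of False] assms(3) unfolding uncut_def
  by (auto) (meson less_le_trans)

text \<open>\<open>uncut\<close> is antitone along a cell, so pieces are convex in their cells. A
  point of another label that cuts a piece therefore shares its column (or row) but not its
  cell.\<close>

lemma cut_diag:
  assumes "cut d (lab q) s" "q \<in> H" "s \<in> H" "lab s \<noteq> lab q"
  shows "g d s = g d q" "g (\<not> d) s \<noteq> g (\<not> d) q" "diag s \<noteq> diag q"
proof -
  obtain p1 p2 where p: "p1 \<in> H" "p2 \<in> H" "lab p1 = lab q" "lab p2 = lab q" "c d p1 < c d s" "c d s < c d p2"
    using assms(1) unfolding cut_def by blast
  have ci: "cell p1 = cell q" "cell p2 = cell q" "uncut p1 = uncut q" "uncut p2 = uncut q"
    using p(3,4) unfolding lab_def by auto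
  have "g d p1 \<le> g d s" "g d s \<le> g d p2" using g_mono p(1,2,5,6) assms(3) by auto
  then show 1: "g d s = g d q" using ci(1,2) cell_iff[of _ q d] by (metis le_antisym)
  show 2: "g (\<not> d) s \<noteq> g (\<not> d) q"
  proof
    assume "g (\<not> d) s = g (\<not> d) q"
    then have s: "cell s = cell q" using 1 cell_iff[of s q d] by simp
    have "uncut p2 \<subseteq> uncut s" "uncut s \<subseteq> uncut p1"
      using uncut_antimono[of s p2 d] uncut_antimono[of p1 s d] p(1,2,5,6) assms(3) ci s by auto
    then have "lab s = lab q" using ci s unfolding lab_def by auto
    then show False using assms(4) by blast
  qed
  show "diag s \<noteq> diag q" using 1 2 unfolding diag_def by (cases d) auto
qed

text \<open>For \<open>d = True\<close>, \<open>s\<close> cuts from a lower row, \<open>r\<close>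
  cuts from a column to the right, and \<open>r'\<close> is a companion of \<open>r\<close> in its
  cell lying below \<open>q\<close>; the induced path is \<open>s q r' q' r\<close>. For
  \<open>d = False\<close> the cuts come from the left and from above.\<close>

lemma corner_path:
  assumes H: "q \<in> H" "q' \<in> H" "s \<in> H" "r \<in> H" "r' \<in> H"
    and q: "cell q = cell q'" and s: "c d q < c d s" "c d s < c d q'" "g d s = g d q" "g (\<not> d) s < g (\<not> d) q"
    and r: "c (\<not> d) q < c (\<not> d) r" "c (\<not> d) r < c (\<not> d) q'" "g (\<not> d) r = g (\<not> d) q" "g d q < g d r"
    and r': "cell r' = cell r" "c (\<not> d) r' < c (\<not> d) q"
  shows False
proof -
  have q': "g d q' = g d q" "g (\<not> d) q' = g (\<not> d) q" using q cell_iff[of q q' d] by auto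
  have gr': "g d r' = g d r" "g (\<not> d) r' = g (\<not> d) r" using r'(1) cell_iff[of r' r d] by auto
  have lts: "lt c q q'" "lt c r' r"
    using cell_lt[OF H(1,2) q, of d] cell_lt[OF H(5,4) r'(1), of "\<not> d"] s r r'(2) by auto
  have 1: "c (\<not> d) s < c (\<not> d) q" "c (\<not> d) s < c (\<not> d) q'" "c (\<not> d) s < c (\<not> d) r" "c (\<not> d) s < c (\<not> d) r'"
    using g_less[OF H(3), of _ "\<not> d"] H s(4) q' gr' r(3) by simp_all
  have 2: "c d q < c d r" "c d q' < c d r" "c d s < c d r" "c d q < c d r'" "c d q' < c d r'" "c d s < c d r'"
    using g_less[OF _ H(4), of _ d] g_less[OF _ H(5), of _ d] H s(3) q' gr' r(4) by simp_all
  have a: "adj c s q" "adj c q r'" "adj c r' q'" "adj c q' r"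
    using 1 2 s r r' adj_iff[of c _ _ d] by auto
  have n: "lt c s q'" "lt c s r" "lt c s r'" "lt c q r"
    using 1 2 s r lt_iff[of c _ _ d] by auto
  have "ind_path c s q r' q' r"
    unfolding ind_path_def using a n lts lt_not_adj by metis
  then show False using path_freeD[OF pf] H by blast
qed

lemma corner_True:
  assumes "cut True (lab q) t" "cut False (lab q) f" "q \<in> H" "t \<in> H" "f \<in> H"
    "lab t \<noteq> lab q" "lab f \<noteq> lab q"
  shows "\<not> (diag q < diag t \<and> diag q < diag f)" "\<not> (diag t < diag q \<and> diag f < diag q)"
proof -
  note t = cut_diag[OF assms(1,3,4,6)] and f = cut_diag[OF assms(2,3,5,7), simplified]
  obtain q1 q2 where q12: "q1 \<in> H" "q2 \<in> H" "lab q1 = lab q" "lab q2 = lab q" "c True q1 < c True t" "c True t < c True q2"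
    using assms(1) unfolding cut_def by blast
  obtain q3 q4 where q34: "q3 \<in> H" "q4 \<in> H" "lab q3 = lab q" "lab q4 = lab q" "c False q3 < c False f" "c False f < c False q4"
    using assms(2) unfolding cut_def by blast
  \<comment> \<open>Cells are increasing, so one pair \<open>lo\<close>, \<open>hi\<close> of the
    piece encloses both \<open>t\<close> in position and \<open>f\<close> in value.\<close>
  define lo where "lo = (if c True q1 \<le> c True q3 then q1 else q3)"
  define hi where "hi = (if c True q2 \<le> c True q4 then q4 else q2)"
  have cells: "cell q1 = cell q" "cell q2 = cell q" "cell q3 = cell q" "cell q4 = cell q"
    using q12 q34 unfolding lab_def by auto
  have lo: "lo \<in> H" "lab lo = lab q" "c True lo < c True t" "c False lo < c False f"
    using q12 q34 cells cell_le[of q1 q3 True False] unfolding lo_def by auto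
  have hi: "hi \<in> H" "lab hi = lab q" "c True t < c True hi" "c False f < c False hi"
    using q12 q34 cells cell_le[of q4 q2 True False] cell_le[of q2 q4 True False] unfolding hi_def by auto
  have ci: "cell lo = cell hi" "cell lo = cell q" using lo(2) hi(2) unfolding lab_def by auto
  have gq: "g d lo = g d q" for d using ci(2) cell_iff[of lo q d] by simp
  \<comment> \<open>\<open>lo\<close>, \<open>t\<close> and \<open>f\<close> show that this pair of
    cells cuts below \<open>hi\<close>. The labels agree, so it also cuts below \<open>lo\<close>,
    which supplies the companion point needed in \<open>corner_path\<close>.\<close>
  have "(cell t, cell f) \<notin> uncut hi"
    using lo hi ci assms(4,5) unfolding uncut_def by auto
  then have "(cell t, cell f) \<notin> uncut lo" using lo(2) hi(2) unfolding lab_def by simp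
  then obtain s' r' where s': "s' \<in> H" "cell s' = cell t" "c True s' < c True lo"
    and r': "r' \<in> H" "cell r' = cell f" "c False r' < c False lo"
    using assms(4,5) unfolding uncut_def by auto
  show "\<not> (diag q < diag t \<and> diag q < diag f)"
  proof
    assume "diag q < diag t \<and> diag q < diag f"
    then have "g False t < g False q" "g True q < g True f" using t f unfolding diag_def by auto
    then show False
      using corner_path[of lo hi t f r' True] lo hi ci r' t f gq assms(4,5) by simp
  qed
  show "\<not> (diag t < diag q \<and> diag f < diag q)"
  proof
    assume "diag t < diag q \<and> diag f < diag q"
    then have "g False q < g False t" "g True f < g True q" using t f unfolding diag_def by auto
    then show False
      using corner_path[of lo hi f t s' False] lo hi ci s' t f gq assms(4,5) by simp
  qed
qed

text \<open>The two forbidden corners leave only opposite diagonal sides for cuts along different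
  axes. In this form P5-freeness enters both the bound on lines and the exclusion of cycles.\<close>

lemma corner:
  assumes "cut d (lab q) t" "cut (\<not> d) (lab q) f" "q \<in> H" "t \<in> H" "f \<in> H"
    "lab t \<noteq> lab q" "lab f \<noteq> lab q"
  shows "diag t < diag q \<longleftrightarrow> diag q < diag f"
proof -
  have "diag t \<noteq> diag q" "diag f \<noteq> diag q"
    using cut_diag(3)[OF assms(1,3,4,6)] cut_diag(3)[OF assms(2,3,5,7)] by auto
  then show ?thesis
    using assms corner_True[of q t f] corner_True[of q f t] by (cases d) force+
qed

section \<open>Cutting lines\<close>

definition piece where
  "piece a = {p \<in> H. lab p = a}"

text \<open>A line at \<open>v\<close> separates coordinates below \<open>v\<close> from those at
  least \<open>v\<close>. By this half-open convention the line after the last point of a piece sits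
  at its maximum plus one.\<close>

definition crosses where
  "crosses d v a \<longleftrightarrow> (\<exists>p\<in>piece a. \<exists>q\<in>piece a. c d p < v \<and> v \<le> c d q)"

text \<open>Every piece contributes lines at its ends; a line crossing a piece is continued, at the same
  place of that piece, by a perpendicular line.\<close>

primrec lines_at :: "nat \<Rightarrow> (bool \<times> int \<times> ((nat \<times> nat) \<times> ((nat \<times> nat) \<times> (nat \<times> nat)) set)) set" where
  "lines_at 0 = {(d, v, a). a \<in> lab ` H \<and> (v = Min (c d ` piece a) \<or> v = Max (c d ` piece a) + 1)}"
| "lines_at (Suc t) = {(e, h, b). b \<in> lab ` H \<and> (\<exists>v a. (\<not> e, v, a) \<in> lines_at t \<and> b \<noteq> a \<and>
     crosses (\<not> e) v b \<and> (t = 0 \<or> (\<exists>s\<in>piece b. cut (\<not> e) a s)) \<and>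
     h = Min (c e ` {p \<in> piece b. v \<le> c (\<not> e) p}))}"

declare lines_at.simps [simp del]

lemma lines_at_0_iff:
  "(d, v, a) \<in> lines_at 0 \<longleftrightarrow> a \<in> lab ` H \<and> (v = Min (c d ` piece a) \<or> v = Max (c d ` piece a) + 1)"
  unfolding lines_at.simps mem_Collect_eq prod.case by (rule refl)

lemma lines_at_Suc_iff:
  "(d, v, a) \<in> lines_at (Suc t) \<longleftrightarrow> a \<in> lab ` H \<and> (\<exists>w b. (\<not> d, w, b) \<in> lines_at t \<and> a \<noteq> b \<and>
     crosses (\<not> d) w a \<and> (t = 0 \<or> (\<exists>s\<in>piece a. cut (\<not> d) b s)) \<and>
     v = Min (c d ` {p \<in> piece a. w \<le> c (\<not> d) p}))"
  unfolding lines_at.simps mem_Collect_eq prod.case by (rule refl)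

definition lines where
  "lines d = {v. \<exists>t a. (d, v, a) \<in> lines_at t}"

text \<open>A strip between consecutive lines, encoded by the lines beyond the point: strips are
  then compared by inclusion and counted by a power set.\<close>

definition stripe where
  "stripe d p = {v \<in> lines d. c d p < v}"

lemma linesI: "(d, v, a) \<in> lines_at t \<Longrightarrow> v \<in> lines d"
  unfolding lines_def by blast

lemma fin_piece: "finite (piece a)"
  using finH unfolding piece_def by simp

lemma Min_attained:
  assumes "A \<subseteq> H" "A \<noteq> {}"
  shows "\<exists>z\<in>A. Min (c d ` A) = c d z"
proof -
  have "Min (c d ` A) \<in> c d ` A"
    using assms(2) finite_subset[OF assms(1) finH] by (intro Min_in) auto
  then show ?thesis by blast
qed

lemma Max_attained:
  assumes "A \<subseteq> H" "A \<noteq> {}"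
  shows "\<exists>z\<in>A. Max (c d ` A) = c d z"
proof -
  have "Max (c d ` A) \<in> c d ` A"
    using assms(2) finite_subset[OF assms(1) finH] by (intro Max_in) auto
  then show ?thesis by blast
qed

lemma diag_bound: "p \<in> H \<Longrightarrow> - int m \<le> diag p \<and> diag p \<le> int m"
  using griddingD(1)[OF grid, of p True] griddingD(1)[OF grid, of p False] unfolding diag_def by auto

lemma diag_lab: "lab p = lab q \<Longrightarrow> diag p = diag q"
  unfolding lab_def diag_def cell_def by simp

text \<open>After the first continuation, the next piece is required to cut the source piece. Then
  \<open>corner\<close> applies at the source and preserves the diagonal direction, so each turn
  uses up a value of \<open>diag\<close>; the bounds on \<open>diag z\<close> count the
  turns.\<close>

lemma lines_at_Suc:
  "(d, v, a) \<in> lines_at (Suc t) \<Longrightarrow> \<exists>z\<in>H. \<exists>s\<in>H. lab z = a \<and> v = c d z \<and> lab s \<noteq> a \<and> cut (\<not> d) a s \<and>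
    (diag s < diag z \<and> int t + 1 - int m \<le> diag z \<or> diag z < diag s \<and> diag z \<le> int m - int t - 1)"
proof (induction t arbitrary: d v a)
  case 0
  then obtain w b where w: "(\<not> d, w, b) \<in> lines_at 0" "a \<noteq> b" "crosses (\<not> d) w a" "a \<in> lab ` H"
    "v = Min (c d ` {p \<in> piece a. w \<le> c (\<not> d) p})"
    unfolding lines_at_Suc_iff by blast
  have "b \<in> lab ` H" using w(1) lines_at_0_iff by blast
  then have "piece b \<subseteq> H" "piece b \<noteq> {}" unfolding piece_def by auto
  then obtain s where s: "s \<in> piece b" "w = c (\<not> d) s \<or> w = c (\<not> d) s + 1"
    using w(1) Min_attained[of "piece b" "\<not> d"] Max_attained[of "piece b" "\<not> d"]
    unfolding lines_at_0_iff by metis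
  obtain p q where pq: "p \<in> piece a" "q \<in> piece a" "c (\<not> d) p < w" "w \<le> c (\<not> d) q"
    using w(3) unfolding crosses_def by blast
  have "c (\<not> d) p \<noteq> c (\<not> d) s" "c (\<not> d) q \<noteq> c (\<not> d) s"
    using genericD[OF gen, of p s "\<not> d"] genericD[OF gen, of q s "\<not> d"] pq s(1) w(2) unfolding piece_def by auto
  \<comment> \<open>The coordinates are distinct integers, so a line at \<open>s\<close> or just
    after \<open>s\<close> that crosses the piece leaves points of it strictly on both sides of
    \<open>s\<close>.\<close>
  then have cut: "cut (\<not> d) a s" using pq s(2) unfolding cut_def piece_def by force
  let ?A = "{p \<in> piece a. w \<le> c (\<not> d) p}"
  have "?A \<subseteq> H" "?A \<noteq> {}" using pq(2,4) unfolding piece_def by auto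
  then obtain z where z: "z \<in> ?A" "v = c d z" using w(5) Min_attained[of ?A d] by auto
  have zs: "z \<in> H" "lab z = a" "s \<in> H" "lab s \<noteq> a" using z(1) s(1) w(2) unfolding piece_def by auto
  then have "diag s \<noteq> diag z" using cut_diag(3)[of "\<not> d" z s] cut by auto
  then have "diag s < diag z \<and> int 0 + 1 - int m \<le> diag z \<or> diag z < diag s \<and> diag z \<le> int m - int 0 - 1"
    using diag_bound[OF zs(3)] by auto
  then show ?case using zs z(2) cut by (intro bexI[of _ z] bexI[of _ s] conjI) simp_all
next
  case (Suc t)
  then obtain w b r where w: "(\<not> d, w, b) \<in> lines_at (Suc t)" "a \<noteq> b" "crosses (\<not> d) w a"
    "v = Min (c d ` {p \<in> piece a. w \<le> c (\<not> d) p})" "r \<in> piece a" "cut (\<not> d) b r"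
    unfolding lines_at_Suc_iff[of d v a "Suc t"] by blast
  obtain y s where y: "y \<in> H" "s \<in> H" "lab y = b" "w = c (\<not> d) y" "lab s \<noteq> b" "cut d b s"
    "diag s < diag y \<and> int t + 1 - int m \<le> diag y \<or> diag y < diag s \<and> diag y \<le> int m - int t - 1"
    using Suc.IH[OF w(1)] by auto
  obtain p q where pq: "p \<in> piece a" "q \<in> piece a" "c (\<not> d) p < w" "w \<le> c (\<not> d) q"
    using w(3) unfolding crosses_def by blast
  have "c (\<not> d) q \<noteq> c (\<not> d) y"
    using genericD[OF gen, of q y "\<not> d"] pq y(1,3) w(2) unfolding piece_def by auto
  then have cut: "cut (\<not> d) a y" using pq y(4) unfolding cut_def piece_def by force
  let ?A = "{p \<in> piece a. w \<le> c (\<not> d) p}"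
  have "?A \<subseteq> H" "?A \<noteq> {}" using pq(2,4) unfolding piece_def by auto
  then obtain z where z: "z \<in> ?A" "v = c d z" using w(4) Min_attained[of ?A d] by auto
  have zH: "z \<in> H" "lab z = a" using z(1) unfolding piece_def by auto
  have r: "r \<in> H" "lab r = a" using w(5) unfolding piece_def by auto
  have "diag s < diag y \<longleftrightarrow> diag y < diag r"
    using corner[of d y s r] y w(2,6) r by auto
  moreover have "diag r = diag z" using diag_lab r zH by metis
  moreover have "diag z \<noteq> diag y" using cut_diag(3)[of "\<not> d" z y] cut zH y w(2) by auto
  ultimately have "diag y < diag z \<and> int (Suc t) + 1 - int m \<le> diag z \<or>
      diag z < diag y \<and> diag z \<le> int m - int (Suc t) - 1"
    using y(7) by auto
  moreover have "lab y \<noteq> a" using y(3) w(2) by simp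
  ultimately show ?case using zH z(2) y(1) cut by (intro bexI[of _ z] bexI[of _ y] conjI) simp_all
qed

lemma lines_at_empty:
  assumes "2 * m + 1 < t"
  shows "lines_at t = {}"
proof (rule ccontr)
  assume "lines_at t \<noteq> {}"
  then obtain d v a where "(d, v, a) \<in> lines_at t" by (metis prod_cases3 ex_in_conv)
  moreover obtain k where k: "t = Suc k" using assms by (cases t) auto
  ultimately obtain z where "z \<in> H" "int k + 1 - int m \<le> diag z \<or> diag z \<le> int m - int k - 1"
    using lines_at_Suc[of d v a k] by blast
  then show False using diag_bound[of z] assms k by auto
qed

lemma base_line:
  assumes "q \<in> H"
  shows "(d, Min (c d ` piece (lab q)), lab q) \<in> lines_at 0" "(d, Max (c d ` piece (lab q)) + 1, lab q) \<in> lines_at 0"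
  unfolding lines_at_0_iff using assms by blast+

lemma piece_ends:
  assumes "q \<in> H"
  shows "Min (c d ` piece (lab q)) \<le> c d q" "c d q \<le> Max (c d ` piece (lab q))"
  using assms fin_piece by (auto intro!: Min_le Max_ge simp: piece_def)

text \<open>The lines at both ends of the piece of \<open>p\<close> confine the strip to the extent
  of that piece; genericity makes the inequalities strict.\<close>

lemma stripe_cut:
  assumes "p \<in> H" "q \<in> H" "lab p \<noteq> lab q" "stripe d p = stripe d q"
  shows "cut d (lab p) q"
proof -
  let ?P = "piece (lab p)"
  have P: "?P \<subseteq> H" "?P \<noteq> {}" using assms(1) unfolding piece_def by auto
  obtain a b where a: "a \<in> ?P" "Min (c d ` ?P) = c d a" and b: "b \<in> ?P" "Max (c d ` ?P) = c d b"
    using Min_attained[OF P] Max_attained[OF P] by blast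
  have "c d a \<in> lines d" "c d b + 1 \<in> lines d"
    using linesI[OF base_line(1)[OF assms(1), of d]] linesI[OF base_line(2)[OF assms(1), of d]] a(2) b(2) by auto
  moreover have "c d a \<le> c d p" "c d p \<le> c d b" using piece_ends[OF assms(1), of d] a(2) b(2) by auto
  moreover have "v \<in> lines d \<Longrightarrow> c d p < v \<longleftrightarrow> c d q < v" for v using assms(4) unfolding stripe_def by blast
  ultimately have "c d a \<le> c d q" "c d q \<le> c d b" by (force simp: not_less[symmetric])+
  moreover have "c d a \<noteq> c d q" "c d b \<noteq> c d q"
    using genericD[OF gen, of a q d] genericD[OF gen, of b q d] a(1) b(1) assms(2,3) unfolding piece_def by auto
  ultimately show ?thesis using a(1) b(1) unfolding cut_def piece_def by force
qed

text \<open>The perpendicular line starts at the first point of the piece beyond the crossing, and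
  the piece is increasing, so it separates the same two points.\<close>

lemma derived_line:
  assumes line: "(d, v, a) \<in> lines_at t" "lab p \<noteq> a" "t = 0 \<or> (\<exists>s\<in>piece (lab p). cut d a s)"
    and pq: "p \<in> H" "q \<in> H" "lab p = lab q" "c d p < v" "v \<le> c d q"
  shows "\<exists>h\<in>lines (\<not> d). c (\<not> d) p < h \<and> h \<le> c (\<not> d) q"
proof -
  let ?A = "{x \<in> piece (lab p). v \<le> c d x}"
  let ?h = "Min (c (\<not> d) ` ?A)"
  have "crosses d v (lab p)" using pq unfolding crosses_def piece_def by auto
  then have "(\<not> d, ?h, lab p) \<in> lines_at (Suc t)"
    unfolding lines_at_Suc_iff not_not using line pq(1) by blast
  then have 1: "?h \<in> lines (\<not> d)" by (rule linesI)
  have A: "?A \<subseteq> H" "q \<in> ?A" using pq unfolding piece_def by auto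
  then obtain z where z: "z \<in> ?A" "?h = c (\<not> d) z" using Min_attained[of ?A "\<not> d"] by blast
  have "?h \<le> c (\<not> d) q" using A finite_subset[OF A(1) finH] by (intro Min_le) auto
  moreover have "c (\<not> d) p < c (\<not> d) z"
    using cell_less[of p z d "\<not> d"] z(1) pq(1,4) unfolding piece_def lab_def by auto
  ultimately show ?thesis using 1 z(2) by auto
qed

text \<open>A line stemming from the piece of \<open>p\<close> is either an end line, which
  separates no two of its points, or continues a perpendicular line that separates the same points.
  A line from another piece is continued into this one, possibly after replacing it by an end
  line.\<close>

lemma line_transfer:
  assumes v: "v \<in> lines d" and pq: "p \<in> H" "q \<in> H" "lab p = lab q" "c d p < v" "v \<le> c d q"
  shows "\<exists>h\<in>lines (\<not> d). c (\<not> d) p < h \<and> h \<le> c (\<not> d) q"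
proof -
  obtain t a where ta: "(d, v, a) \<in> lines_at t" using v unfolding lines_def by blast
  show ?thesis
  proof (cases "lab p = a")
    case True
    show ?thesis
    proof (cases t)
      case 0
      then have "v = Min (c d ` piece (lab p)) \<or> v = Max (c d ` piece (lab q)) + 1"
        using ta True pq(3) lines_at_0_iff by metis
      then show ?thesis using piece_ends[OF pq(1), of d] piece_ends[OF pq(2), of d] pq(4,5) by auto
    next
      case (Suc k)
      then obtain h b where h: "(\<not> d, h, b) \<in> lines_at k" "v = Min (c d ` {x \<in> piece a. h \<le> c (\<not> d) x})"
        "crosses (\<not> d) h a" using ta unfolding Suc lines_at_Suc_iff by blast
      let ?A = "{x \<in> piece a. h \<le> c (\<not> d) x}"
      have A: "?A \<subseteq> H" "?A \<noteq> {}" using h(3) unfolding crosses_def piece_def by auto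
      then obtain z where z: "z \<in> ?A" "v = c d z" using h(2) Min_attained[of ?A d] by auto
      have "c (\<not> d) p < h"
      proof (rule ccontr)
        assume "\<not> ?thesis"
        then have "p \<in> ?A" using pq(1) True unfolding piece_def by auto
        then have "v \<le> c d p" unfolding h(2) using finite_subset[OF A(1) finH] by (intro Min_le) auto
        then show False using pq(4) by simp
      qed
      moreover have "c (\<not> d) z \<le> c (\<not> d) q"
        using cell_le[of z q d "\<not> d"] z pq True unfolding piece_def lab_def by auto
      ultimately show ?thesis using z(1) linesI[OF h(1)] by force
    qed
  next
    case False
    show ?thesis
    proof (cases "t = 0 \<or> (\<exists>s\<in>piece (lab p). cut d a s)")
      case True
      then show ?thesis using derived_line[OF ta False _ pq] by blast
    next
      \<comment> \<open>No point of the piece of \<open>p\<close> cuts \<open>a\<close> along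
        \<open>d\<close>, so \<open>p\<close> precedes all of \<open>a\<close>. The first end line
        of \<open>a\<close> then also separates \<open>p\<close> from \<open>q\<close>, and end
        lines are continued without the cut condition.\<close>
      case nocut: False
      then obtain k where "t = Suc k" by (cases t) auto
      then obtain z where z: "z \<in> H" "lab z = a" "v = c d z" using lines_at_Suc[of d v a k] ta by blast
      let ?P = "piece (lab z)"
      have P: "?P \<subseteq> H" "?P \<noteq> {}" using z unfolding piece_def by auto
      obtain x where x: "x \<in> ?P" "Min (c d ` ?P) = c d x" using Min_attained[OF P] by blast
      have xz: "c d x \<le> c d z" using piece_ends[OF z(1), of d] x(2) by simp
      have "c d p \<noteq> c d x" using genericD[OF gen, of p x d] x(1) pq(1) z(2) False unfolding piece_def by auto
      moreover have "\<not> c d x < c d p"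
      proof
        assume "c d x < c d p"
        then have "cut d a p" using x(1) z pq(4) unfolding cut_def piece_def by force
        then show False using nocut pq(1) unfolding piece_def by blast
      qed
      ultimately have 1: "c d p < c d x" by simp
      have "(d, c d x, a) \<in> lines_at 0" using base_line(1)[OF z(1), of d] x(2) z(2) by simp
      then show ?thesis using derived_line[OF _ False _ pq(1-3) 1] xz z(3) pq(5) by simp
    qed
  qed
qed

text \<open>Lines of both axes divide a piece at the same places, so inside a piece a step along one
  axis is a step along the other as well.\<close>

lemma stripe_perp:
  assumes "p \<in> H" "q \<in> H" "lab p = lab q" "stripe d p = stripe d q"
  shows "stripe (\<not> d) p = stripe (\<not> d) q"
proof -
  have *: "stripe (\<not> d) x = stripe (\<not> d) y"
    if xy: "x \<in> H" "y \<in> H" "lab x = lab y" "stripe d x = stripe d y" "c (\<not> d) x \<le> c (\<not> d) y" for x y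
  proof (rule ccontr)
    assume "\<not> ?thesis"
    then obtain v where v: "v \<in> lines (\<not> d)" "c (\<not> d) x < v" "v \<le> c (\<not> d) y"
      using xy(5) unfolding stripe_def by force
    then obtain h where "h \<in> lines d" "c d x < h" "h \<le> c d y"
      using line_transfer[OF v(1) xy(1-3) v(2,3)] by auto
    then show False using xy(4) unfolding stripe_def by (metis (no_types, lifting) mem_Collect_eq not_less)
  qed
  show ?thesis
    using *[of p q] *[of q p] assms by (metis linear)
qed


section \<open>Acyclicity and the encoding word\<close>

text \<open>The word must list \<open>p\<close> before \<open>q\<close> in this case: letters record
  only strips, so within a common strip the order along \<open>d\<close> has to come from the
  word.\<close>

definition step where
  "step d p q \<longleftrightarrow> p \<in> H \<and> q \<in> H \<and> stripe d p = stripe d q \<and> c d p < c d q"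

text \<open>Normal form for chains of steps: axes alternate and every step changes the label. Steps
  inside a piece are treated apart, as \<open>climb\<close>.\<close>

inductive walk :: "bool \<Rightarrow> 'p \<Rightarrow> 'p \<Rightarrow> bool" where
  single: "step d p q \<Longrightarrow> lab p \<noteq> lab q \<Longrightarrow> walk d p q"
| turn: "walk (\<not> d) p s \<Longrightarrow> step d s q \<Longrightarrow> lab s \<noteq> lab q \<Longrightarrow> walk d p q"

definition climb where
  "climb p q \<longleftrightarrow> lab p = lab q \<and> step True p q \<and> step False p q"

lemma step_trans: "step d p q \<Longrightarrow> step d q r \<Longrightarrow> step d p r"
  unfolding step_def by auto

lemma step_climb:
  assumes "step d p q" "lab p = lab q"
  shows "climb p q"
proof -
  have H: "p \<in> H" "q \<in> H" "cell p = cell q" and 1: "stripe d p = stripe d q" "c d p < c d q"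
    using assms unfolding step_def lab_def by auto
  have "stripe (\<not> d) p = stripe (\<not> d) q" using stripe_perp[OF H(1,2) assms(2) 1(1)] .
  then have "stripe e p = stripe e q" for e using 1(1) by (cases "e = d") auto
  moreover have "c e p < c e q" for e using cell_less[OF H 1(2)] .
  ultimately show ?thesis using H assms(2) unfolding climb_def step_def by blast
qed

lemma climb_step: "climb p q \<Longrightarrow> step d p q"
  unfolding climb_def by (cases d) auto

lemma step_cut:
  assumes "step d p q" "lab p \<noteq> lab q"
  shows "cut d (lab p) q" "cut d (lab q) p"
  using assms stripe_cut[of p q d] stripe_cut[of q p d] unfolding step_def by auto

lemma walk_last:
  "walk d p q \<Longrightarrow> \<exists>s. step d s q \<and> lab s \<noteq> lab q \<and> (s = p \<or> walk (\<not> d) p s)"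
  by (erule walk.cases) auto

text \<open>At each turn the corner condition forces the walk to continue in the same diagonal direction.\<close>

lemma walk_monotone:
  "walk d p q \<Longrightarrow> \<exists>s. step d s q \<and> lab s \<noteq> lab q \<and>
     (diag s < diag q \<and> diag p < diag q \<or> diag q < diag s \<and> diag q < diag p)"
proof (induction rule: walk.induct)
  case (single d p q)
  have "diag q \<noteq> diag p"
    using cut_diag(3)[OF step_cut(1)[OF single]] single unfolding step_def by auto
  then show ?case using single by (intro exI[of _ p]) auto
next
  case (turn d p s q)
  obtain o' where o': "step (\<not> d) o' s" "lab o' \<noteq> lab s"
    "diag o' < diag s \<and> diag p < diag s \<or> diag s < diag o' \<and> diag s < diag p"
    using turn.IH by blast
  have H: "s \<in> H" "q \<in> H" "o' \<in> H" using turn.hyps(2) o'(1) unfolding step_def by auto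
  have "diag q < diag s \<longleftrightarrow> diag s < diag o'"
    using corner[OF step_cut(1)[OF turn.hyps(2,3)] step_cut(2)[OF o'(1,2)] H] turn.hyps(3) o'(2) by auto
  moreover have "diag q \<noteq> diag s"
    using cut_diag(3)[OF step_cut(1)[OF turn.hyps(2,3)] H(1,2)] turn.hyps(3) by auto
  ultimately show ?case using turn.hyps(2,3) o'(3) by (intro exI[of _ s]) auto
qed

lemma walk_irrefl: "\<not> walk d p p"
  using walk_monotone[of d p p] by auto

lemma walk_climb:
  assumes "walk d p q" "climb q r"
  shows "walk d p r"
proof -
  obtain s where s: "step d s q" "lab s \<noteq> lab q" "s = p \<or> walk (\<not> d) p s" using walk_last[OF assms(1)] by blast
  have "step d s r" using step_trans[OF s(1) climb_step[OF assms(2)]] .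
  moreover have "lab s \<noteq> lab r" using s(2) assms(2) unfolding climb_def by simp
  ultimately show ?thesis using s(3) walk.intros by blast
qed

text \<open>A further step inside a piece is absorbed, and one along the last axis merges with the
  last step; merging may return to the label before that step, leaving a climb after a shorter walk.
  Only a step along the other axis to a new label makes the walk longer.\<close>

lemma walk_step:
  assumes "walk d p q" "step e q r"
  shows "(\<exists>e. walk e p r) \<or> climb p r"
proof (cases "lab q = lab r")
  case True
  then show ?thesis using walk_climb[OF assms(1) step_climb[OF assms(2)]] by blast
next
  case neq: False
  show ?thesis
  proof (cases "e = d")
    case False
    then have "walk (\<not> e) p q" using assms(1) by (cases e; cases d) auto
    then show ?thesis using walk.turn[OF _ assms(2) neq] by blast
  next
    case True
    obtain s where s: "step d s q" "lab s \<noteq> lab q" "s = p \<or> walk (\<not> d) p s" using walk_last[OF assms(1)] by blast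
    have sr: "step d s r" using step_trans[OF s(1)] assms(2) True by blast
    show ?thesis
    proof (cases "lab s = lab r")
      case True
      then show ?thesis using step_climb[OF sr] walk_climb[of "\<not> d" p s r] s(3) by blast
    next
      case False
      then show ?thesis using s(3) sr walk.intros by blast
    qed
  qed
qed

lemma climb_then_step:
  assumes "climb p q" "step e q r"
  shows "(\<exists>e. walk e p r) \<or> climb p r"
  using step_trans[OF climb_step[OF assms(1)] assms(2)] step_climb[of e p r] walk.single[of e p r] by blast

text \<open>A closed chain would reduce to a closed walk, impossible since \<open>diag\<close>
  changes strictly, or to a climb from a point to itself.\<close>

lemma acyclic_step: "acyclic {(p, q). \<exists>d. step d p q}"
proof -
  have "(p, q) \<in> {(p, q). \<exists>d. step d p q}\<^sup>+ \<Longrightarrow> (\<exists>e. walk e p q) \<or> climb p q" for p q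
  proof (induction rule: trancl_induct)
    case (base y)
    then show ?case using step_climb walk.single by blast
  next
    case (step y z)
    then show ?case using walk_step climb_then_step by blast
  qed
  then show ?thesis
    using walk_irrefl unfolding acyclic_def climb_def step_def by blast
qed

section \<open>Counting labels, lines and letters\<close>

lemma stripe_antimono: "c d p \<le> c d q \<Longrightarrow> stripe d q \<subseteq> stripe d p"
  unfolding stripe_def by auto

definition label_bound :: nat where
  "label_bound = card (({..m} \<times> {..m}) \<times> Pow (({..m} \<times> {..m}) \<times> ({..m} \<times> {..m})))"

lemma card_labels: "card (lab ` H) \<le> label_bound"
  unfolding label_bound_def
proof (intro card_mono)
  have "cell p \<in> {..m} \<times> {..m}" if "p \<in> H" for p
    using griddingD(1)[OF grid that] unfolding cell_def by auto
  then show "lab ` H \<subseteq> ({..m} \<times> {..m}) \<times> Pow (({..m} \<times> {..m}) \<times> ({..m} \<times> {..m}))"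
    unfolding lab_def uncut_def by fastforce
qed simp

text \<open>Each label has four initial lines (two axes, two ends), and a line has at most one
  continuation into each piece.\<close>

lemma card_lines_at: "finite (lines_at t) \<and> card (lines_at t) \<le> 4 * label_bound ^ Suc t"
proof (induction t)
  case 0
  let ?f = "\<lambda>(d, e, a). (d, if e then Min (c d ` piece a) else Max (c d ` piece a) + 1, a)"
  let ?A = "(UNIV :: bool set) \<times> (UNIV :: bool set) \<times> lab ` H"
  have sub: "lines_at 0 \<subseteq> ?f ` ?A"
  proof
    fix x assume x: "x \<in> lines_at 0"
    obtain d v a where xe: "x = (d, v, a)" by (metis prod_cases3)
    then have "a \<in> lab ` H" "v = Min (c d ` piece a) \<or> v = Max (c d ` piece a) + 1" using x lines_at_0_iff by auto
    then have "(d, True, a) \<in> ?A \<and> x = ?f (d, True, a) \<or> (d, False, a) \<in> ?A \<and> x = ?f (d, False, a)"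
      using xe by auto
    then show "x \<in> ?f ` ?A" by (elim disjE conjE) (rule image_eqI, assumption, assumption)+
  qed
  have fin: "finite ?A" using finH by simp
  have "card (lines_at 0) \<le> card ?A" using surj_card_le[OF fin sub] .
  then show ?case using card_labels finite_subset[OF sub] fin by (simp add: card_cartesian_product)
next
  case (Suc t)
  let ?f = "\<lambda>((d, v, a), b). (\<not> d, Min (c (\<not> d) ` {p \<in> piece b. v \<le> c d p}), b)"
  let ?A = "lines_at t \<times> lab ` H"
  have sub: "lines_at (Suc t) \<subseteq> ?f ` ?A"
  proof
    fix x assume x: "x \<in> lines_at (Suc t)"
    obtain d v a where xe: "x = (d, v, a)" by (metis prod_cases3)
    then obtain w b where "a \<in> lab ` H" "(\<not> d, w, b) \<in> lines_at t" "v = Min (c d ` {p \<in> piece a. w \<le> c (\<not> d) p})"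
      using x unfolding xe lines_at_Suc_iff by blast
    then have "((\<not> d, w, b), a) \<in> ?A \<and> x = ?f ((\<not> d, w, b), a)" using xe by auto
    then show "x \<in> ?f ` ?A" by (elim conjE) (rule image_eqI, assumption, assumption)
  qed
  have fin: "finite ?A" using Suc finH by simp
  have "card (lines_at (Suc t)) \<le> card (lines_at t) * card (lab ` H)"
    using surj_card_le[OF fin sub] by (simp add: card_cartesian_product)
  also have "\<dots> \<le> (4 * label_bound ^ Suc t) * label_bound" using Suc card_labels by (intro mult_le_mono) auto
  finally show ?case using finite_subset[OF sub] fin by (simp add: ac_simps)
qed

definition line_bound :: nat where
  "line_bound = (\<Sum>t\<le>2 * m + 1. 4 * label_bound ^ Suc t)"

lemma card_lines: "finite (lines d)" "card (lines d) \<le> line_bound"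
proof -
  let ?A = "\<Union>t\<le>2 * m + 1. lines_at t"
  have sub: "lines d \<subseteq> (\<lambda>(d, v, a). v) ` ?A"
  proof
    fix v assume "v \<in> lines d"
    then obtain t a where t: "(d, v, a) \<in> lines_at t" unfolding lines_def by blast
    then have "t \<le> 2 * m + 1" using lines_at_empty[of t] by (cases "2 * m + 1 < t") auto
    then show "v \<in> (\<lambda>(d, v, a). v) ` ?A" using t by (intro image_eqI[of _ _ "(d, v, a)"]) auto
  qed
  have fin: "finite ?A" using card_lines_at by blast
  then show "finite (lines d)" using sub finite_subset by blast
  have "card (lines d) \<le> card ?A" using surj_card_le[OF fin sub] .
  also have "\<dots> \<le> (\<Sum>t\<le>2 * m + 1. card (lines_at t))" by (rule card_UN_le) simp
  also have "\<dots> \<le> line_bound" unfolding line_bound_def using card_lines_at by (intro sum_mono) blast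
  finally show "card (lines d) \<le> line_bound" .
qed

lemma card_letters: "card ((\<lambda>p. (stripe True p, stripe False p)) ` H) \<le> 2 ^ line_bound * 2 ^ line_bound"
proof -
  have "card ((\<lambda>p. (stripe True p, stripe False p)) ` H) \<le> card (Pow (lines True) \<times> Pow (lines False))"
    using card_lines(1) by (intro card_mono) (auto simp: stripe_def)
  also have "\<dots> = 2 ^ card (lines True) * 2 ^ card (lines False)"
    using card_lines(1) by (simp add: card_cartesian_product card_Pow)
  also have "\<dots> \<le> 2 ^ line_bound * 2 ^ line_bound"
    using card_lines(2) by (intro mult_le_mono power_increasing) auto
  finally show ?thesis .
qed

end

section \<open>Linear extensions and the encoding of tight point sets\<close>

lemma topological_sort:
  assumes "finite S" "acyclic r"
  shows "\<exists>xs. distinct xs \<and> set xs = S \<and> (\<forall>i j. i < j \<and> j < length xs \<longrightarrow> (xs ! j, xs ! i) \<notin> r)"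
  using assms(1)
proof (induction "card S" arbitrary: S)
  case 0
  then show ?case by (intro exI[of _ "[]"]) auto
next
  case (Suc n)
  then have S: "S \<noteq> {}" by auto
  have "acyclic (r \<inter> S \<times> S)" using assms(2) by (rule acyclic_subset) blast
  then have "wf (r \<inter> S \<times> S)" using Suc.prems by (intro finite_acyclic_wf) auto
  then obtain z where z: "z \<in> S" "\<And>y. (y, z) \<in> r \<inter> S \<times> S \<Longrightarrow> y \<notin> S"
    using S by (metis wfE_min ex_in_conv)
  have n: "n = card (S - {z})" using Suc.hyps(2) z(1) by simp
  have "finite (S - {z})" using Suc.prems by simp
  from Suc.hyps(1)[OF n this] obtain xs
    where xs: "distinct xs" "set xs = S - {z}" "\<forall>i j. i < j \<and> j < length xs \<longrightarrow> (xs ! j, xs ! i) \<notin> r"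
    by (elim exE conjE)
  have "((z # xs) ! j, (z # xs) ! i) \<notin> r" if "i < j" "j < length (z # xs)" for i j
  proof (cases i)
    case 0
    then have "(z # xs) ! j \<in> S" using that xs(2) by (cases j) (auto dest!: nth_mem)
    then have "((z # xs) ! j, z) \<notin> r" using z(2)[of "(z # xs) ! j"] z(1) by blast
    then show ?thesis using 0 by simp
  next
    case (Suc i')
    then show ?thesis using that xs(3) by (cases j) auto
  qed
  moreover have "distinct (z # xs)" "set (z # xs) = S" using xs(1,2) z(1) by auto
  ultimately show ?case by (intro exI[of _ "z # xs"] conjI allI impI) simp_all
qed

text \<open>The letter of a point is its pair of strips, and the word is a linear extension of all
  steps. Different strips reveal the order along an axis; inside a common strip the word order
  does.\<close>

lemma tight_encoding:
  fixes l :: nat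
  shows "\<exists>N. \<forall>(c :: bool \<Rightarrow> 'p \<Rightarrow> int) H. bounded_class l c H \<and> tight c H \<longrightarrow>
    (\<exists>(f :: 'p \<Rightarrow> nat) xs tab. f ` H \<subseteq> {..<N} \<and> set xs = H \<and> distinct xs \<and> tab \<subseteq> {..<N} \<times> {..<N} \<times> UNIV \<and>
      (\<forall>i j d. i < j \<and> j < length xs \<longrightarrow>
        (c d (xs ! i) < c d (xs ! j) \<longleftrightarrow> (f (xs ! i), f (xs ! j), d) \<in> tab)))"
proof -
  obtain m where m: "\<And>(c :: bool \<Rightarrow> 'p \<Rightarrow> int) H. bounded_class l c H \<Longrightarrow> tight c H \<Longrightarrow> \<exists>g. gridding c H m g"
    using bounded_gridding[of l] by blast
  \<comment> \<open>The exported constant depends on \<open>m\<close> alone, so one \<open>N\<close>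
    serves all \<open>c\<close> and \<open>H\<close>.\<close>
  define N where "N = (2 :: nat) ^ grid.line_bound m * 2 ^ grid.line_bound m"
  have "\<exists>(f :: 'p \<Rightarrow> nat) xs tab. f ` H \<subseteq> {..<N} \<and> set xs = H \<and> distinct xs \<and> tab \<subseteq> {..<N} \<times> {..<N} \<times> UNIV \<and>
      (\<forall>i j d. i < j \<and> j < length xs \<longrightarrow>
        (c d (xs ! i) < c d (xs ! j) \<longleftrightarrow> (f (xs ! i), f (xs ! j), d) \<in> tab))"
    if bc: "bounded_class l c H" and tight: "tight c H" for c :: "bool \<Rightarrow> 'p \<Rightarrow> int" and H
  proof -
    obtain g where g: "gridding c H m g" using m[OF bc tight] by blast
    interpret grid c H m g
      using bc g unfolding bounded_class_def by unfold_locales blast+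
    let ?L = "\<lambda>p. (stripe True p, stripe False p)"
    have "finite (?L ` H)" using finH by simp
    then obtain h where h: "bij_betw h (?L ` H) {0..<card (?L ` H)}" using ex_bij_betw_finite_nat by blast
    define f where "f p = h (?L p)" for p
    have fN: "f ` H \<subseteq> {..<N}"
    proof
      fix x assume "x \<in> f ` H"
      then have "x \<in> h ` ?L ` H" unfolding f_def by blast
      then have "x < card (?L ` H)" using bij_betw_imp_surj_on[OF h] by auto
      then show "x \<in> {..<N}" using card_letters unfolding N_def by simp
    qed
    have inj: "stripe d p = stripe d q" if "p \<in> H" "q \<in> H" "f p = f q" for d p q
    proof -
      have "?L p = ?L q" using inj_onD[OF bij_betw_imp_inj_on[OF h]] that unfolding f_def by blast
      then show ?thesis by (cases d) auto
    qed
    obtain xs where xs: "distinct xs" "set xs = H" "\<And>i j. i < j \<Longrightarrow> j < length xs \<Longrightarrow> \<not> (\<exists>d. step d (xs ! j) (xs ! i))"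
      using topological_sort[OF finH acyclic_step] by auto
    \<comment> \<open>Inclusion includes equality of strips: there the letter occurring earlier in
      the word has the smaller coordinate.\<close>
    define tab where "tab = {(f p, f q, d) | p q d. p \<in> H \<and> q \<in> H \<and> stripe d q \<subseteq> stripe d p}"
    have "c d (xs ! i) < c d (xs ! j) \<longleftrightarrow> (f (xs ! i), f (xs ! j), d) \<in> tab" if ij: "i < j" "j < length xs" for i j d
    proof -
      define p q where "p = xs ! i" and "q = xs ! j"
      have pq: "p \<in> H" "q \<in> H" "p \<noteq> q" using xs(1,2) ij nth_mem[of i xs] nth_mem[of j xs]
        unfolding p_def q_def by (auto simp: nth_eq_iff_index_eq)
      have nstep: "\<not> step d q p" using xs(3)[OF ij] unfolding p_def q_def by blast
      have "(f p, f q, d) \<in> tab \<longleftrightarrow> stripe d q \<subseteq> stripe d p"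
      proof
        assume "(f p, f q, d) \<in> tab"
        then obtain p' q' where "p' \<in> H" "q' \<in> H" "f p = f p'" "f q = f q'" "stripe d q' \<subseteq> stripe d p'"
          unfolding tab_def by blast
        then show "stripe d q \<subseteq> stripe d p" using inj[of p p' d] inj[of q q' d] pq(1,2) by simp
      next
        assume "stripe d q \<subseteq> stripe d p"
        then show "(f p, f q, d) \<in> tab" using pq(1,2) unfolding tab_def by blast
      qed
      also have "\<dots> \<longleftrightarrow> c d p < c d q"
      proof
        assume sub: "stripe d q \<subseteq> stripe d p"
        show "c d p < c d q"
        proof (rule ccontr)
          assume "\<not> ?thesis"
          then have "c d q < c d p" using genericD[OF gen pq(1,2), of d] pq(3) by force
          moreover then have "stripe d p = stripe d q" using stripe_antimono[of d q p] sub by auto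
          ultimately show False using nstep pq(1,2) unfolding step_def by simp
        qed
      qed (use stripe_antimono[of d p q] in simp)
      finally show ?thesis unfolding p_def q_def by simp
    qed
    moreover have "tab \<subseteq> {..<N} \<times> {..<N} \<times> UNIV" using fN unfolding tab_def by blast
    ultimately show ?thesis using fN xs(1,2) by (intro exI[of _ f] exI[of _ xs] exI[of _ tab]) blast
  qed
  then show ?thesis by blast
qed

section \<open>Decomposition into connected intervals\<close>

definition convex_block :: "(bool \<Rightarrow> 'p \<Rightarrow> int) \<Rightarrow> 'p set \<Rightarrow> 'p set \<Rightarrow> bool" where
  "convex_block c S M \<longleftrightarrow> (\<forall>v\<in>S - M. \<forall>d. \<not> between c d v M)"

text \<open>Blocks differ from \<open>S\<close> so that their clique bound drops, and are connected
  so that the induction hypothesis covers them.\<close>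

definition block_partition :: "(bool \<Rightarrow> 'p \<Rightarrow> int) \<Rightarrow> 'p set \<Rightarrow> 'p set set \<Rightarrow> bool" where
  "block_partition c S P \<longleftrightarrow> partition_on S P \<and> (\<forall>M\<in>P. conn c M \<and> convex_block c S M \<and> M \<noteq> S)"

lemma convex_block_order:
  assumes gen: "generic c S" and M: "M \<subseteq> S" "convex_block c S M" and p: "p \<in> M" "p' \<in> M" and q: "q \<in> S" "q \<notin> M"
  shows "c d p < c d q \<longleftrightarrow> c d p' < c d q"
proof -
  have "c d p \<noteq> c d q" "c d p' \<noteq> c d q"
    using genericD[OF gen, of p q d] genericD[OF gen, of p' q d] M(1) p q by blast+
  moreover have "\<not> between c d q M" using M(2) q unfolding convex_block_def by blast
  ultimately show ?thesis using p unfolding between_def by force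
qed

lemma block_partitionD:
  assumes "block_partition c S P" "M \<in> P"
  shows "M \<subseteq> S" "conn c M" "convex_block c S M" "M \<noteq> S" "M \<noteq> {}"
  using assms unfolding block_partition_def partition_on_def by auto

lemma block_partition_disjoint:
  assumes "block_partition c S P" "M \<in> P" "M' \<in> P" "x \<in> M" "x \<in> M'"
  shows "M = M'"
proof -
  have "disjoint P" using assms(1) unfolding block_partition_def partition_on_def by blast
  then show ?thesis using assms(2-5) unfolding disjoint_def by blast
qed

text \<open>Disjoint intervals do not interleave on either axis, so any representatives show the
  order of their blocks.\<close>

lemma block_partition_order:
  assumes gen: "generic c S" and P: "block_partition c S P" and M: "M \<in> P" "M' \<in> P" "M \<noteq> M'"
    and p: "p \<in> M" "p' \<in> M" and q: "q \<in> M'" "q' \<in> M'"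
  shows "c d p < c d q \<longleftrightarrow> c d p' < c d q'"
proof -
  have out: "q \<in> S" "q \<notin> M" "p' \<in> S" "p' \<notin> M'"
    using block_partitionD(1)[OF P] block_partition_disjoint[OF P M(1,2)] M p q by blast+
  have "c d p < c d q \<longleftrightarrow> c d p' < c d q"
    using convex_block_order[OF gen block_partitionD(1,3)[OF P M(1)] p out(1,2)] .
  moreover have "c d q < c d p' \<longleftrightarrow> c d q' < c d p'"
    using convex_block_order[OF gen block_partitionD(1,3)[OF P M(2)] q out(3,4)] .
  moreover have "c d p' \<noteq> c d q" "c d p' \<noteq> c d q'"
    using genericD[OF gen, of p' q d] genericD[OF gen, of p' q' d] out block_partitionD(1)[OF P M(2)] q by blast+
  ultimately show ?thesis by force
qed

text \<open>The blocks represented in an unsplit connected set of representatives could be merged into one.\<close>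

lemma minimal_partition_tight:
  assumes gen: "generic c S" and P: "block_partition c S P"
    and min: "\<And>P'. block_partition c S P' \<Longrightarrow> card P \<le> card P'"
    and rep: "\<And>M. M \<in> P \<Longrightarrow> rep M \<in> M"
  shows "tight c (rep ` P)"
  unfolding tight_def
proof (intro allI impI)
  fix A assume A: "A \<subseteq> rep ` P" "conn c A \<and> 2 \<le> card A \<and> A \<noteq> rep ` P"
  have finS: "finite S" using gen by (simp add: generic_def)
  have part: "\<Union>P = S" "{} \<notin> P" "disjoint P" using P unfolding block_partition_def partition_on_def by blast+
  have finP: "finite P" using finS part(1) finite_UnionD by blast
  note disj = block_partition_disjoint[OF P]
  have inj: "inj_on rep P" using disj rep by (metis inj_onI)
  define B where "B = {M \<in> P. rep M \<in> A}"
  have AB: "A = rep ` B" using A(1) unfolding B_def by blast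
  have BP: "B \<subseteq> P" unfolding B_def by blast
  have "card B = card A" using AB card_image[of rep B] inj_on_subset[OF inj BP] by simp
  then have cB: "2 \<le> card B" using A(2) by simp
  obtain M0 where M0: "M0 \<in> P" "M0 \<notin> B" using A AB BP by blast
  show "\<exists>v\<in>rep ` P - A. \<exists>d. between c d v A"
  proof (rule ccontr)
    assume neg: "\<not> ?thesis"
    define P' where "P' = insert (\<Union>B) (P - B)"
    have out: "x \<notin> M" if "M \<in> P - B" "x \<in> \<Union>B" for x M
      using that BP disj by blast
    have ne: "\<Union>B \<noteq> {}" using cB part(2) BP by (metis card.empty Sup_bot_conv(1) not_numeral_le_zero subset_eq ex_in_conv)
    have notin: "\<Union>B \<notin> P - B" using out ne by blast
    have "finite B" using finP BP finite_subset by blast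
    then have "card P' = Suc (card P - card B)"
      using notin finP BP unfolding P'_def by (simp add: card_Diff_subset)
    moreover have "card B \<le> card P" using finP BP card_mono by blast
    \<comment> \<open>At least two blocks are replaced by one.\<close>
    ultimately have less: "card P' < card P" using cB by simp
    have cross: "c d p < c d v \<longleftrightarrow> c d (rep M) < c d (rep M')"
      if "M \<in> P" "M' \<in> P" "M \<noteq> M'" "p \<in> M" "v \<in> M'" for d p v M M'
      using block_partition_order[OF gen P that(1-4) rep[OF that(1)] that(5) rep[OF that(2)]] .
    have "convex_block c S (\<Union>B)"
      unfolding convex_block_def
    proof (intro ballI allI notI)
      fix v d assume v: "v \<in> S - \<Union>B" "between c d v (\<Union>B)"
      then obtain Mv where Mv: "Mv \<in> P" "v \<in> Mv" "Mv \<notin> B" using part(1) by blast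
      obtain a b Ma Mb where ab: "a \<in> Ma" "Ma \<in> B" "b \<in> Mb" "Mb \<in> B" "c d a < c d v" "c d v < c d b"
        using v(2) unfolding between_def by blast
      have "Ma \<in> P" "Mb \<in> P" "Ma \<noteq> Mv" "Mv \<noteq> Mb" using ab Mv BP by blast+
      then have "c d (rep Ma) < c d (rep Mv)" "c d (rep Mv) < c d (rep Mb)"
        using cross[of Ma Mv a v d] cross[of Mv Mb v b d] ab Mv by auto
      moreover have "rep Ma \<in> A" "rep Mb \<in> A" using ab(2,4) AB by blast+
      ultimately have "between c d (rep Mv) A" unfolding between_def by blast
      moreover have "rep Mv \<in> rep ` P - A" using Mv(1,3) unfolding B_def by blast
      ultimately show False using neg by blast
    qed
    moreover have "conn c (\<Union>B)"
      unfolding conn_def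
    proof (intro conjI allI impI)
      show "\<Union>B \<noteq> {}" by (rule ne)
      fix X assume X: "X \<subseteq> \<Union>B" "X \<noteq> {} \<and> X \<noteq> \<Union>B"
      \<comment> \<open>Either \<open>X\<close> cuts through a connected block, or it is a union of
        blocks and an edge between representatives in \<open>A\<close> leaves it.\<close>
      show "\<exists>p\<in>X. \<exists>q\<in>\<Union>B - X. adj c p q"
      proof (cases "\<exists>M\<in>B. X \<inter> M \<noteq> {} \<and> X \<inter> M \<noteq> M")
        case True
        then obtain M where M: "M \<in> B" "X \<inter> M \<noteq> {}" "X \<inter> M \<noteq> M" by blast
        then have "conn c M" using block_partitionD(2)[OF P] BP by blast
        then obtain p q where "p \<in> X \<inter> M" "q \<in> M" "q \<notin> X \<inter> M" "adj c p q"
          using connD[of c M "X \<inter> M"] M(2,3) by blast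
        then show ?thesis using M(1) by blast
      next
        case False
        then have all: "M \<subseteq> X \<or> M \<inter> X = {}" if "M \<in> B" for M using that by blast
        have repX: "rep M \<in> X \<longleftrightarrow> M \<subseteq> X" if "M \<in> B" for M
          using all[OF that] rep[of M] that BP by blast
        have "A \<inter> X \<noteq> {}" "A \<inter> X \<noteq> A"
        proof -
          obtain x M where "x \<in> X" "M \<in> B" "x \<in> M" using X by blast
          then show "A \<inter> X \<noteq> {}" using all[of M] repX[of M] AB by blast
          obtain y M' where "y \<notin> X" "M' \<in> B" "y \<in> M'" using X by blast
          then have "rep M' \<in> A" "rep M' \<notin> X" using repX[of M'] AB by blast+
          then show "A \<inter> X \<noteq> A" by blast
        qed
        then obtain p q where pq: "p \<in> A \<inter> X" "q \<in> A" "q \<notin> A \<inter> X" "adj c p q"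
          using connD[of c A "A \<inter> X"] A(2) by blast
        moreover have "A \<subseteq> \<Union>B" using AB rep BP by blast
        ultimately show ?thesis by blast
      qed
    qed
    moreover have "\<Union>B \<noteq> S"
    proof -
      obtain x where "x \<in> M0" using part(2) M0(1) by (metis ex_in_conv)
      then have "x \<in> S" "x \<notin> \<Union>B" using part(1) M0 out[of M0] by blast+
      then show ?thesis by blast
    qed
    moreover have "partition_on S P'"
    proof (rule partition_onI)
      show "\<Union>P' = S" using part(1) BP unfolding P'_def by blast
      show "{} \<notin> P'" using ne part(2) unfolding P'_def by blast
      show "disjnt p q" if pq: "p \<in> P'" "q \<in> P'" "p \<noteq> q" for p q
      proof -
        consider "p \<in> P - B" "q \<in> P - B" | "p = \<Union>B" "q \<in> P - B" | "q = \<Union>B" "p \<in> P - B"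
          using pq unfolding P'_def by blast
        then show ?thesis
        proof cases
          case 1
          then show ?thesis using part(3) pq(3) unfolding disjoint_def disjnt_def by blast
        next
          case 2
          then show ?thesis using out[of q] unfolding disjnt_def by blast
        next
          case 3
          then show ?thesis using out[of p] unfolding disjnt_def by blast
        qed
      qed
    qed
    ultimately have "block_partition c S P'"
      using P unfolding block_partition_def P'_def by blast
    then show False using min less by (meson not_le)
  qed
qed

lemma tight_partition:
  assumes gen: "generic c S" and conn: "conn c S" "2 \<le> card S"
  obtains P rep where "block_partition c S P" "\<And>M. M \<in> P \<Longrightarrow> rep M \<in> M" "tight c (rep ` P)"
proof -
  \<comment> \<open>Singletons show that such partitions exist; one with fewest blocks is then
    chosen.\<close>
  have "block_partition c S ((\<lambda>p. {p}) ` S)"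
    unfolding block_partition_def
  proof (intro conjI ballI)
    show "partition_on S ((\<lambda>p. {p}) ` S)" by (rule partition_onI) (auto simp: disjnt_def)
    fix M assume "M \<in> (\<lambda>p. {p}) ` S"
    then obtain p where p: "M = {p}" by blast
    then show "conn c M" by (simp add: conn_singleton)
    show "convex_block c S M" unfolding convex_block_def between_def p by auto
    show "M \<noteq> S" using conn(2) p by auto
  qed
  then obtain P where P: "block_partition c S P" "\<And>P'. block_partition c S P' \<Longrightarrow> card P \<le> card P'"
    using ex_has_least_nat[of "block_partition c S" _ card] by blast
  define rep where "rep M = (SOME x. x \<in> M)" for M :: "'a set"
  have rep: "rep M \<in> M" if "M \<in> P" for M
    using block_partitionD(5)[OF P(1) that] unfolding rep_def by (simp add: some_in_eq)
  show thesis
  proof (rule that)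
    show "block_partition c S P" by (rule P(1))
    show "rep M \<in> M" if "M \<in> P" for M using rep[OF that] .
    show "tight c (rep ` P)" by (rule minimal_partition_tight[OF gen P rep])
  qed
qed

text \<open>As \<open>S\<close> is connected, some outside point is adjacent to one point of the
  interval, hence by convexity to all of them, and it extends every decreasing set inside.\<close>

lemma block_bounded:
  assumes bc: "bounded_class (Suc l) c S" and conn: "conn c S" and P: "block_partition c S P" and M: "M \<in> P"
  shows "bounded_class l c M"
proof -
  note MD = block_partitionD[OF P M]
  have gen: "generic c S" using bc unfolding bounded_class_def by blast
  obtain m v where mv: "m \<in> M" "v \<in> S" "v \<notin> M" "adj c m v"
    using connD[OF conn MD(1,5,4)] by blast
  have vM: "adj c v k" if "k \<in> M" for k
  proof -
    have e: "c d k < c d v \<longleftrightarrow> c d m < c d v" for d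
      using convex_block_order[OF gen MD(1,3) that mv(1,2,3)] .
    have n: "c d k \<noteq> c d v" "c d m \<noteq> c d v" for d
      using genericD[OF gen, of k v d] genericD[OF gen, of m v d] MD(1) that mv by blast+
    show ?thesis
      using mv(4) e[of True] e[of False] n[of True] n[of False]
      unfolding adj_iff[of c m v True] adj_iff[of c v k True] by (simp only: not_True_eq_False) linarith
  qed
  have "\<not> (\<exists>K\<subseteq>M. card K = l \<and> decreasing c K)"
  proof
    assume "\<exists>K\<subseteq>M. card K = l \<and> decreasing c K"
    then obtain K where K: "K \<subseteq> M" "card K = l" "decreasing c K" by blast
    have "decreasing c (insert v K)" using decreasing_insert[OF K(3), of v] vM K(1) by blast
    moreover have "insert v K \<subseteq> S" using K(1) MD(1) mv(2) by blast
    moreover have "finite K" using K(1) MD(1) gen unfolding generic_def by (meson finite_subset)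
    moreover have "v \<notin> K" using K(1) mv(3) by blast
    ultimately have "card (insert v K) = Suc l" "decreasing c (insert v K)" "insert v K \<subseteq> S"
      using card_insert_disjoint K(2) by auto
    then show False using bc unfolding bounded_class_def by blast
  qed
  then show ?thesis using bounded_class_subset[OF bc MD(1)] unfolding bounded_class_def by blast
qed

section \<open>Well-quasi-ordering bounded classes\<close>

lemma singleton_bounded:
  assumes "bounded_class k c {p}" "2 \<le> l"
  shows "bounded_class l c {p}"
proof -
  have "card K \<noteq> l" if "K \<subseteq> {p}" for K
    using card_mono[OF _ that] assms(2) by auto
  then show ?thesis using assms(1) unfolding bounded_class_def by blast
qed

text \<open>The blocks are attached as labels to the word of their representatives; as blocks do not
  interleave, the table for the representatives is also correct for the blocks.\<close>

lemma connected_coded: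
  assumes N: "\<And>H. bounded_class (Suc l) coord H \<Longrightarrow> tight coord H \<Longrightarrow>
    \<exists>(f :: int \<times> int \<Rightarrow> nat) xs tab. f ` H \<subseteq> {..<N} \<and> set xs = H \<and> distinct xs \<and> tab \<subseteq> {..<N} \<times> {..<N} \<times> UNIV \<and>
      (\<forall>i j d. i < j \<and> j < length xs \<longrightarrow>
        (coord d (xs ! i) < coord d (xs ! j) \<longleftrightarrow> (f (xs ! i), f (xs ! j), d) \<in> tab))"
    and l: "2 \<le> l" and S: "bounded_class (Suc l) coord S" "conn coord S"
  shows "\<exists>tab w. tab \<subseteq> {..<Suc N} \<times> {..<Suc N} \<times> UNIV \<and>
    set w \<subseteq> {..<Suc N} \<times> {S. bounded_class l coord S \<and> conn coord S} \<and> codes tab w S"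
proof (cases "2 \<le> card S")
  case False
  have "finite S" "S \<noteq> {}" using S unfolding bounded_class_def generic_def conn_def by blast+
  then have "card S = 1" using False by (cases "card S") auto
  then obtain p where p: "S = {p}" using card_1_singletonE by blast
  have "bounded_class l coord S" unfolding p by (rule singleton_bounded[OF S(1)[unfolded p] l])
  \<comment> \<open>The bound \<open>N\<close> could be \<open>0\<close>; the alphabet
    \<open>{..<Suc N}\<close> still has a letter for this one-place word.\<close>
  moreover have "codes {} [(0, S)] S" by (simp add: codes_def)
  ultimately show ?thesis using S(2) by (intro exI[of _ "{}"] exI[of _ "[(0, S)]"]) simp
next
  case True
  have gen: "generic coord S" using S(1) unfolding bounded_class_def by blast
  obtain P rep where P: "block_partition coord S P" and rep: "\<And>M. M \<in> P \<Longrightarrow> rep M \<in> M"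
    and tight: "tight coord (rep ` P)" using tight_partition[OF gen S(2) True] by blast
  have part: "\<Union>P = S" using P unfolding block_partition_def partition_on_def by blast
  have "rep ` P \<subseteq> S" using rep part by blast
  then have "bounded_class (Suc l) coord (rep ` P)" by (rule bounded_class_subset[OF S(1)])
  from N[OF this tight] obtain f :: "int \<times> int \<Rightarrow> nat" and xs tab
    where f: "f ` rep ` P \<subseteq> {..<N}" and xs: "set xs = rep ` P" "distinct xs" and tab: "tab \<subseteq> {..<N} \<times> {..<N} \<times> UNIV"
      and code: "\<forall>i j d. i < j \<and> j < length xs \<longrightarrow>
        (coord d (xs ! i) < coord d (xs ! j) \<longleftrightarrow> (f (xs ! i), f (xs ! j), d) \<in> tab)"
    by (elim exE conjE)
  define blk where "blk = the_inv_into P rep"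
  have inj: "inj_on rep P" using block_partition_disjoint[OF P] rep by (metis inj_onI)
  have blk: "blk x \<in> P" "rep (blk x) = x" if "x \<in> rep ` P" for x
    using the_inv_into_into[OF inj that order_refl] f_the_inv_into_f[OF inj that] unfolding blk_def by auto
  define w where "w = map (\<lambda>x. (f x, blk x)) xs"
  have "blk ` rep ` P = P" using the_inv_into_f_f[OF inj] unfolding blk_def image_image by simp
  then have "\<Union>(snd ` set w) = S" using part xs(1) unfolding w_def by (simp add: image_image)
  moreover have "coord d p \<noteq> coord d q \<and> (coord d p < coord d q \<longleftrightarrow> (fst (w ! i), fst (w ! j), d) \<in> tab)"
    if ij: "i < j" "j < length w" and p: "p \<in> snd (w ! i)" and q: "q \<in> snd (w ! j)" for i j p q d
  proof -
    define x y where "x = xs ! i" and "y = xs ! j"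
    have j: "j < length xs" "i < length xs" using ij unfolding w_def by auto
    have xy: "x \<in> rep ` P" "y \<in> rep ` P" "x \<noteq> y"
      using j ij(1) xs nth_eq_iff_index_eq[OF xs(2) j] nth_mem[OF j(1)] nth_mem[OF j(2)] unfolding x_def y_def by auto
    have w: "w ! i = (f x, blk x)" "w ! j = (f y, blk y)" using j unfolding w_def x_def y_def by auto
    have ne: "blk x \<noteq> blk y" using blk(2) xy by metis
    have pq: "p \<in> blk x" "q \<in> blk y" using p q w by auto
    have "coord d p < coord d q \<longleftrightarrow> coord d x < coord d y"
      using block_partition_order[OF gen P blk(1)[OF xy(1)] blk(1)[OF xy(2)] ne pq(1) _ pq(2), of x y d]
        rep[OF blk(1)[OF xy(1)]] rep[OF blk(1)[OF xy(2)]] blk(2) xy by simp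
    also have "\<dots> \<longleftrightarrow> (f x, f y, d) \<in> tab" using code ij(1) j(1) unfolding x_def y_def by blast
    finally have 1: "coord d p < coord d q \<longleftrightarrow> (f x, f y, d) \<in> tab" .
    have "p \<noteq> q" using block_partition_disjoint[OF P blk(1)[OF xy(1)] blk(1)[OF xy(2)] pq(1)] pq(2) ne by blast
    moreover have "p \<in> S" "q \<in> S" using pq blk(1) xy(1,2) part by blast+
    ultimately have "coord d p \<noteq> coord d q" using genericD[OF gen, of p q d] by blast
    then show ?thesis using 1 w by simp
  qed
  ultimately have "codes tab w S" by (rule codesI)
  moreover have "set w \<subseteq> {..<Suc N} \<times> {S. bounded_class l coord S \<and> conn coord S}"
  proof
    fix z assume "z \<in> set w"
    then obtain x where x: "x \<in> rep ` P" "z = (f x, blk x)" using xs(1) unfolding w_def by auto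
    then have "f x \<in> {..<N}" using f by blast
    then have "f x < Suc N" by simp
    then show "z \<in> {..<Suc N} \<times> {S. bounded_class l coord S \<and> conn coord S}"
      using x(2) block_bounded[OF S P blk(1)[OF x(1)]] block_partitionD(2)[OF P blk(1)[OF x(1)]] by simp
  qed
  moreover have "tab \<subseteq> {..<Suc N} \<times> {..<Suc N} \<times> UNIV" using tab by (rule subset_trans) auto
  ultimately show ?thesis by blast
qed

lemma wqo_connected:
  assumes "2 \<le> l"
  shows "wqo_on emb {S. bounded_class l coord S \<and> conn coord S}"
  using assms
proof (induction l rule: dec_induct)
  case base
  show ?case
    unfolding wqo_on_def
  proof (intro allI impI)
    fix f :: "nat \<Rightarrow> (int \<times> int) set"
    assume f: "\<forall>i. f i \<in> {S. bounded_class 2 coord S \<and> conn coord S}"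
    \<comment> \<open>A connected set with two points would contain an inversion, that is, a
      decreasing pair.\<close>
    have "\<exists>p. f i = {p}" for i
    proof -
      have fi: "bounded_class 2 coord (f i)" "conn coord (f i)" using f by auto
      then have "\<not> 2 \<le> card (f i)" using conn_decreasing_pair unfolding bounded_class_def by blast
      moreover have "finite (f i)" "f i \<noteq> {}" using fi unfolding bounded_class_def generic_def conn_def by blast+
      ultimately have "card (f i) = 1" by (cases "card (f i)") auto
      then show ?thesis using card_1_singletonE by blast
    qed
    then obtain p q where "f 0 = {p}" "f 1 = {q}" by meson
    then have "emb (f 0) (f 1)" unfolding emb_def by (intro exI[of _ "\<lambda>_. q"]) simp
    then show "\<exists>i j. i < j \<and> emb (f i) (f j)" by (intro exI[of _ 0] exI[of _ 1]) simp
  qed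
next
  case (step l)
  obtain N where N: "\<And>H. bounded_class (Suc l) coord H \<Longrightarrow> tight coord H \<Longrightarrow>
    \<exists>(f :: int \<times> int \<Rightarrow> nat) xs tab. f ` H \<subseteq> {..<N} \<and> set xs = H \<and> distinct xs \<and> tab \<subseteq> {..<N} \<times> {..<N} \<times> UNIV \<and>
      (\<forall>i j d. i < j \<and> j < length xs \<longrightarrow>
        (coord d (xs ! i) < coord d (xs ! j) \<longleftrightarrow> (f (xs ! i), f (xs ! j), d) \<in> tab))"
    using tight_encoding[of "Suc l"] by metis
  have "{S. bounded_class (Suc l) coord S \<and> conn coord S} \<subseteq>
    {S. \<exists>tab w. tab \<subseteq> {..<Suc N} \<times> {..<Suc N} \<times> UNIV \<and>
      set w \<subseteq> {..<Suc N} \<times> {S. bounded_class l coord S \<and> conn coord S} \<and> codes tab w S}"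
    using connected_coded[OF N step.hyps(1)] by blast
  then show ?case using wqo_on_subset[OF wqo_on_coded[OF step.IH]] by blast
qed

lemma bounded_class_mono:
  assumes "bounded_class k c S" "k \<le> l"
  shows "bounded_class l c S"
proof -
  have "card K < l" if "K \<subseteq> S" "decreasing c K" for K
    using decreasing_card_less[OF assms(1) that] assms(2) by simp
  then show ?thesis using assms(1) unfolding bounded_class_def by blast
qed

text \<open>The components form a chain under \<open>before\<close>; listed in that order they are a
  word over one letter, with connected sets attached.\<close>

lemma wqo_bounded_class: "wqo_on emb {S. bounded_class l coord S}"
proof -
  \<comment> \<open>The bound is raised to at least \<open>2\<close>, where the result on connected
    sets starts.\<close>
  let ?Q = "{S. bounded_class (max 2 l) coord S \<and> conn coord S}"
  have "\<exists>tab w. tab \<subseteq> {..<1} \<times> {..<1} \<times> UNIV \<and> set w \<subseteq> {..<1} \<times> ?Q \<and> codes tab w S"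
    if S: "bounded_class l coord S" for S
  proof -
    have gen: "generic coord S" using S unfolding bounded_class_def by blast
    let ?C = "component coord S ` S"
    let ?r = "{(A, B). A \<in> ?C \<and> B \<in> ?C \<and> before coord A B}"
    have "finite ?C" using gen unfolding generic_def by simp
    have ne: "(SOME x. x \<in> A) \<in> A" if "A \<in> ?C" for A
      using that component_self[of _ S coord] by (auto simp: some_in_eq)
    have "acyclic ?r"
    proof (rule acyclicI_order)
      fix A B assume "(A, B) \<in> ?r"
      then show "- coord True (SOME x. x \<in> B) < - coord True (SOME x. x \<in> A)"
        using ne[of A] ne[of B] before_less[of coord A B] by simp
    qed
    from topological_sort[OF \<open>finite ?C\<close> this] obtain xs
      where xs: "distinct xs" "set xs = ?C" "\<forall>i j. i < j \<and> j < length xs \<longrightarrow> (xs ! j, xs ! i) \<notin> ?r"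
      by (elim exE conjE)
    define w where "w = map (\<lambda>A. (0 :: nat, A)) xs"
    define tab where "tab = {0 :: nat} \<times> {0 :: nat} \<times> (UNIV :: bool set)"
    have "\<Union>?C = S" using component_subset[of coord S] component_self[of _ S coord] by blast
    then have "\<Union>(snd ` set w) = S" using xs(2) unfolding w_def by (simp add: image_image)
    moreover have "coord d p \<noteq> coord d q \<and> (coord d p < coord d q \<longleftrightarrow> (fst (w ! i), fst (w ! j), d) \<in> tab)"
      if ij: "i < j" "j < length w" and p: "p \<in> snd (w ! i)" and q: "q \<in> snd (w ! j)" for i j p q d
    proof -
      have j: "j < length xs" "i < length xs" using ij unfolding w_def by auto
      have w: "w ! i = (0, xs ! i)" "w ! j = (0, xs ! j)" using j unfolding w_def by auto
      have C: "xs ! i \<in> ?C" "xs ! j \<in> ?C" "xs ! i \<noteq> xs ! j"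
        using nth_mem[OF j(1)] nth_mem[OF j(2)] xs(2) nth_eq_iff_index_eq[OF xs(1) j] ij(1) by auto
      then have "before coord (xs ! i) (xs ! j) \<or> before coord (xs ! j) (xs ! i)"
        using component_separated[OF gen] unfolding before_def by blast
      then have "before coord (xs ! i) (xs ! j)" using xs(3) ij(1) j(1) C by blast
      then have "coord d p < coord d q" using before_less p q w by fastforce
      then show ?thesis using w unfolding tab_def by simp
    qed
    ultimately have "codes tab w S" by (rule codesI)
    moreover have "set w \<subseteq> {..<1} \<times> ?Q"
    proof
      fix z assume "z \<in> set w"
      then obtain p where p: "p \<in> S" "z = (0, component coord S p)" using xs(2) unfolding w_def by auto
      have "bounded_class (max 2 l) coord (component coord S p)"
        by (rule bounded_class_mono[OF bounded_class_subset[OF S component_subset]]) simp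
      then show "z \<in> {..<1} \<times> ?Q" using p component_conn[OF p(1), of coord] by simp
    qed
    moreover have "tab \<subseteq> {..<1} \<times> {..<1} \<times> UNIV" unfolding tab_def by auto
    ultimately show ?thesis by blast
  qed
  then have "{S. bounded_class l coord S} \<subseteq>
    {S. \<exists>tab w. tab \<subseteq> {..<1} \<times> {..<1} \<times> UNIV \<and> set w \<subseteq> {..<1} \<times> ?Q \<and> codes tab w S}" by blast
  then show ?thesis using wqo_on_subset[OF wqo_on_coded[OF wqo_connected[of "max 2 l"]]] by (meson max.cobounded1)
qed

section \<open>Permutations\<close>

text \<open>Adjacent points are ordered oppositely on the two axes and nonadjacent ones equally, so
  the first edge and the side of \<open>r\<close> determine everything along the path. The outcome
  is 24153 for \<open>d = True\<close> and 31524 for \<open>d = False\<close>.\<close>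

lemma ind_path_order:
  assumes gen: "generic c S" and S: "p \<in> S" "q \<in> S" "r \<in> S" "s \<in> S" "t \<in> S"
    and path: "ind_path c p q r s t"
    and pq: "c d p < c d q" "c (\<not> d) q < c (\<not> d) p" and pr: "c d p < c d r"
  shows "c d p < c d r \<and> c d r < c d q \<and> c d q < c d t \<and> c d t < c d s"
    and "c (\<not> d) q < c (\<not> d) p \<and> c (\<not> d) p < c (\<not> d) s \<and> c (\<not> d) s < c (\<not> d) r \<and> c (\<not> d) r < c (\<not> d) t"
proof -
  note a = path[unfolded ind_path_def]
  have n: "lt c x y" if "x \<in> S" "y \<in> S" "\<not> adj c x y" "c e x < c e y" for x y e
    using nonadj_lt[OF gen that] .
  have ltD: "c e x < c e y" if "lt c x y" for x y e using that unfolding lt_def by blast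
  have lpr: "lt c p r" using n[OF S(1,3) _ pr] a by blast
  have rq: "c d r < c d q" "c (\<not> d) q < c (\<not> d) r"
    using a adj_iff[of c q r d] pq ltD[OF lpr, of "\<not> d"] by auto
  have rs: "c d r < c d s" "c (\<not> d) s < c (\<not> d) r"
    using a adj_iff[of c r s d] adj_iff[of c q s d] rq by auto
  have lps: "lt c p s" using n[OF S(1,4), of d] a pr rs by auto
  have ts: "c d t < c d s" "c (\<not> d) s < c (\<not> d) t"
    using a adj_iff[of c s t d] adj_iff[of c r t d] rs by auto
  have "lt c q t" using n[OF S(2,5), of "\<not> d"] a pq(2) ltD[OF lps, of "\<not> d"] ts(2) by auto
  moreover then have "lt c r t" using n[OF S(3,5), of d] a rq(1) ltD[of q t d] by auto
  ultimately show "c d p < c d r \<and> c d r < c d q \<and> c d q < c d t \<and> c d t < c d s"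
    and "c (\<not> d) q < c (\<not> d) p \<and> c (\<not> d) p < c (\<not> d) s \<and> c (\<not> d) s < c (\<not> d) r \<and> c (\<not> d) r < c (\<not> d) t"
    using pr pq(2) rq(1) rs(2) ts(1) ltD[OF lps, of "\<not> d"] ltD[of q t d] ltD[of r t "\<not> d"] by auto
qed

lemma ind_path_rev: "ind_path c p q r s t \<Longrightarrow> ind_path c t s r q p"
  unfolding ind_path_def using adj_sym[of c] by blast

text \<open>This treats the other side of \<open>r\<close>: the reversed path, read from
  \<open>t\<close>, meets the hypotheses of \<open>ind_path_order\<close> with the same
  \<open>d\<close>.\<close>

lemma ind_path_turn:
  assumes gen: "generic c S" and S: "p \<in> S" "q \<in> S" "r \<in> S" "s \<in> S" "t \<in> S"
    and path: "ind_path c p q r s t"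
    and pq: "c d p < c d q" "c (\<not> d) q < c (\<not> d) p" and pr: "\<not> c d p < c d r"
  shows "c d t < c d s" "c (\<not> d) s < c (\<not> d) t" "c d t < c d r"
proof -
  note a = path[unfolded ind_path_def]
  have n: "lt c x y" if "x \<in> S" "y \<in> S" "\<not> adj c x y" "c e x < c e y" for x y e
    using nonadj_lt[OF gen that] .
  have ltD: "c e x < c e y" if "lt c x y" for x y e using that unfolding lt_def by blast
  have "r \<noteq> p" using a by auto
  then have "c d r < c d p" using genericD[OF gen S(3,1), of d] pr by force
  then have lrp: "lt c r p" using n[OF S(3,1)] a adj_sym[of c p r] by blast
  have rq: "c d r < c d q" "c (\<not> d) q < c (\<not> d) r"
    using a adj_iff[of c q r d] pq ltD[OF lrp, of d] by auto
  have rs: "c d r < c d s" "c (\<not> d) s < c (\<not> d) r"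
    using a adj_iff[of c r s d] adj_iff[of c q s d] rq by auto
  show ts: "c d t < c d s" "c (\<not> d) s < c (\<not> d) t"
    using a adj_iff[of c s t d] adj_iff[of c r t d] rs by auto
  show "c d t < c d r"
  proof (rule ccontr)
    assume neg: "\<not> ?thesis"
    have "r \<noteq> t" using a adj_sym[of c s] by auto
    then have "c d r < c d t" using genericD[OF gen S(3,5), of d] neg by force
    then have rt: "lt c r t" using n[OF S(3,5)] a by blast
    have "c (\<not> d) s < c (\<not> d) p" using rs(2) ltD[OF lrp, of "\<not> d"] by simp
    then have "lt c s p" using n[OF S(4,1)] a adj_sym[of c p s] by blast
    then have "c d t < c d q" "c (\<not> d) q < c (\<not> d) t"
      using ts(1) pq(1) ltD[of s p d] rq(2) ltD[OF rt, of "\<not> d"] by auto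
    then show False using a adj_iff[of c q t d] by auto
  qed
qed

lemma ind_path_pattern:
  assumes gen: "generic c S" and S: "p \<in> S" "q \<in> S" "r \<in> S" "s \<in> S" "t \<in> S"
    and path: "ind_path c p q r s t"
  shows "\<exists>u\<in>S. \<exists>v\<in>S. \<exists>w\<in>S. \<exists>x\<in>S. \<exists>y\<in>S.
    c True u < c True v \<and> c True v < c True w \<and> c True w < c True x \<and> c True x < c True y \<and>
    (c False w < c False u \<and> c False u < c False y \<and> c False y < c False v \<and> c False v < c False x \<or>
     c False v < c False x \<and> c False x < c False u \<and> c False u < c False y \<and> c False y < c False w)"
proof -
  have *: ?thesis if H: "p \<in> S" "q \<in> S" "r \<in> S" "s \<in> S" "t \<in> S" "ind_path c p q r s t"
      "c d p < c d q" "c (\<not> d) q < c (\<not> d) p" "c d p < c d r" for p q r s t d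
  proof (cases d)
    case True
    then have d: "d = True" by simp
    note o = ind_path_order[OF gen H, unfolded d, simplified]
    \<comment> \<open>By position the points read \<open>p r q t s\<close>; in the case
      \<open>d = False\<close> they read \<open>q p s r t\<close>.\<close>
    show ?thesis
      by (rule bexI[of _ p], rule bexI[of _ r], rule bexI[of _ q], rule bexI[of _ t], rule bexI[of _ s])
        (simp_all add: o H(1-5))
  next
    case False
    then have d: "d = False" by simp
    note o = ind_path_order[OF gen H, unfolded d, simplified]
    show ?thesis
      by (rule bexI[of _ q], rule bexI[of _ p], rule bexI[of _ s], rule bexI[of _ r], rule bexI[of _ t])
        (simp_all add: o H(1-5))
  qed
  have "adj c p q" using path unfolding ind_path_def by blast
  then obtain d where d: "c d p < c d q" "c (\<not> d) q < c (\<not> d) p" unfolding adj_def by blast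
  show ?thesis
  proof (cases "c d p < c d r")
    case True
    then show ?thesis using *[OF S path d] by blast
  next
    case False
    note t = ind_path_turn[OF gen S path d False]
    show ?thesis using *[OF S(5,4,3,2,1) ind_path_rev[OF path] t] .
  qed
qed

section \<open>Point sets of permutations and pattern containment\<close>

definition points :: "nat list \<Rightarrow> (int \<times> int) set" where
  "points \<pi> = (\<lambda>i. (int i, int (\<pi> ! i))) ` {..<length \<pi>}"

lemma coord_simps [simp]: "coord True (a, b) = a" "coord False (a, b) = b"
  by (simp_all add: coord_def)

lemma points_generic:
  assumes "is_perm \<pi>"
  shows "generic coord (points \<pi>)"
proof -
  have d: "distinct \<pi>" using assms by (auto simp: is_perm_def permutations_of_set_def)
  have "inj_on (coord e) (points \<pi>)" for e
    by (cases e) (auto simp: inj_on_def points_def nth_eq_iff_index_eq[OF d])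
  then show ?thesis unfolding generic_def points_def by simp
qed

lemma emb_points_perm_le:
  assumes "emb (points \<sigma>) (points \<pi>)"
  shows "perm_le \<sigma> \<pi>"
proof -
  obtain f where f0: "f ` points \<sigma> \<subseteq> points \<pi> \<and>
     (\<forall>p\<in>points \<sigma>. \<forall>q\<in>points \<sigma>. \<forall>d. coord d p < coord d q \<longleftrightarrow> coord d (f p) < coord d (f q))"
    using assms unfolding emb_def by (elim exE)
  then have f: "f ` points \<sigma> \<subseteq> points \<pi>"
    "\<And>p q d. p \<in> points \<sigma> \<Longrightarrow> q \<in> points \<sigma> \<Longrightarrow> coord d p < coord d q \<longleftrightarrow> coord d (f p) < coord d (f q)"
    by auto
  define P where "P k = (int k, int (\<sigma> ! k))" for k
  have P: "P k \<in> points \<sigma>" if "k < length \<sigma>" for k using that unfolding P_def points_def by blast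
  have "\<exists>j<length \<pi>. f (P k) = (int j, int (\<pi> ! j))" if "k < length \<sigma>" for k
  proof -
    have "f (P k) \<in> points \<pi>" using f(1) P[OF that] by blast
    then show ?thesis unfolding points_def by blast
  qed
  then obtain h where h: "\<And>k. k < length \<sigma> \<Longrightarrow> h k < length \<pi> \<and> f (P k) = (int (h k), int (\<pi> ! h k))"
    by metis
  have ord: "h i < h j \<longleftrightarrow> i < j" "\<pi> ! h i < \<pi> ! h j \<longleftrightarrow> \<sigma> ! i < \<sigma> ! j"
    if "i < length \<sigma>" "j < length \<sigma>" for i j
    using f(2)[OF P[OF that(1)] P[OF that(2)], of True] f(2)[OF P[OF that(1)] P[OF that(2)], of False]
      h[OF that(1)] h[OF that(2)] by (simp_all add: P_def)
  show ?thesis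
    unfolding perm_le_def order_isomorphic_def
  proof (intro exI[of _ h] conjI)
    show "strict_mono_on {..<length \<sigma>} h" unfolding monotone_on_def using ord(1) by simp
    show "h ` {..<length \<sigma>} \<subseteq> {..<length \<pi>}" using h by blast
  qed (simp_all add: ord(2))
qed

lemma perm_leI:
  assumes "length ks = length \<sigma>" "\<And>i j. i < j \<Longrightarrow> j < length ks \<Longrightarrow> ks ! i < ks ! j"
    "\<And>k. k \<in> set ks \<Longrightarrow> k < length \<pi>"
    "\<And>i j. i < j \<Longrightarrow> j < length ks \<Longrightarrow> \<pi> ! (ks ! i) < \<pi> ! (ks ! j) \<and> \<sigma> ! i < \<sigma> ! j \<or>
      \<pi> ! (ks ! j) < \<pi> ! (ks ! i) \<and> \<sigma> ! j < \<sigma> ! i"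
  shows "perm_le \<sigma> \<pi>"
proof -
  have "\<pi> ! (ks ! i) < \<pi> ! (ks ! j) \<longleftrightarrow> \<sigma> ! i < \<sigma> ! j" if "i < length \<sigma>" "j < length \<sigma>" for i j
    using assms(4)[of i j] assms(4)[of j i] that assms(1) by (cases i j rule: linorder_cases) auto
  moreover have "ks ! k < length \<pi>" if "k < length \<sigma>" for k using assms(1,3) that by auto
  ultimately show ?thesis
    unfolding perm_le_def order_isomorphic_def
    using assms(1,2) by (intro exI[of _ "(!) ks"] conjI) (auto simp: monotone_on_def)
qed

lemma path_perm_le:
  assumes gen: "is_perm \<pi>" and path: "\<not> path_free coord (points \<pi>)"
  shows "perm_le [2, 4, 1, 5, 3] \<pi> \<or> perm_le [3, 1, 5, 2, 4] \<pi>"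
proof -
  obtain p q r s t where S: "p \<in> points \<pi>" "q \<in> points \<pi>" "r \<in> points \<pi>" "s \<in> points \<pi>" "t \<in> points \<pi>"
    and "ind_path coord p q r s t" using path unfolding path_free_def by blast
  from ind_path_pattern[OF points_generic[OF gen] this] obtain u v w x y where
    S: "u \<in> points \<pi>" "v \<in> points \<pi>" "w \<in> points \<pi>" "x \<in> points \<pi>" "y \<in> points \<pi>"
    and o: "coord True u < coord True v \<and> coord True v < coord True w \<and> coord True w < coord True x \<and> coord True x < coord True y \<and>
    (coord False w < coord False u \<and> coord False u < coord False y \<and> coord False y < coord False v \<and> coord False v < coord False x \<or>
     coord False v < coord False x \<and> coord False x < coord False u \<and> coord False u < coord False y \<and> coord False y < coord False w)"
    by (elim bexE)
  have "\<exists>k<length \<pi>. z = (int k, int (\<pi> ! k))" if "z \<in> points \<pi>" for z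
    using that unfolding points_def by blast
  then obtain k1 k2 k3 k4 k5 where k: "k1 < length \<pi>" "k2 < length \<pi>" "k3 < length \<pi>" "k4 < length \<pi>" "k5 < length \<pi>"
    "u = (int k1, int (\<pi> ! k1))" "v = (int k2, int (\<pi> ! k2))" "w = (int k3, int (\<pi> ! k3))"
    "x = (int k4, int (\<pi> ! k4))" "y = (int k5, int (\<pi> ! k5))"
    using S by meson
  have five: "(i, j) \<in> {(0,1),(0,2),(0,3),(0,4),(1,2),(1,3),(1,4),(2,3),(2,4),(3,4)}" if "i < j" "j < (5::nat)" for i j
  proof -
    have "j = 0 \<or> j = 1 \<or> j = 2 \<or> j = 3 \<or> j = 4" using that(2) by auto
    then show ?thesis using that(1) by (elim disjE) auto
  qed
  from o have "k1 < k2" "k2 < k3" "k3 < k4" "k4 < k5" unfolding k by auto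
  note ks = this
  consider "\<pi> ! k3 < \<pi> ! k1" "\<pi> ! k1 < \<pi> ! k5" "\<pi> ! k5 < \<pi> ! k2" "\<pi> ! k2 < \<pi> ! k4"
    | "\<pi> ! k2 < \<pi> ! k4" "\<pi> ! k4 < \<pi> ! k1" "\<pi> ! k1 < \<pi> ! k5" "\<pi> ! k5 < \<pi> ! k3"
    using o unfolding k by auto
  then show ?thesis
  proof cases
    case 1
    have "perm_le [2, 4, 1, 5, 3] \<pi>"
    proof (rule perm_leI[of "[k1, k2, k3, k4, k5]"])
      fix i j assume "i < j" "j < length [k1, k2, k3, k4, k5]"
      then have "(i, j) \<in> {(0,1),(0,2),(0,3),(0,4),(1,2),(1,3),(1,4),(2,3),(2,4),(3,4)}" using five by simp
      then show "[k1, k2, k3, k4, k5] ! i < [k1, k2, k3, k4, k5] ! j"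
        "\<pi> ! ([k1, k2, k3, k4, k5] ! i) < \<pi> ! ([k1, k2, k3, k4, k5] ! j) \<and> [2, 4, 1, 5, 3::nat] ! i < [2, 4, 1, 5, 3] ! j \<or>
        \<pi> ! ([k1, k2, k3, k4, k5] ! j) < \<pi> ! ([k1, k2, k3, k4, k5] ! i) \<and> [2, 4, 1, 5, 3::nat] ! j < [2, 4, 1, 5, 3] ! i"
        using ks 1 by auto
    qed (use k(1-5) in auto)
    then show ?thesis by simp
  next
    case 2
    have "perm_le [3, 1, 5, 2, 4] \<pi>"
    proof (rule perm_leI[of "[k1, k2, k3, k4, k5]"])
      fix i j assume "i < j" "j < length [k1, k2, k3, k4, k5]"
      then have "(i, j) \<in> {(0,1),(0,2),(0,3),(0,4),(1,2),(1,3),(1,4),(2,3),(2,4),(3,4)}" using five by simp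
      then show "[k1, k2, k3, k4, k5] ! i < [k1, k2, k3, k4, k5] ! j"
        "\<pi> ! ([k1, k2, k3, k4, k5] ! i) < \<pi> ! ([k1, k2, k3, k4, k5] ! j) \<and> [3, 1, 5, 2, 4::nat] ! i < [3, 1, 5, 2, 4] ! j \<or>
        \<pi> ! ([k1, k2, k3, k4, k5] ! j) < \<pi> ! ([k1, k2, k3, k4, k5] ! i) \<and> [3, 1, 5, 2, 4::nat] ! j < [3, 1, 5, 2, 4] ! i"
        using ks 2 by auto
    qed (use k(1-5) in auto)
    then show ?thesis by simp
  qed
qed

lemma decreasing_perm_le:
  assumes K: "K \<subseteq> points \<pi>" "card K = l" "decreasing coord K"
  shows "perm_le (decreasing_perm l) \<pi>"
proof -
  define I where "I = {k. k < length \<pi> \<and> (int k, int (\<pi> ! k)) \<in> K}"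
  have "K = (\<lambda>i. (int i, int (\<pi> ! i))) ` I" using K(1) unfolding I_def points_def by blast
  moreover have "inj_on (\<lambda>i. (int i, int (\<pi> ! i))) I" by (simp add: inj_on_def)
  ultimately have cI: "card I = l" using K(2) card_image by metis
  have fin: "finite I" unfolding I_def by simp
  define ks where "ks = sorted_list_of_set I"
  have ks: "set ks = I" "length ks = l" "sorted_wrt (<) ks"
    using fin cI unfolding ks_def by simp_all
  have len: "length (decreasing_perm l) = l" by (simp add: decreasing_perm_def)
  have nth: "decreasing_perm l ! i = l - i" if "i < l" for i
    using that by (simp add: decreasing_perm_def rev_nth del: upt_Suc)
  show ?thesis
  proof (rule perm_leI[of ks])
    show "length ks = length (decreasing_perm l)" using len ks(2) by simp
    show "k < length \<pi>" if "k \<in> set ks" for k using that ks(1) unfolding I_def by blast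
    fix i j assume ij: "i < j" "j < length ks"
    then show lt: "ks ! i < ks ! j" using ks(3) sorted_wrt_nth_less by blast
    have "ks ! i \<in> I" "ks ! j \<in> I" using ks(1) ij nth_mem[of _ ks] by auto
    then have "adj coord (int (ks ! i), int (\<pi> ! (ks ! i))) (int (ks ! j), int (\<pi> ! (ks ! j)))"
      using K(3) lt unfolding decreasing_def I_def by auto
    then have "\<pi> ! (ks ! j) < \<pi> ! (ks ! i)" using lt by (auto simp: adj_iff[of _ _ _ True])
    moreover have "decreasing_perm l ! j < decreasing_perm l ! i" using nth ij ks(2) by auto
    ultimately show "\<pi> ! (ks ! i) < \<pi> ! (ks ! j) \<and> decreasing_perm l ! i < decreasing_perm l ! j \<or>
      \<pi> ! (ks ! j) < \<pi> ! (ks ! i) \<and> decreasing_perm l ! j < decreasing_perm l ! i" by blast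
  qed
qed

lemma Av_bounded_class:
  assumes "\<pi> \<in> Av {[2, 4, 1, 5, 3], [3, 1, 5, 2, 4], decreasing_perm l}"
  shows "bounded_class l coord (points \<pi>)"
  using assms points_generic[of \<pi>] path_perm_le[of \<pi>] decreasing_perm_le[of _ \<pi> l]
  unfolding Av_def bounded_class_def by blast

text \<open>An infinite antichain contains an injective sequence, and a good pair among its images
  is a comparable pair of distinct elements.\<close>

lemma well_quasi_orderedI:
  fixes A :: "'a set"
  assumes wqo: "wqo_on Q B" and B: "\<And>x. x \<in> A \<Longrightarrow> \<phi> x \<in> B"
    and le: "\<And>x y. x \<in> A \<Longrightarrow> y \<in> A \<Longrightarrow> Q (\<phi> x) (\<phi> y) \<Longrightarrow> le x y"
  shows "well_quasi_ordered le A"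
  unfolding well_quasi_ordered_def
proof
  assume "\<exists>S\<subseteq>A. infinite S \<and> pairwise (\<lambda>x y. \<not> le x y \<and> \<not> le y x) S"
  then obtain S where S: "S \<subseteq> A" "infinite S" "pairwise (\<lambda>x y. \<not> le x y \<and> \<not> le y x) S" by blast
  obtain f :: "nat \<Rightarrow> 'a" where f: "inj f" "range f \<subseteq> S"
    using infinite_countable_subset[OF S(2)] by blast
  then have fA: "f i \<in> A" for i using S(1) by blast
  obtain i j where ij: "i < j" "Q (\<phi> (f i)) (\<phi> (f j))"
    using wqo_onD[OF wqo, of "\<lambda>i. \<phi> (f i)"] B fA by blast
  have "f i \<noteq> f j" using ij(1) f(1) by (auto dest: injD)
  then have "\<not> le (f i) (f j)" using S(3) f(2) unfolding pairwise_def by blast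
  then show False using le[OF fA fA ij(2)] by blast
qed

section \<open>Permutation graphs\<close>

text \<open>Tails and heads in \<open>with_proj\<close> graphs are the projections, so the arc part
  of an isomorphism is determined by its vertex part.\<close>

lemma pair_iso_map:
  assumes "digraph_iso (with_proj A) (with_proj B)"
  obtains h where "bij_betw h (pverts A) (pverts B)"
    "\<And>u v. u \<in> pverts A \<Longrightarrow> v \<in> pverts A \<Longrightarrow> (u, v) \<in> parcs A \<longleftrightarrow> (h u, h v) \<in> parcs B"
    "parcs B \<subseteq> pverts B \<times> pverts B"
proof -
  obtain f where f: "pre_digraph.digraph_isomorphism (with_proj A) f" "with_proj B = app_iso f (with_proj A)"
    using assms unfolding digraph_iso_def by blast
  have wf: "wf_digraph (with_proj A)" and inj: "inj_on (iso_verts f) (pverts A)"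
    and ends: "\<And>a. a \<in> parcs A \<Longrightarrow> iso_verts f (fst a) = iso_tail f (iso_arcs f a) \<and>
      iso_verts f (snd a) = iso_head f (iso_arcs f a)"
    using f(1) unfolding pre_digraph.digraph_isomorphism_def by auto
  have B: "pverts B = iso_verts f ` pverts A" "parcs B = iso_arcs f ` parcs A" "iso_tail f = fst" "iso_head f = snd"
    using arg_cong[OF f(2), of verts] arg_cong[OF f(2), of arcs] arg_cong[OF f(2), of tail] arg_cong[OF f(2), of head]
    by simp_all
  have inA: "fst a \<in> pverts A \<and> snd a \<in> pverts A" if "a \<in> parcs A" for a
    using wf_digraph.tail_in_verts[OF wf] wf_digraph.head_in_verts[OF wf] that by auto
  have arc: "iso_arcs f a = (iso_verts f (fst a), iso_verts f (snd a))" if "a \<in> parcs A" for a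
    using ends[OF that] B(3,4) by (simp add: prod_eq_iff)
  show thesis
  proof (rule that)
    show "bij_betw (iso_verts f) (pverts A) (pverts B)" using inj B(1) unfolding bij_betw_def by simp
    fix u v assume uv: "u \<in> pverts A" "v \<in> pverts A"
    show "(u, v) \<in> parcs A \<longleftrightarrow> (iso_verts f u, iso_verts f v) \<in> parcs B"
    proof
      assume "(u, v) \<in> parcs A"
      then show "(iso_verts f u, iso_verts f v) \<in> parcs B" using arc[of "(u, v)"] B(2) by force
    next
      assume "(iso_verts f u, iso_verts f v) \<in> parcs B"
      then obtain a where a: "a \<in> parcs A" "(iso_verts f u, iso_verts f v) = iso_arcs f a" using B(2) by blast
      then have "u = fst a" "v = snd a" using arc[OF a(1)] inA[OF a(1)] inj uv by (auto dest: inj_onD)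
      then show "(u, v) \<in> parcs A" using a(1) by simp
    qed
  next
    show "parcs B \<subseteq> pverts B \<times> pverts B" using arc inA B(1,2) by auto
  qed
qed

lemma wf_with_projI: "parcs G \<subseteq> pverts G \<times> pverts G \<Longrightarrow> wf_digraph (with_proj G)"
  by unfold_locales auto

lemma induced_pair_subgraph:
  assumes "parcs G \<subseteq> pverts G \<times> pverts G" "V \<subseteq> pverts G"
  shows "induced_subgraph (with_proj \<lparr>pverts = V, parcs = parcs G \<inter> V \<times> V\<rparr>) (with_proj G)"
  unfolding induced_subgraph_def subgraph_def compatible_def
  using assms by (auto intro!: wf_with_projI)

lemma induced_subgraph_leI:
  assumes A: "parcs A \<subseteq> pverts A \<times> pverts A" and B: "parcs B \<subseteq> pverts B \<times> pverts B"
    and h: "inj_on h (pverts A)" "h ` pverts A \<subseteq> pverts B"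
    and arcs: "\<And>u v. u \<in> pverts A \<Longrightarrow> v \<in> pverts A \<Longrightarrow> (u, v) \<in> parcs A \<longleftrightarrow> (h u, h v) \<in> parcs B"
  shows "induced_subgraph_le A B"
proof -
  let ?V = "h ` pverts A"
  let ?H = "with_proj \<lparr>pverts = ?V, parcs = parcs B \<inter> ?V \<times> ?V\<rparr>"
  let ?f = "\<lparr>iso_verts = h, iso_arcs = map_prod h h, iso_head = snd, iso_tail = fst\<rparr>"
  have inj: "inj_on (map_prod h h) (parcs A)"
    using map_prod_inj_on[OF h(1) h(1)] A by (rule inj_on_subset)
  have "parcs B \<inter> ?V \<times> ?V = map_prod h h ` parcs A"
    using A arcs by force
  then have "?H = app_iso ?f (with_proj A)" by (simp add: app_iso_def with_proj_def)
  moreover have "pre_digraph.digraph_isomorphism (with_proj A) ?f"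
    unfolding pre_digraph.digraph_isomorphism_def using wf_with_projI[OF A] h(1) inj by simp
  ultimately show ?thesis
    unfolding induced_subgraph_le_def digraph_iso_def using induced_pair_subgraph[OF B h(2)] by blast
qed

text \<open>A point set stands in for the graph, so that \<open>emb\<close> can be turned into
  induced subgraph containment without returning to permutations.\<close>

definition represents :: "(int \<times> int) set \<Rightarrow> (int \<times> int \<Rightarrow> 'a) \<Rightarrow> 'a pair_pre_digraph \<Rightarrow> bool" where
  "represents S e G \<longleftrightarrow> generic coord S \<and> bij_betw e S (pverts G) \<and>
    (\<forall>x\<in>S. \<forall>y\<in>S. adj coord x y \<longleftrightarrow> (e x, e y) \<in> parcs G) \<and> parcs G \<subseteq> pverts G \<times> pverts G"

lemma representsD:
  assumes "represents S e G"
  shows "generic coord S" "bij_betw e S (pverts G)" "parcs G \<subseteq> pverts G \<times> pverts G"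
    "\<And>x y. x \<in> S \<Longrightarrow> y \<in> S \<Longrightarrow> adj coord x y \<longleftrightarrow> (e x, e y) \<in> parcs G"
  using assms unfolding represents_def by auto

lemma permutation_graph_points:
  assumes "permutation_graph G"
  shows "\<exists>S e. represents S e G"
proof -
  obtain \<pi> where \<pi>: "is_perm \<pi>" "digraph_iso (with_proj (perm_graph \<pi>)) (with_proj G)"
    using assms unfolding permutation_graph_def by blast
  obtain h where h: "bij_betw h (pverts (perm_graph \<pi>)) (pverts G)"
    "\<And>u v. u \<in> pverts (perm_graph \<pi>) \<Longrightarrow> v \<in> pverts (perm_graph \<pi>) \<Longrightarrow>
      (u, v) \<in> parcs (perm_graph \<pi>) \<longleftrightarrow> (h u, h v) \<in> parcs G"
    "parcs G \<subseteq> pverts G \<times> pverts G"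
    using pair_iso_map[OF \<pi>(2)] by metis
  \<comment> \<open>Positions in \<open>points\<close> start at \<open>0\<close>, the vertices of
    \<open>perm_graph\<close> at \<open>1\<close>.\<close>
  define k where "k x = Suc (nat (fst x))" for x :: "int \<times> int"
  have "bij_betw k (points \<pi>) (pverts (perm_graph \<pi>))"
    unfolding bij_betw_def
  proof
    show "inj_on k (points \<pi>)" unfolding inj_on_def k_def points_def by auto
    have "k ` points \<pi> = Suc ` {..<length \<pi>}" unfolding k_def points_def by (simp add: image_image)
    then show "k ` points \<pi> = pverts (perm_graph \<pi>)"
      by (simp add: perm_graph_def lessThan_atLeast0 image_Suc_atLeastLessThan atLeastLessThanSuc_atLeastAtMost)
  qed
  then have bij: "bij_betw (h \<circ> k) (points \<pi>) (pverts G)" using h(1) by (rule bij_betw_trans)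
  have "adj coord x y \<longleftrightarrow> ((h \<circ> k) x, (h \<circ> k) y) \<in> parcs G" if xy: "x \<in> points \<pi>" "y \<in> points \<pi>" for x y
  proof -
    obtain i j where ij: "i < length \<pi>" "j < length \<pi>" "x = (int i, int (\<pi> ! i))" "y = (int j, int (\<pi> ! j))"
      using xy unfolding points_def by blast
    have "adj coord x y \<longleftrightarrow> (k x, k y) \<in> parcs (perm_graph \<pi>)"
      using ij by (auto simp: adj_iff[of _ _ _ True] perm_graph_def k_def)
    also have "\<dots> \<longleftrightarrow> (h (k x), h (k y)) \<in> parcs G"
      using ij by (intro h(2)) (auto simp: perm_graph_def k_def)
    finally show ?thesis by simp
  qed
  then have "represents (points \<pi>) (h \<circ> k) G"
    unfolding represents_def using points_generic[OF \<pi>(1)] bij h(3) by simp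
  then show ?thesis by blast
qed

lemma graph_bounded_class:
  assumes rep: "represents S e G"
    and path: "\<not> induced_subgraph_le (path_graph 5) G"
    and clique: "\<not> (\<exists>H. induced_subgraph H (with_proj G) \<and> complete_digraph l H)"
  shows "bounded_class l coord S"
  unfolding bounded_class_def
proof (intro conjI notI)
  note gen = representsD(1)[OF rep] and e = representsD(2)[OF rep] and wf = representsD(3)[OF rep]
    and adj = representsD(4)[OF rep]
  have inj: "inj_on e S" and im: "e ` S = pverts G" using e unfolding bij_betw_def by auto
  show "generic coord S" by (rule gen)
  show "path_free coord S"
    unfolding path_free_def
  proof (intro ballI notI)
    fix p q r s t assume S: "p \<in> S" "q \<in> S" "r \<in> S" "s \<in> S" "t \<in> S" and P: "ind_path coord p q r s t"
    define f where "f i = [p, q, r, s, t] ! (i - 1)" for i :: nat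
    have V: "pverts (path_graph 5) = {1, 2, 3, 4, 5}"
      unfolding path_graph_def by auto
    have fv: "f 1 = p" "f 2 = q" "f 3 = r" "f 4 = s" "f 5 = t" by (simp_all add: f_def)
    have fS: "f i \<in> S" if "i \<in> pverts (path_graph 5)" for i using that S fv unfolding V by auto
    note PD = P[unfolded ind_path_def] 
    have sym: "adj coord x y = adj coord y x" for x y by (rule adj_sym)
    have arcs: "(i, j) \<in> parcs (path_graph 5) \<longleftrightarrow> adj coord (f i) (f j)"
      if "i \<in> pverts (path_graph 5)" "j \<in> pverts (path_graph 5)" for i j
      using that PD fv sym[of q p] sym[of r q] sym[of s r] sym[of t s] sym[of r p] sym[of s p] sym[of t p]
        sym[of s q] sym[of t q] sym[of t r]
      unfolding V by (auto simp: path_graph_def)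
    have ne: "p \<noteq> q" "p \<noteq> r" "p \<noteq> s" "p \<noteq> t" "q \<noteq> r" "q \<noteq> s" "q \<noteq> t" "r \<noteq> s" "r \<noteq> t" "s \<noteq> t"
      using PD sym[of p q] sym[of q s] sym[of q t] by auto
    have "inj_on f (pverts (path_graph 5))" unfolding V inj_on_def using fv ne by auto
    then have "inj_on (e \<circ> f) (pverts (path_graph 5))"
      using fS inj by (intro comp_inj_on) (auto intro: inj_on_subset)
    moreover have "(e \<circ> f) ` pverts (path_graph 5) \<subseteq> pverts G" using fS im by auto
    moreover have "(i, j) \<in> parcs (path_graph 5) \<longleftrightarrow> ((e \<circ> f) i, (e \<circ> f) j) \<in> parcs G"
      if "i \<in> pverts (path_graph 5)" "j \<in> pverts (path_graph 5)" for i j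
      using arcs[OF that] adj[OF fS[OF that(1)] fS[OF that(2)]] by simp
    moreover have "parcs (path_graph 5) \<subseteq> pverts (path_graph 5) \<times> pverts (path_graph 5)"
      by (auto simp: path_graph_def)
    ultimately have "induced_subgraph_le (path_graph 5) G" using wf by (intro induced_subgraph_leI)
    then show False using path by blast
  qed
  assume "\<exists>K\<subseteq>S. card K = l \<and> decreasing coord K"
  then obtain K where K: "K \<subseteq> S" "card K = l" "decreasing coord K" by blast
  have finK: "finite K" using K(1) gen unfolding generic_def by (meson finite_subset)
  let ?V = "e ` K"
  have V: "?V \<subseteq> pverts G" using K(1) im by blast
  have "card ?V = l" using K(1,2) card_image[OF inj_on_subset[OF inj K(1)]] by simp
  moreover have "parcs G \<inter> ?V \<times> ?V = {(u, v). (u, v) \<in> ?V \<times> ?V \<and> u \<noteq> v}"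
  proof -
    have "(e x, e y) \<in> parcs G \<longleftrightarrow> e x \<noteq> e y" if "x \<in> K" "y \<in> K" for x y
      using adj[of x y] K(1,3) that inj unfolding decreasing_def by (metis adj_irrefl inj_onD subsetD)
    then show ?thesis by auto
  qed
  ultimately have "complete_digraph l (with_proj \<lparr>pverts = ?V, parcs = parcs G \<inter> ?V \<times> ?V\<rparr>)"
    unfolding complete_digraph_pair_def using finK by simp
  then show False using clique induced_pair_subgraph[OF wf V] by blast
qed

text \<open>Adjacency is expressed by coordinate comparisons alone, so \<open>emb\<close> preserves
  it in both directions.\<close>

lemma emb_induced_subgraph_le:
  assumes emb: "emb S T" and G: "represents S d G" and H: "represents T e H"
  shows "induced_subgraph_le G H"
proof -
  note S = representsD(1)[OF G] and d = representsD(2)[OF G] representsD(4)[OF G] representsD(3)[OF G]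
    and e = representsD(2)[OF H] representsD(4)[OF H] representsD(3)[OF H]
  obtain f where f0: "f ` S \<subseteq> T \<and>
     (\<forall>p\<in>S. \<forall>q\<in>S. \<forall>d. coord d p < coord d q \<longleftrightarrow> coord d (f p) < coord d (f q))"
    using emb unfolding emb_def by (elim exE)
  then have f: "f ` S \<subseteq> T"
    "\<And>p q d. p \<in> S \<Longrightarrow> q \<in> S \<Longrightarrow> coord d p < coord d q \<longleftrightarrow> coord d (f p) < coord d (f q)"
    by auto
  have inj: "inj_on f S"
  proof (rule inj_onI)
    fix x y assume xy: "x \<in> S" "y \<in> S" "f x = f y"
    then have "coord True x = coord True y"
      using f(2)[of x y True] f(2)[of y x True] by force
    then show "x = y" using genericD[OF S xy(1,2)] by blast
  qed
  have adj: "adj coord x y \<longleftrightarrow> adj coord (f x) (f y)" if "x \<in> S" "y \<in> S" for x y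
    unfolding adj_def using f(2) that by simp
  define k where "k = the_inv_into S d"
  have k: "bij_betw k (pverts G) S" unfolding k_def by (rule bij_betw_the_inv_into[OF d(1)])
  have dk: "d (k u) = u" "k u \<in> S" if "u \<in> pverts G" for u
    using f_the_inv_into_f_bij_betw[OF d(1)] that bij_betwE[OF k] unfolding k_def by auto
  have fT: "f x \<in> T" if "x \<in> S" for x using f(1) that by blast
  have "inj_on (\<lambda>u. e (f (k u))) (pverts G)"
  proof (rule inj_onI)
    fix u v assume uv: "u \<in> pverts G" "v \<in> pverts G" "e (f (k u)) = e (f (k v))"
    have "inj_on e T" using e(1) unfolding bij_betw_def by blast
    then have "f (k u) = f (k v)" using uv(3) fT[OF dk(2)[OF uv(1)]] fT[OF dk(2)[OF uv(2)]] by (simp add: inj_on_eq_iff)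
    then have "k u = k v" using inj dk(2) uv by (simp add: inj_on_eq_iff)
    then show "u = v" using dk(1) uv by metis
  qed
  moreover have "(\<lambda>u. e (f (k u))) ` pverts G \<subseteq> pverts H"
    using fT dk(2) bij_betwE[OF e(1)] by blast
  moreover have "(u, v) \<in> parcs G \<longleftrightarrow> (e (f (k u)), e (f (k v))) \<in> parcs H"
    if uv: "u \<in> pverts G" "v \<in> pverts G" for u v
    using d(2)[OF dk(2)[OF uv(1)] dk(2)[OF uv(2)]] adj[OF dk(2)[OF uv(1)] dk(2)[OF uv(2)]]
      e(2)[OF fT[OF dk(2)[OF uv(1)]] fT[OF dk(2)[OF uv(2)]]] dk(1)[OF uv(1)] dk(1)[OF uv(2)] by simp
  ultimately show ?thesis using d(3) e(3) by (intro induced_subgraph_leI)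
qed

text \<open>Both halves send their objects to bounded point sets, by \<open>points\<close> and by a
  chosen representation, and pull back the well-quasi-order of \<open>emb\<close>.\<close>

theorem theorem4p6:
  shows "(\<forall>l\<ge>1. well_quasi_ordered perm_le
            (Av {[2, 4, 1, 5, 3], [3, 1, 5, 2, 4], decreasing_perm l})) \<and>
         (\<forall>l. well_quasi_ordered induced_subgraph_le
            {G :: 'a pair_pre_digraph. permutation_graph G \<and>
               \<not> induced_subgraph_le (path_graph 5) G \<and>
               \<not> (\<exists>H. induced_subgraph H (with_proj G) \<and> complete_digraph l H)})"
proof (intro conjI allI impI)
  fix l :: nat
  show "well_quasi_ordered perm_le (Av {[2, 4, 1, 5, 3], [3, 1, 5, 2, 4], decreasing_perm l})"
    by (rule well_quasi_orderedI[OF wqo_bounded_class[of l], of _ points])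
      (use Av_bounded_class emb_points_perm_le in blast)+
next
  fix l :: nat
  let ?A = "{G :: 'a pair_pre_digraph. permutation_graph G \<and> \<not> induced_subgraph_le (path_graph 5) G \<and>
    \<not> (\<exists>H. induced_subgraph H (with_proj G) \<and> complete_digraph l H)}"
  have "\<forall>G\<in>?A. \<exists>S. \<exists>e. represents S e G" by (intro ballI permutation_graph_points) simp
  from bchoice[OF this] obtain S where S: "\<forall>G\<in>?A. \<exists>e. represents (S G) e G" by (elim exE)
  show "well_quasi_ordered induced_subgraph_le ?A"
  proof (rule well_quasi_orderedI[OF wqo_bounded_class[of l], of _ S])
    fix G assume G: "G \<in> ?A"
    then obtain e where "represents (S G) e G" using S by auto
    then have "bounded_class l coord (S G)" using G graph_bounded_class[of "S G" e G l] by simp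
    then show "S G \<in> {S. bounded_class l coord S}" by simp
  next
    fix G H assume GH: "G \<in> ?A" "H \<in> ?A" "emb (S G) (S H)"
    obtain d where "represents (S G) d G" using S GH(1) by auto
    moreover obtain e where "represents (S H) e H" using S GH(2) by auto
    ultimately show "induced_subgraph_le G H" by (rule emb_induced_subgraph_le[OF GH(3)])
  qed
qed

end
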